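(* Let $k$ be $\mathbb{R}$ or $\mathbb{C}$, let $q\in k$ with $q\neq 0$, let $s\in[0,1]$, and let $E_s$ be the left coalgebra line bundle over the quantum two-sphere $S^2_{qs}\subseteq SU_q(2)$ (as defined in the context). Then $E_s$ is a finitely generated projective left $S^2_{qs}$-module. More precisely, the $2\times 2$ matrix with entries in $S^2_{qs}$ $$ e_s=\frac{1}{1+s^2}\begin{pmatrix}1-\zeta & \xi\\ -\eta & s^2+q^{-2}\zeta\end{pmatrix} $$ satisfies $e_s^2=e_s$, and the map $$ \Theta_s:(S^2_{qs})^2e_s\to E_s,\qquad (x,y)e_s\mapsto x(\alpha+s\beta)+y(\gamma+s\delta),\qquad x,y\in S^2_{qs}, $$ is well defined and is an isomorphism of left $S^2_{qs}$-modules, where $(S^2_{qs})^2e_s=\{(x,y)e_s : x,y\in S^2_{qs}\}$.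
   Context: $SU_q(2)$ is the unital associative $k$-algebra generated by $\alpha,\beta,\gamma,\delta$ subject to the relations $$\alpha\beta=q\beta\alpha,\quad \alpha\gamma=q\gamma\alpha,\quad \beta\gamma=\gamma\beta,\quad \beta\delta=q\delta\beta,\quad \gamma\delta=q\delta\gamma,$$ $$\alpha\delta=\delta\alpha+(q-q^{-1})\beta\gamma,\quad \alpha\delta-q\beta\gamma=1.$$ It is a Hopf algebra: writing $t=\begin{pmatrix}\alpha&\beta\\ \gamma&\delta\end{pmatrix}$, the coproduct is $\Delta(t_{ik})=\sum_{j=1}^2 t_{ij}\otimes t_{jk}$, the counit is $\epsilon(t_{ik})=\delta_{ik}$, and the antipode is $S(\alpha)=\delta$, $S(\beta)=-q^{-1}\beta$, $S(\gamma)=-q\gamma$, $S(\delta)=\alpha$. The quantum two-sphere $S^2_{qs}$ is the subalgebra of $SU_q(2)$ generated by $1$ and $$\xi=s(\alpha^2-q^{-1}\beta^2)+(s^2-1)q^{-1}\alpha\beta,\qquad \eta=s(q\gamma^2-\delta^2)+(s^2-1)\gamma\delta,$$ $$\zeta=s(q\alpha\gamma-\beta\delta)+(s^2-1)q\beta\gamma.$$ Let $J_s=\{\xi-s,\ \eta+s,\ \zeta\}\,SU_q(2)$ be the right ideal generated by $\xi-s,\eta+s,\zeta$, let $C_s=SU_q(2)/J_s$ be the quotient coalgebra, and let $\pi_s:SU_q(2)\to C_s$ be the canonical projection. The coalgebra $C_s$ coacts on $SU_q(2)$ from the right by $\Delta_{SU_q(2)}=(\mathrm{id}\otimes\pi_s)\circ\Delta$.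 The element $g_1^+=\pi_s(\alpha+s\beta)$ is group-like in $C_s$, so $k$ is a left $C_s$-comodule with coaction $1\mapsto g_1^+\otimes 1$. For a right $C$-comodule $P$ and a left $C$-comodule $V$ with coaction ${}_V\Delta:V\to C\otimes V$, the associated module is $E=\{\sum_i p^i\otimes v^i\in P\otimes V : \sum_i\Delta_P(p^i)\otimes v^i=\sum_i p^i\otimes{}_V\Delta(v^i)\}$. The line bundle $E_s$ is the left $S^2_{qs}$-module associated in this way to $P=SU_q(2)$, $C=C_s$ and $V=k$ with the left coaction ${}_k\Delta:k\to C_s\otimes k$, ${}_k\Delta(1)=g_1^+\otimes 1$. Identifying $P\otimes k$ with $P$, it is explicitly $$E_s=\{x(\alpha+s\beta)+y(\gamma+s\delta) : x,y\in S^2_{qs}\}.$$ *)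

theory Defs
  imports
    Complex_Main
    "HOL-Library.Poly_Mapping"
    "HOL-Algebra.Module"
    "HOL-Algebra.QuotRing"
    "HOL-Algebra.Subrings"
begin

text \<open>
  The ground field \<open>k\<close> is a type of class \<open>real_normed_field\<close>. Up to isomorphism this class contains
  exactly the real and the complex numbers (Mazur's theorem). Vector spaces and algebras over
  \<open>k\<close> are records of type \<open>module\<close>; for a plain vector space the fields \<open>mult\<close> and \<open>one\<close> carry no
  information.
\<close>

definition scalars :: "'k::field ring"
  where "scalars = \<lparr>carrier = UNIV, mult = (*), one = 1, zero = 0, add = (+)\<rparr>"


section \<open>Free vector spaces, quotients, tensor products\<close>

text \<open>
  The vector space with basis \<open>B\<close>, multiplied by bilinear extension of \<open>f\<close> on basis elements.
\<close>

definition free_space :: "'x set \<Rightarrow> ('x \<Rightarrow> 'x \<Rightarrow> 'x) \<Rightarrow> 'x \<Rightarrow> ('k::field, 'x \<Rightarrow>\<^sub>0 'k) module"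
  where "free_space B f e =
    \<lparr>carrier = {p. Poly_Mapping.keys p \<subseteq> B},
     mult = (\<lambda>p r. \<Sum>x\<in>Poly_Mapping.keys p. \<Sum>y\<in>Poly_Mapping.keys r.
        Poly_Mapping.single (f x y) (Poly_Mapping.lookup p x * Poly_Mapping.lookup r y)),
     one = Poly_Mapping.single e 1,
     zero = 0,
     add = (+),
     smult = (\<lambda>c. Poly_Mapping.map ((*) c))\<rparr>"

text \<open>
  The multiplication inherited from \<open>V Quot W\<close> is meaningful only when \<open>W\<close> is a two-sided ideal.
\<close>

definition quot_space :: "('k, 'v) module \<Rightarrow> 'v set \<Rightarrow> ('k, 'v set) module"
  where "quot_space V W =
    ring.extend (V Quot W) (module.fields (\<lambda>c Q. \<Union>x\<in>Q. W +>\<^bsub>V\<^esub> c \<odot>\<^bsub>V\<^esub> x))"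

definition lin_span :: "('k::field, 'v) module \<Rightarrow> 'v set \<Rightarrow> 'v set"
  where "lin_span V S = \<Inter>{H. submodule H (scalars :: 'k ring) V \<and> S \<subseteq> H}"

definition pair_space ::
  "('k::field, 'v) module \<Rightarrow> ('k, 'w) module \<Rightarrow> ('k, ('v \<times> 'w) \<Rightarrow>\<^sub>0 'k) module"
  where "pair_space V W =
    free_space (carrier V \<times> carrier W)
      (\<lambda>(v, w) (v', w'). (v \<otimes>\<^bsub>V\<^esub> v', w \<otimes>\<^bsub>W\<^esub> w')) (\<one>\<^bsub>V\<^esub>, \<one>\<^bsub>W\<^esub>)"

definition bilinear_rels ::
  "('k::field, 'v) module \<Rightarrow> ('k, 'w) module \<Rightarrow> (('v \<times> 'w) \<Rightarrow>\<^sub>0 'k) set"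
  where "bilinear_rels V W = (let \<delta> = (\<lambda>v w. Poly_Mapping.single (v, w) 1) in
      {\<delta> (v \<oplus>\<^bsub>V\<^esub> v') w - \<delta> v w - \<delta> v' w | v v' w.
          v \<in> carrier V \<and> v' \<in> carrier V \<and> w \<in> carrier W}
    \<union> {\<delta> v (w \<oplus>\<^bsub>W\<^esub> w') - \<delta> v w - \<delta> v w' | v w w'.
          v \<in> carrier V \<and> w \<in> carrier W \<and> w' \<in> carrier W}
    \<union> {\<delta> (c \<odot>\<^bsub>V\<^esub> v) w - Poly_Mapping.single (v, w) c | c v w.
          v \<in> carrier V \<and> w \<in> carrier W}
    \<union> {\<delta> v (c \<odot>\<^bsub>W\<^esub> w) - Poly_Mapping.single (v, w) c | c v w.
          v \<in> carrier V \<and> w \<in> carrier W})"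

definition tensor_kernel ::
  "('k::field, 'v) module \<Rightarrow> ('k, 'w) module \<Rightarrow> (('v \<times> 'w) \<Rightarrow>\<^sub>0 'k) set"
  where "tensor_kernel V W = lin_span (pair_space V W) (bilinear_rels V W)"

text \<open>
  For algebras \<open>V\<close> and \<open>W\<close> the multiplication of \<open>tensor V W\<close> is
  \<open>(v \<otimes> w)(v' \<otimes> w') = vv' \<otimes> ww'\<close>.
\<close>

definition tensor ::
  "('k::field, 'v) module \<Rightarrow> ('k, 'w) module \<Rightarrow> ('k, (('v \<times> 'w) \<Rightarrow>\<^sub>0 'k) set) module"
  where "tensor V W = quot_space (pair_space V W) (tensor_kernel V W)"

definition pure_tensor ::
  "('k::field, 'v) module \<Rightarrow> ('k, 'w) module \<Rightarrow> 'v \<Rightarrow> 'w \<Rightarrow> (('v \<times> 'w) \<Rightarrow>\<^sub>0 'k) set"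
  where "pure_tensor V W v w =
    tensor_kernel V W +>\<^bsub>pair_space V W\<^esub> Poly_Mapping.single (v, w) 1"

text \<open>
  Maps on quotients are unions over representatives: the values on all representatives of a
  coset are the same coset whenever the map is well defined.
\<close>

definition tensor_map ::
  "('k::field, 'a) module \<Rightarrow> ('k, 'b) module \<Rightarrow> ('a' \<Rightarrow> 'a) \<Rightarrow> ('b' \<Rightarrow> 'b) \<Rightarrow>
     (('a' \<times> 'b') \<Rightarrow>\<^sub>0 'k) set \<Rightarrow> (('a \<times> 'b) \<Rightarrow>\<^sub>0 'k) set"
  where "tensor_map V W \<phi> \<psi> Q = (\<Union>p\<in>Q.
    \<Oplus>\<^bsub>tensor V W\<^esub>x\<in>Poly_Mapping.keys p.
      Poly_Mapping.lookup p x \<odot>\<^bsub>tensor V W\<^esub> pure_tensor V W (\<phi> (fst x)) (\<psi> (snd x)))"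


section \<open>Generated subalgebras and right ideals; left modules\<close>

definition gen_subalgebra :: "('k, 'a) module \<Rightarrow> 'a set \<Rightarrow> 'a set"
  where "gen_subalgebra A S =
    \<Inter>{B. subring B A \<and> (\<forall>c. \<forall>b\<in>B. c \<odot>\<^bsub>A\<^esub> b \<in> B) \<and> S \<subseteq> B}"

definition right_ideal :: "'a set \<Rightarrow> ('a, 'b) ring_scheme \<Rightarrow> bool"
  where "right_ideal J R \<longleftrightarrow>
    additive_subgroup J R \<and> (\<forall>x\<in>J. \<forall>r\<in>carrier R. x \<otimes>\<^bsub>R\<^esub> r \<in> J)"

definition gen_right_ideal :: "('a, 'b) ring_scheme \<Rightarrow> 'a set \<Rightarrow> 'a set"
  where "gen_right_ideal R S = \<Inter>{J. right_ideal J R \<and> S \<subseteq> J}"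

text \<open>
  The library's locale \<open>module\<close> demands a commutative ring of scalars.
\<close>

locale left_module = R?: ring R + M?: abelian_group M
  for R :: "('r, 'x) ring_scheme" (structure) and M :: "('r, 'm) module" (structure) +
  assumes "\<lbrakk>a \<in> carrier R; x \<in> carrier M\<rbrakk> \<Longrightarrow> a \<odot>\<^bsub>M\<^esub> x \<in> carrier M"
    and "\<lbrakk>a \<in> carrier R; b \<in> carrier R; x \<in> carrier M\<rbrakk> \<Longrightarrow>
      (a \<oplus>\<^bsub>R\<^esub> b) \<odot>\<^bsub>M\<^esub> x = a \<odot>\<^bsub>M\<^esub> x \<oplus>\<^bsub>M\<^esub> b \<odot>\<^bsub>M\<^esub> x"
    and "\<lbrakk>a \<in> carrier R; x \<in> carrier M; y \<in> carrier M\<rbrakk> \<Longrightarrow>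
      a \<odot>\<^bsub>M\<^esub> (x \<oplus>\<^bsub>M\<^esub> y) = a \<odot>\<^bsub>M\<^esub> x \<oplus>\<^bsub>M\<^esub> a \<odot>\<^bsub>M\<^esub> y"
    and "\<lbrakk>a \<in> carrier R; b \<in> carrier R; x \<in> carrier M\<rbrakk> \<Longrightarrow>
      (a \<otimes>\<^bsub>R\<^esub> b) \<odot>\<^bsub>M\<^esub> x = a \<odot>\<^bsub>M\<^esub> (b \<odot>\<^bsub>M\<^esub> x)"
    and "x \<in> carrier M \<Longrightarrow> \<one>\<^bsub>R\<^esub> \<odot>\<^bsub>M\<^esub> x = x"

definition left_hom ::
  "('r, 'x) ring_scheme \<Rightarrow> ('r, 'm) module \<Rightarrow> ('r, 'n) module \<Rightarrow> ('m \<Rightarrow> 'n) set"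
  where "left_hom R M N = {f \<in> carrier M \<rightarrow> carrier N.
    (\<forall>x\<in>carrier M. \<forall>y\<in>carrier M. f (x \<oplus>\<^bsub>M\<^esub> y) = f x \<oplus>\<^bsub>N\<^esub> f y) \<and>
    (\<forall>a\<in>carrier R. \<forall>x\<in>carrier M. f (a \<odot>\<^bsub>M\<^esub> x) = a \<odot>\<^bsub>N\<^esub> f x)}"

definition left_iso ::
  "('r, 'x) ring_scheme \<Rightarrow> ('r, 'm) module \<Rightarrow> ('r, 'n) module \<Rightarrow> ('m \<Rightarrow> 'n) set"
  where "left_iso R M N = {f \<in> left_hom R M N. bij_betw f (carrier M) (carrier N)}"

definition left_finitely_generated :: "('r, 'x) ring_scheme \<Rightarrow> ('r, 'm) module \<Rightarrow> bool"
  where "left_finitely_generated R M \<longleftrightarrow> (\<exists>S. finite S \<and> S \<subseteq> carrier M \<and>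
    (\<forall>m\<in>carrier M. \<exists>c\<in>S \<rightarrow> carrier R. m = (\<Oplus>\<^bsub>M\<^esub>x\<in>S. c x \<odot>\<^bsub>M\<^esub> x)))"

text \<open>
  Projectivity as the lifting property along surjections \<open>g : N \<rightarrow> P\<close>. HOL cannot quantify over the
  types carrying \<open>N\<close> and \<open>P\<close> inside a definition, so these are parameters; a theorem that leaves
  them as type variables asserts the lifting property for all modules.
\<close>

definition left_projective ::
  "'n itself \<Rightarrow> 'p itself \<Rightarrow> ('r, 'x) ring_scheme \<Rightarrow> ('r, 'm) module \<Rightarrow> bool"
  where "left_projective _ _ R M \<longleftrightarrow>
    (\<forall>(N :: ('r, 'n) module) (P :: ('r, 'p) module).
      left_module R N \<and> left_module R P \<longrightarrow>
      (\<forall>g\<in>left_hom R N P. g ` carrier N = carrier P \<longrightarrow>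
        (\<forall>f\<in>left_hom R M P. \<exists>h\<in>left_hom R M N. \<forall>m\<in>carrier M. g (h m) = f m)))"


section \<open>The algebra \<open>SU\<^sub>q(2)\<close> and its coproduct\<close>

datatype gen = Al | Be | Ga | De

definition free_alg :: "('k::field, gen list \<Rightarrow>\<^sub>0 'k) module"
  where "free_alg = free_space UNIV (@) []"

definition free_gen :: "gen \<Rightarrow> gen list \<Rightarrow>\<^sub>0 'k::field"
  where "free_gen g = Poly_Mapping.single [g] 1"

definition SUq2_rels :: "'k::field \<Rightarrow> (gen list \<Rightarrow>\<^sub>0 'k) set"
  where "SUq2_rels q = (let F = free_alg;
      \<alpha> = free_gen Al; \<beta> = free_gen Be; \<gamma> = free_gen Ga; \<delta> = free_gen De in
    {\<alpha> \<otimes>\<^bsub>F\<^esub> \<beta> \<ominus>\<^bsub>F\<^esub> q \<odot>\<^bsub>F\<^esub> (\<beta> \<otimes>\<^bsub>F\<^esub> \<alpha>),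
     \<alpha> \<otimes>\<^bsub>F\<^esub> \<gamma> \<ominus>\<^bsub>F\<^esub> q \<odot>\<^bsub>F\<^esub> (\<gamma> \<otimes>\<^bsub>F\<^esub> \<alpha>),
     \<beta> \<otimes>\<^bsub>F\<^esub> \<gamma> \<ominus>\<^bsub>F\<^esub> \<gamma> \<otimes>\<^bsub>F\<^esub> \<beta>,
     \<beta> \<otimes>\<^bsub>F\<^esub> \<delta> \<ominus>\<^bsub>F\<^esub> q \<odot>\<^bsub>F\<^esub> (\<delta> \<otimes>\<^bsub>F\<^esub> \<beta>),
     \<gamma> \<otimes>\<^bsub>F\<^esub> \<delta> \<ominus>\<^bsub>F\<^esub> q \<odot>\<^bsub>F\<^esub> (\<delta> \<otimes>\<^bsub>F\<^esub> \<gamma>),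
     \<alpha> \<otimes>\<^bsub>F\<^esub> \<delta> \<ominus>\<^bsub>F\<^esub> (\<delta> \<otimes>\<^bsub>F\<^esub> \<alpha> \<oplus>\<^bsub>F\<^esub> (q - inverse q) \<odot>\<^bsub>F\<^esub> (\<beta> \<otimes>\<^bsub>F\<^esub> \<gamma>)),
     \<alpha> \<otimes>\<^bsub>F\<^esub> \<delta> \<ominus>\<^bsub>F\<^esub> q \<odot>\<^bsub>F\<^esub> (\<beta> \<otimes>\<^bsub>F\<^esub> \<gamma>) \<ominus>\<^bsub>F\<^esub> \<one>\<^bsub>F\<^esub>})"

definition SUq2_ideal :: "'k::field \<Rightarrow> (gen list \<Rightarrow>\<^sub>0 'k) set"
  where "SUq2_ideal q = Idl\<^bsub>free_alg\<^esub> (SUq2_rels q)"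

definition SUq2 :: "'k::field \<Rightarrow> ('k, (gen list \<Rightarrow>\<^sub>0 'k) set) module"
  where "SUq2 q = quot_space free_alg (SUq2_ideal q)"

definition SUq2_gen :: "'k::field \<Rightarrow> gen \<Rightarrow> (gen list \<Rightarrow>\<^sub>0 'k) set"
  where "SUq2_gen q g = SUq2_ideal q +>\<^bsub>free_alg\<^esub> free_gen g"

definition free_eval :: "('k::field, 'a) module \<Rightarrow> (gen \<Rightarrow> 'a) \<Rightarrow> (gen list \<Rightarrow>\<^sub>0 'k) \<Rightarrow> 'a"
  where "free_eval A t p = (\<Oplus>\<^bsub>A\<^esub>w\<in>Poly_Mapping.keys p.
    Poly_Mapping.lookup p w \<odot>\<^bsub>A\<^esub> foldr (\<lambda>g a. t g \<otimes>\<^bsub>A\<^esub> a) w \<one>\<^bsub>A\<^esub>)"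

type_synonym 'k SUq2_el = "(gen list \<Rightarrow>\<^sub>0 'k) set"
type_synonym 'k SUq2_tensor_el = "(('k SUq2_el \<times> 'k SUq2_el) \<Rightarrow>\<^sub>0 'k) set"

fun coproduct_gen :: "'k::field \<Rightarrow> gen \<Rightarrow> 'k SUq2_tensor_el"
  where
    "coproduct_gen q Al =
      pure_tensor (SUq2 q) (SUq2 q) (SUq2_gen q Al) (SUq2_gen q Al) \<oplus>\<^bsub>tensor (SUq2 q) (SUq2 q)\<^esub>
      pure_tensor (SUq2 q) (SUq2 q) (SUq2_gen q Be) (SUq2_gen q Ga)"
  | "coproduct_gen q Be =
      pure_tensor (SUq2 q) (SUq2 q) (SUq2_gen q Al) (SUq2_gen q Be) \<oplus>\<^bsub>tensor (SUq2 q) (SUq2 q)\<^esub>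
      pure_tensor (SUq2 q) (SUq2 q) (SUq2_gen q Be) (SUq2_gen q De)"
  | "coproduct_gen q Ga =
      pure_tensor (SUq2 q) (SUq2 q) (SUq2_gen q Ga) (SUq2_gen q Al) \<oplus>\<^bsub>tensor (SUq2 q) (SUq2 q)\<^esub>
      pure_tensor (SUq2 q) (SUq2 q) (SUq2_gen q De) (SUq2_gen q Ga)"
  | "coproduct_gen q De =
      pure_tensor (SUq2 q) (SUq2 q) (SUq2_gen q Ga) (SUq2_gen q Be) \<oplus>\<^bsub>tensor (SUq2 q) (SUq2 q)\<^esub>
      pure_tensor (SUq2 q) (SUq2 q) (SUq2_gen q De) (SUq2_gen q De)"

definition coproduct :: "'k::field \<Rightarrow> 'k SUq2_el \<Rightarrow> 'k SUq2_tensor_el"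
  where "coproduct q Q = (\<Union>p\<in>Q. free_eval (tensor (SUq2 q) (SUq2 q)) (coproduct_gen q) p)"


section \<open>The quantum two-sphere, the quotient coalgebra and the line bundle\<close>

definition sphere_xi :: "'k::real_normed_field \<Rightarrow> real \<Rightarrow> 'k SUq2_el"
  where "sphere_xi q s = (let A = SUq2 q; \<alpha> = SUq2_gen q Al; \<beta> = SUq2_gen q Be; \<sigma> = of_real s in
    \<sigma> \<odot>\<^bsub>A\<^esub> (\<alpha> \<otimes>\<^bsub>A\<^esub> \<alpha> \<ominus>\<^bsub>A\<^esub> inverse q \<odot>\<^bsub>A\<^esub> (\<beta> \<otimes>\<^bsub>A\<^esub> \<beta>))
    \<oplus>\<^bsub>A\<^esub> ((\<sigma>\<^sup>2 - 1) * inverse q) \<odot>\<^bsub>A\<^esub> (\<alpha> \<otimes>\<^bsub>A\<^esub> \<beta>))"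

definition sphere_eta :: "'k::real_normed_field \<Rightarrow> real \<Rightarrow> 'k SUq2_el"
  where "sphere_eta q s = (let A = SUq2 q; \<gamma> = SUq2_gen q Ga; \<delta> = SUq2_gen q De; \<sigma> = of_real s in
    \<sigma> \<odot>\<^bsub>A\<^esub> (q \<odot>\<^bsub>A\<^esub> (\<gamma> \<otimes>\<^bsub>A\<^esub> \<gamma>) \<ominus>\<^bsub>A\<^esub> \<delta> \<otimes>\<^bsub>A\<^esub> \<delta>)
    \<oplus>\<^bsub>A\<^esub> (\<sigma>\<^sup>2 - 1) \<odot>\<^bsub>A\<^esub> (\<gamma> \<otimes>\<^bsub>A\<^esub> \<delta>))"

definition sphere_zeta :: "'k::real_normed_field \<Rightarrow> real \<Rightarrow> 'k SUq2_el"
  where "sphere_zeta q s = (let A = SUq2 q; \<alpha> = SUq2_gen q Al; \<beta> = SUq2_gen q Be;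
      \<gamma> = SUq2_gen q Ga; \<delta> = SUq2_gen q De; \<sigma> = of_real s in
    \<sigma> \<odot>\<^bsub>A\<^esub> (q \<odot>\<^bsub>A\<^esub> (\<alpha> \<otimes>\<^bsub>A\<^esub> \<gamma>) \<ominus>\<^bsub>A\<^esub> \<beta> \<otimes>\<^bsub>A\<^esub> \<delta>)
    \<oplus>\<^bsub>A\<^esub> ((\<sigma>\<^sup>2 - 1) * q) \<odot>\<^bsub>A\<^esub> (\<beta> \<otimes>\<^bsub>A\<^esub> \<gamma>))"

definition qsphere :: "'k::real_normed_field \<Rightarrow> real \<Rightarrow> ('k, 'k SUq2_el) module"
  where "qsphere q s = (SUq2 q)\<lparr>carrier :=
    gen_subalgebra (SUq2 q) {\<one>\<^bsub>SUq2 q\<^esub>, sphere_xi q s, sphere_eta q s, sphere_zeta q s}\<rparr>"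

definition J_ideal :: "'k::real_normed_field \<Rightarrow> real \<Rightarrow> 'k SUq2_el set"
  where "J_ideal q s = (let A = SUq2 q; \<sigma> = of_real s in
    gen_right_ideal A {sphere_xi q s \<ominus>\<^bsub>A\<^esub> \<sigma> \<odot>\<^bsub>A\<^esub> \<one>\<^bsub>A\<^esub>,
      sphere_eta q s \<oplus>\<^bsub>A\<^esub> \<sigma> \<odot>\<^bsub>A\<^esub> \<one>\<^bsub>A\<^esub>, sphere_zeta q s})"

definition C_coalg :: "'k::real_normed_field \<Rightarrow> real \<Rightarrow> ('k, 'k SUq2_el set) module"
  where "C_coalg q s = quot_space (SUq2 q) (J_ideal q s)"

definition C_proj :: "'k::real_normed_field \<Rightarrow> real \<Rightarrow> 'k SUq2_el \<Rightarrow> 'k SUq2_el set"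
  where "C_proj q s a = J_ideal q s +>\<^bsub>SUq2 q\<^esub> a"

definition right_coaction ::
  "'k::real_normed_field \<Rightarrow> real \<Rightarrow> 'k SUq2_el \<Rightarrow> (('k SUq2_el \<times> 'k SUq2_el set) \<Rightarrow>\<^sub>0 'k) set"
  where "right_coaction q s a =
    tensor_map (SUq2 q) (C_coalg q s) id (C_proj q s) (coproduct q a)"

text \<open>The elements \<open>\<alpha> + s\<beta>\<close> and \<open>\<gamma> + s\<delta>\<close>.\<close>

definition row_upper :: "'k::real_normed_field \<Rightarrow> real \<Rightarrow> 'k SUq2_el"
  where "row_upper q s =
    SUq2_gen q Al \<oplus>\<^bsub>SUq2 q\<^esub> of_real s \<odot>\<^bsub>SUq2 q\<^esub> SUq2_gen q Be"

definition row_lower :: "'k::real_normed_field \<Rightarrow> real \<Rightarrow> 'k SUq2_el"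
  where "row_lower q s =
    SUq2_gen q Ga \<oplus>\<^bsub>SUq2 q\<^esub> of_real s \<odot>\<^bsub>SUq2 q\<^esub> SUq2_gen q De"

definition grouplike :: "'k::real_normed_field \<Rightarrow> real \<Rightarrow> 'k SUq2_el set"
  where "grouplike q s = C_proj q s (row_upper q s)"

text \<open>
  The module associated to \<open>P = SU\<^sub>q(2)\<close> and \<open>V = k\<close> with coaction \<open>1 \<mapsto> g \<otimes> 1\<close>: with \<open>P \<otimes> k\<close> and
  \<open>P \<otimes> C \<otimes> k\<close> identified with \<open>P\<close> and \<open>P \<otimes> C\<close>, the condition
  \<open>\<Delta>\<^sub>P(p) \<otimes> 1 = p \<otimes> \<Delta>\<^sub>V(1)\<close> reads \<open>\<Delta>\<^sub>P(p) = p \<otimes> g\<close>.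
\<close>

definition line_bundle :: "'k::real_normed_field \<Rightarrow> real \<Rightarrow> ('k SUq2_el, 'k SUq2_el) module"
  where "line_bundle q s =
    \<lparr>carrier = {p \<in> carrier (SUq2 q).
       right_coaction q s p = pure_tensor (SUq2 q) (C_coalg q s) p (grouplike q s)},
     mult = undefined,
     one = undefined,
     zero = \<zero>\<^bsub>SUq2 q\<^esub>,
     add = add (SUq2 q),
     smult = mult (SUq2 q)\<rparr>"


section \<open>The idempotent matrix\<close>

type_synonym 'a mat2 = "('a \<times> 'a) \<times> ('a \<times> 'a)"

fun row_times :: "('a, 'x) ring_scheme \<Rightarrow> 'a \<times> 'a \<Rightarrow> 'a mat2 \<Rightarrow> 'a \<times> 'a"
  where "row_times R (x, y) ((a, b), (c, d)) =
    (x \<otimes>\<^bsub>R\<^esub> a \<oplus>\<^bsub>R\<^esub> y \<otimes>\<^bsub>R\<^esub> c, x \<otimes>\<^bsub>R\<^esub> b \<oplus>\<^bsub>R\<^esub> y \<otimes>\<^bsub>R\<^esub> d)"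

fun mat_times :: "('a, 'x) ring_scheme \<Rightarrow> 'a mat2 \<Rightarrow> 'a mat2 \<Rightarrow> 'a mat2"
  where "mat_times R (r\<^sub>1, r\<^sub>2) M = (row_times R r\<^sub>1 M, row_times R r\<^sub>2 M)"

definition e_matrix :: "'k::real_normed_field \<Rightarrow> real \<Rightarrow> 'k SUq2_el mat2"
  where "e_matrix q s = (let A = SUq2 q; \<xi> = sphere_xi q s; \<eta> = sphere_eta q s; \<zeta> = sphere_zeta q s;
      \<sigma> = of_real s; c = inverse (1 + \<sigma>\<^sup>2) in
    ((c \<odot>\<^bsub>A\<^esub> (\<one>\<^bsub>A\<^esub> \<ominus>\<^bsub>A\<^esub> \<zeta>), c \<odot>\<^bsub>A\<^esub> \<xi>),
     (c \<odot>\<^bsub>A\<^esub> (\<ominus>\<^bsub>A\<^esub> \<eta>), c \<odot>\<^bsub>A\<^esub> (\<sigma>\<^sup>2 \<odot>\<^bsub>A\<^esub> \<one>\<^bsub>A\<^esub> \<oplus>\<^bsub>A\<^esub> inverse (q\<^sup>2) \<odot>\<^bsub>A\<^esub> \<zeta>))))"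

definition row_module :: "('k, 'a) module \<Rightarrow> 'a mat2 \<Rightarrow> ('a, 'a \<times> 'a) module"
  where "row_module R e =
    \<lparr>carrier = {row_times R (x, y) e | x y. x \<in> carrier R \<and> y \<in> carrier R},
     mult = undefined,
     one = undefined,
     zero = (\<zero>\<^bsub>R\<^esub>, \<zero>\<^bsub>R\<^esub>),
     add = (\<lambda>(x, y) (x', y'). (x \<oplus>\<^bsub>R\<^esub> x', y \<oplus>\<^bsub>R\<^esub> y')),
     smult = (\<lambda>b (x, y). (b \<otimes>\<^bsub>R\<^esub> x, b \<otimes>\<^bsub>R\<^esub> y))\<rparr>"

end

theory Submission
  imports Defs "HOL-Library.Product_Lexorder" "HOL-Library.Product_Plus"
begin

text \<open>
  Let \<open>A = SU\<^sub>q(2)\<close> and let \<open>X\<close> be the quantum sphere. Put \<open>u\<^sub>1 = \<alpha> + s\<beta>\<close>, \<open>u\<^sub>2 = \<gamma> + s\<delta>\<close> and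
  \<open>v\<^sub>1 = (\<delta> - sq\<gamma>) / (1 + s\<^sup>2)\<close>, \<open>v\<^sub>2 = (s\<alpha> - q\<^sup>-\<^sup>1\<beta>) / (1 + s\<^sup>2)\<close>. Multiplying out gives \<open>e = (u\<^sub>i v\<^sub>j)\<close> and
  \<open>v\<^sub>1 u\<^sub>1 + v\<^sub>2 u\<^sub>2 = 1\<close>, so \<open>e\<close> is idempotent, \<open>\<Theta>\<close> is multiplication of a row by the column \<open>u\<close>, and
  \<open>p \<mapsto> (p v\<^sub>1, p v\<^sub>2)\<close> inverts it on \<open>X u\<^sub>1 + X u\<^sub>2\<close>. The formula \<open>p = (p v\<^sub>1) u\<^sub>1 + (p v\<^sub>2) u\<^sub>2\<close> also exhibits
  this module as a direct summand of \<open>X\<^sup>2\<close>, whence it is projective.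

  The substance is that the line bundle, defined by the equation \<open>\<Delta>\<^sub>P(p) = p \<otimes> g\<close>, equals
  \<open>X u\<^sub>1 + X u\<^sub>2\<close>. One inclusion holds because \<open>X\<close> is a left coideal whose augmentation ideal generates \<open>J\<close>
  (\<open>coact_row\<close>). For the other one, if \<open>p\<close> solves the equation, then \<open>p v\<^sub>1\<close> and \<open>p v\<^sub>2\<close> are coinvariant under
  \<open>C\<close>, and it must be shown that every coinvariant element \<open>x\<close> lies in \<open>X\<close>. The parameters are
  arbitrary: \<open>q\<close> may be a root of unity, and if \<open>1 + q\<^sup>2\<^sup>ns\<^sup>2 = 0\<close> for some \<open>n\<close>, then \<open>C\<close> need
  not be spanned by group-like elements. The following argument does not distinguish cases.

  The map \<open>a \<otimes> c \<mapsto> a S(c\<^sub>1) \<otimes> c\<^sub>2\<close>, with \<open>S\<close> the antipode, inverts the Galois map and is well defined from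
  \<open>A \<otimes> C\<close> to the tensor square of \<open>A\<close> over \<open>X\<close>. It sends \<open>x\<^sub>1 \<otimes> \<pi>(x\<^sub>2)\<close> to \<open>1 \<otimes> x\<close> and \<open>x \<otimes> \<pi>(1)\<close> to
  \<open>x \<otimes> 1\<close>, so \<open>1 \<otimes> x = x \<otimes> 1\<close> over \<open>X\<close> for a coinvariant \<open>x\<close> (\<open>coinvariant_balanced\<close>). The sphere is a
  domain of polynomial growth, hence satisfies the Ore conditions (\<open>common_multiples\<close>), and therefore
  every finitely generated right \<open>X\<close>-submodule of \<open>A\<close> containing \<open>1\<close> has a right linear map \<open>\<phi>\<close> to the
  sphere with \<open>\<phi>(1) \<noteq> 0\<close> (\<open>right_hom_on_finite\<close>). As only finitely many elements witness
  \<open>1 \<otimes> x = x \<otimes> 1\<close>, such a \<open>\<phi>\<close> yields \<open>\<phi>(1) x = \<phi>(x)\<close>: a nonzero multiple of \<open>x\<close> lies in the sphere. Comparing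
  leading monomials, \<open>x\<close> itself does (\<open>sphere_saturated\<close>).

  Two devices make this computable. The algebra is embedded into the linear operators on
  functions on \<open>\<int>\<^sup>3\<close>, as a subalgebra of a quantum torus; the embedding is faithful since the
  Poincare-Birkhoff-Witt monomials have distinct leading exponents (\<open>ev_eq_0_iff\<close>). And tensors are
  handled through bilinear forms: two tensors agree iff all bilinear forms take the same value on
  them (\<open>tclass_eq_iff\<close>), so that \<open>\<Delta>\<close> becomes an action of the algebra on forms.
\<close>

abbreviation "single \<equiv> Poly_Mapping.single"
abbreviation "lookup \<equiv> Poly_Mapping.lookup"
abbreviation "keys \<equiv> Poly_Mapping.keys"

section \<open>Linear algebra\<close>

lemma (in vector_space) functional_separating:
  assumes "x \<notin> span S"
  shows "\<exists>f. Vector_Spaces.linear scale (*) f \<and> (\<forall>y\<in>S. f y = 0) \<and> f x = (1::'a)"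
proof -
  obtain B where B: "B \<subseteq> S" "independent B" "S \<subseteq> span B"
    using maximal_independent_subset by blast
  have "x \<notin> span B"
    using assms B(1) span_mono by blast
  then have ind: "independent (insert x B)"
    using B(2) independent_insertI by blast
  interpret field: vector_space "(*) :: 'a \<Rightarrow> 'a \<Rightarrow> 'a"
    by unfold_locales (simp_all add: algebra_simps)
  interpret pair: vector_space_pair scale "(*) :: 'a \<Rightarrow> 'a \<Rightarrow> 'a"
    by unfold_locales
  obtain f where f: "Vector_Spaces.linear scale (*) f"
    "\<forall>y\<in>insert x B. f y = (if y = x then 1 else 0)"
    using pair.linear_independent_extend[OF ind, of "\<lambda>y. if y = x then 1 else 0"] by blast
  have "f y = 0" if "y \<in> S" for y
    using pair.linear_eq_0_on_span[OF f(1), of B y] f(2) that B(3) \<open>x \<notin> span B\<close> span_base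
    by (metis insert_iff subsetD)
  then show ?thesis
    using f by auto
qed

lemma (in vector_space) linear_projection_onto:
  assumes "subspace V"
  shows "\<exists>p. Vector_Spaces.linear scale scale p \<and> range p \<subseteq> V \<and> (\<forall>v\<in>V. p v = v)"
proof -
  interpret pair: vector_space_pair scale scale
    by unfold_locales
  show ?thesis
    using pair.linear_exists_left_inverse_on[OF linear_id assms, simplified] by auto
qed

abbreviation pm_scale :: "'k::field \<Rightarrow> ('x \<Rightarrow>\<^sub>0 'k) \<Rightarrow> 'x \<Rightarrow>\<^sub>0 'k"
  where "pm_scale c \<equiv> Poly_Mapping.map ((*) c)"

lemma lookup_pm_scale [simp]: "lookup (pm_scale c p) x = c * lookup p x"
  by (simp add: Poly_Mapping.map.rep_eq when_def)

lemma pm_scale_single [simp]: "pm_scale c (single x d) = single x (c * d)"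
  by (simp add: Poly_Mapping.map_single)

interpretation pm: vector_space pm_scale
  by unfold_locales (auto intro!: poly_mapping_eqI simp: lookup_add algebra_simps)

definition lin_ext :: "('k::field \<Rightarrow> 'v \<Rightarrow> 'v) \<Rightarrow> ('x \<Rightarrow> 'v::ab_group_add) \<Rightarrow> ('x \<Rightarrow>\<^sub>0 'k) \<Rightarrow> 'v"
  where "lin_ext sca f p = (\<Sum>x\<in>keys p. sca (lookup p x) (f x))"

context vector_space
begin

lemma lin_ext_superset:
  assumes "finite K" "keys p \<subseteq> K"
  shows "lin_ext scale f p = (\<Sum>x\<in>K. scale (lookup p x) (f x))"
  unfolding lin_ext_def
  by (rule sum.mono_neutral_left) (use assms in \<open>auto simp: in_keys_iff\<close>)

lemma lin_ext_add: "lin_ext scale f (p + r) = lin_ext scale f p + lin_ext scale f r"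
proof -
  let ?K = "keys p \<union> keys r"
  have "keys (p + r) \<subseteq> ?K"
    by (rule Poly_Mapping.keys_add)
  then show ?thesis
    by (simp add: lin_ext_superset[of ?K] lookup_add scale_left_distrib sum.distrib)
qed

lemma lin_ext_scale: "lin_ext scale f (pm_scale c p) = scale c (lin_ext scale f p)"
proof -
  have "keys (pm_scale c p) \<subseteq> keys p"
    by (auto simp: in_keys_iff)
  then have "lin_ext scale f (pm_scale c p)
      = (\<Sum>x\<in>keys p. scale (c * lookup p x) (f x))"
    by (simp add: lin_ext_superset[of "keys p"])
  then show ?thesis
    by (simp add: lin_ext_def scale_sum_right)
qed

lemma lin_ext_zero [simp]: "lin_ext scale f 0 = 0"
  by (simp add: lin_ext_def)

lemma lin_ext_single [simp]: "lin_ext scale f (single x c) = scale c (f x)"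
  by (simp add: lin_ext_def)

lemma lin_ext_uminus: "lin_ext scale f (- p) = - lin_ext scale f p"
  using lin_ext_add[of f p "- p"] by (simp add: eq_neg_iff_add_eq_0 add.commute)

lemma lin_ext_diff: "lin_ext scale f (p - r) = lin_ext scale f p - lin_ext scale f r"
  using lin_ext_add[of f p "- r"] by (simp add: lin_ext_uminus)

lemma lin_ext_sum: "lin_ext scale f (sum P I) = (\<Sum>i\<in>I. lin_ext scale f (P i))"
  by (induction I rule: infinite_finite_induct) (simp_all add: lin_ext_add)

lemma linear_lin_ext:
  "Vector_Spaces.linear pm_scale scale (lin_ext scale f)"
  by (intro Vector_Spaces.linear_iff[THEN iffD2] conjI allI)
     (auto simp: lin_ext_add lin_ext_scale pm.vector_space_axioms vector_space_axioms)

end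

lemma pm_sum_singles: "p = (\<Sum>x\<in>keys p. single x (lookup p x))"
  by (rule poly_mapping_eqI)
     (simp add: lookup_sum lookup_single when_def in_keys_iff sum.delta)

lemma vector_space_field: "vector_space ((*) :: 'k::field \<Rightarrow> 'k \<Rightarrow> 'k)"
  by unfold_locales (simp_all add: algebra_simps)

lemmas pm_sum_add = vector_space.lin_ext_add[OF vector_space_field]
  and pm_sum_scale = vector_space.lin_ext_scale[OF vector_space_field]
  and pm_sum_single [simp] = vector_space.lin_ext_single[OF vector_space_field]
  and pm_sum_zero [simp] = vector_space.lin_ext_zero[OF vector_space_field]
  and pm_sum_diff = vector_space.lin_ext_diff[OF vector_space_field]
  and pm_sum_uminus = vector_space.lin_ext_uminus[OF vector_space_field]
  and pm_sum_sum = vector_space.lin_ext_sum[OF vector_space_field]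
  and linear_pm_sum = vector_space.linear_lin_ext[OF vector_space_field]

lemma linear_eq_lin_ext:
  assumes "Vector_Spaces.linear pm_scale (*) f"
  shows "f p = lin_ext (*) (\<lambda>x. f (single x 1)) p"
proof -
  interpret Vector_Spaces.linear pm_scale "(*)" f by fact
  have *: "single x c = pm_scale c (single x 1)" for x :: 'b and c :: 'a
    by simp
  have "f p = (\<Sum>x\<in>keys p. f (single x (lookup p x)))"
    by (subst pm_sum_singles[of p]) (simp add: sum)
  also have "\<dots> = lin_ext (*) (\<lambda>x. f (single x 1)) p"
    unfolding lin_ext_def by (rule sum.cong[OF refl], subst *, simp only: scale)
  finally show ?thesis .
qed

section \<open>Linear operators on functions on the lattice of exponents\<close>

type_synonym tri = "int \<times> int \<times> int"

text \<open>
  A quantum torus depends on the value \<open>q\<close> and so is not a type. Its regular representation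
  consists of linear operators, which form one ring type for all \<open>q\<close>. They act on arbitrary
  functions, so that a monomial is a shift given by a formula without finiteness conditions.
\<close>

definition linear_op :: "((tri \<Rightarrow> 'k::field) \<Rightarrow> tri \<Rightarrow> 'k) \<Rightarrow> bool"
  where "linear_op T \<longleftrightarrow> (\<forall>u v. T (\<lambda>n. u n + v n) = (\<lambda>n. T u n + T v n)) \<and>
    (\<forall>c u. T (\<lambda>n. c * u n) = (\<lambda>n. c * T u n))"

lemma linear_opI:
  assumes "\<And>u v n. T (\<lambda>n. u n + v n) n = T u n + T v n" "\<And>c u n. T (\<lambda>n. c * u n) n = c * T u n"
  shows "linear_op T"
  using assms by (auto simp: linear_op_def)

lemma linear_op_add: "linear_op T \<Longrightarrow> T (\<lambda>n. u n + v n) n = T u n + T v n"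
  and linear_op_scale: "linear_op T \<Longrightarrow> T (\<lambda>n. c * u n) n = c * T u n"
  by (simp_all add: linear_op_def)

typedef (overloaded) 'k qop = "{T :: (tri \<Rightarrow> 'k::field) \<Rightarrow> tri \<Rightarrow> 'k. linear_op T}"
  morphisms app Abs_qop
  by (rule exI[of _ "\<lambda>u. u"]) (simp add: linear_op_def)

setup_lifting type_definition_qop

instantiation qop :: (field) ring_1
begin

lift_definition zero_qop :: "'a qop" is "\<lambda>u n. 0"
  by (rule linear_opI) simp_all
lift_definition one_qop :: "'a qop" is "\<lambda>u. u"
  by (rule linear_opI) simp_all
lift_definition plus_qop :: "'a qop \<Rightarrow> 'a qop \<Rightarrow> 'a qop" is "\<lambda>S T u n. S u n + T u n"
  by (rule linear_opI)
     (simp_all only: linear_op_add linear_op_scale distrib_left add.assoc add.left_commute)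
lift_definition minus_qop :: "'a qop \<Rightarrow> 'a qop \<Rightarrow> 'a qop" is "\<lambda>S T u n. S u n - T u n"
  by (rule linear_opI)
     (simp_all only: linear_op_add linear_op_scale right_diff_distrib add_diff_add)
lift_definition uminus_qop :: "'a qop \<Rightarrow> 'a qop" is "\<lambda>T u n. - T u n"
  by (rule linear_opI)
     (simp_all only: linear_op_add linear_op_scale minus_add_distrib mult_minus_right)
lift_definition times_qop :: "'a qop \<Rightarrow> 'a qop \<Rightarrow> 'a qop" is "\<lambda>S T u. S (T u)"
  by (rule linear_opI) (auto simp only: linear_op_def)

instance
proof
  fix x y z :: "'a qop"
  show "(0::'a qop) \<noteq> 1"
    by transfer (metis zero_neq_one)
  show "x * (y + z) = x * y + x * z"
    by transfer (simp only: linear_op_def)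
qed (transfer; simp add: fun_eq_iff add.assoc add.commute; fail)+

end

lift_definition sc :: "'k::field \<Rightarrow> 'k qop" is "\<lambda>c u n. c * u n"
  by (rule linear_opI) (simp_all add: distrib_left mult.left_commute)

lemma app_0 [simp]: "app 0 u n = 0" and app_1 [simp]: "app 1 u = u"
  and app_add [simp]: "app (x + y) u n = app x u n + app y u n"
  and app_diff [simp]: "app (x - y) u n = app x u n - app y u n"
  and app_uminus [simp]: "app (- x) u n = - app x u n"
  and app_mult [simp]: "app (x * y) u = app x (app y u)"
  and app_sc [simp]: "app (sc c) u n = c * u n"
  by (transfer; simp)+

lemma app_scale: "app x (\<lambda>n. c * u n) = (\<lambda>n. c * app x u n)"
  by transfer (simp only: linear_op_def)

lemma qop_eqI: "(\<And>u n. app x u n = app y u n) \<Longrightarrow> x = y"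
  by transfer (simp add: fun_eq_iff)

lemma sc_0 [simp]: "sc 0 = 0" and sc_1 [simp]: "sc 1 = 1"
  by (rule qop_eqI; simp)+

lemma sc_add: "sc (x + y) = sc x + sc y" and sc_mult: "sc (x * y) = sc x * sc y"
  and sc_uminus: "sc (- x) = - sc x" and sc_diff: "sc (x - y) = sc x - sc y"
  by (rule qop_eqI; simp add: algebra_simps)+

lemma sc_central: "x * sc c = sc c * x"
proof (rule qop_eqI)
  fix u n
  have "app (sc c) u = (\<lambda>n. c * u n)"
    by (simp add: fun_eq_iff)
  then show "app (x * sc c) u n = app (sc c * x) u n"
    by (simp add: app_scale)
qed

lemma sc_left_commute: "x * (sc c * y) = sc c * (x * y)"
  by (metis mult.assoc sc_central)

lemma sc_mult_scaled: "sc c * x * (sc d * y) = sc (c * d) * (x * y)"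
proof -
  have "sc c * x * (sc d * y) = sc c * (x * (sc d * y))"
    by (rule mult.assoc)
  also have "x * (sc d * y) = sc d * (x * y)"
    by (rule sc_left_commute)
  finally show ?thesis
    by (simp add: sc_mult mult.assoc)
qed

interpretation op: vector_space "\<lambda>c x. sc c * x :: 'k::field qop"
  by unfold_locales (simp_all add: sc_add sc_mult distrib_left distrib_right mult.assoc)

text \<open>
  The monomial of exponents \<open>m = (D, i, k)\<close> stands for \<open>\<alpha>\<^sup>i \<beta>\<^sup>j \<gamma>\<^sup>k\<close> with \<open>i + j + k = D\<close>. Recording the
  total degree instead of \<open>j\<close> turns the degree-lexicographic order into the order of the product.
  The twist is the power of \<open>q\<close> from moving \<open>\<alpha>\<^sup>i\<close> past \<open>\<beta>\<^sup>j \<gamma>\<^sup>k\<close>.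
\<close>

definition twist :: "'k::field \<Rightarrow> tri \<Rightarrow> tri \<Rightarrow> 'k"
  where "twist q m n = q powi (- (fst (snd n) * (fst m - fst (snd m))))"

lift_definition mon :: "'k::field \<Rightarrow> tri \<Rightarrow> 'k qop"
  is "\<lambda>q m u n. twist q m (n - m) * u (n - m)"
  by (rule linear_opI) (simp_all add: distrib_left mult.left_commute)

lemma app_mon [simp]: "app (mon q m) u n = twist q m (n - m) * u (n - m)"
  by transfer simp

text \<open>
  For a combination of monomials this is the coefficient of a monomial: a monomial sends the
  function supported at the origin to the one supported at its exponent.
\<close>

definition cf :: "'k::field qop \<Rightarrow> tri \<Rightarrow> 'k"
  where "cf x = app x (\<lambda>n. if n = 0 then 1 else 0)"

lemma twist_0 [simp]: "twist q m 0 = 1" "twist q 0 m = 1"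
  by (simp_all add: twist_def)

lemma twist_nonzero [simp]: "q \<noteq> 0 \<Longrightarrow> twist q m n \<noteq> 0"
  by (simp add: twist_def power_int_not_zero)

lemma mon_0 [simp]: "mon q 0 = 1"
  by (rule qop_eqI) simp

lemma mon_mult:
  assumes "q \<noteq> 0"
  shows "mon q m * mon q n = sc (twist q m n) * mon q (m + n)"
proof -
  have "twist q m (l - m) * twist q n (l - m - n) = twist q m n * twist q (m + n) (l - (m + n))" for l
    using assms
    by (simp add: twist_def power_int_add[symmetric] algebra_simps)
  then show ?thesis
    by (intro qop_eqI) (simp add: diff_diff_eq mult.assoc[symmetric])
qed

lemma cf_add [simp]: "cf (x + y) n = cf x n + cf y n"
  and cf_diff [simp]: "cf (x - y) n = cf x n - cf y n"
  and cf_sc [simp]: "cf (sc c * x) n = c * cf x n"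
  and cf_0 [simp]: "cf 0 n = 0"
  and cf_1: "cf 1 n = (if n = 0 then 1 else 0)"
  by (simp_all add: cf_def)

lemma cf_sum: "cf (sum f I) n = (\<Sum>i\<in>I. cf (f i) n)"
  by (induction I rule: infinite_finite_induct) simp_all

lemma cf_mon: "cf (mon q m) n = (if n = m then 1 else 0)"
  by (simp add: cf_def)

definition torus :: "'k::field \<Rightarrow> 'k qop set"
  where "torus q = op.span (range (mon q))"

lemma torus_explicit:
  assumes "x \<in> torus q"
  obtains F where "finite F" "\<And>m. m \<notin> F \<Longrightarrow> cf x m = 0" "x = (\<Sum>m\<in>F. sc (cf x m) * mon q m)"
proof -
  have inj: "inj (mon q)"
    by (rule injI) (metis cf_mon zero_neq_one)
  obtain T r where T: "finite T" "T \<subseteq> range (mon q)" "x = (\<Sum>a\<in>T. sc (r a) * a)"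
    using assms unfolding torus_def op.span_explicit by auto
  obtain F where F: "finite F" "T = mon q ` F"
    using T(1,2) finite_subset_image by blast
  have x: "x = (\<Sum>m\<in>F. sc (r (mon q m)) * mon q m)"
    by (simp add: T(3) F(2) sum.reindex[OF inj_on_subset[OF inj subset_UNIV]])
  have cf: "cf x n = (if n \<in> F then r (mon q n) else 0)" for n
    by (simp add: x cf_sum cf_mon F(1) if_distrib[of "(*) _"] cong: if_cong)
  show ?thesis
    by (rule that[OF F(1)]) (auto simp: cf intro!: trans[OF x] sum.cong)
qed

lemma torus_mon [simp]: "mon q m \<in> torus q"
  unfolding torus_def by (rule op.span_base) simp

lemma torus_1 [simp]: "1 \<in> torus q"
  using torus_mon[of q 0] by simp

lemma torus_add [simp]: "x \<in> torus q \<Longrightarrow> y \<in> torus q \<Longrightarrow> x + y \<in> torus q"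
  and torus_diff [simp]: "x \<in> torus q \<Longrightarrow> y \<in> torus q \<Longrightarrow> x - y \<in> torus q"
  and torus_0 [simp]: "0 \<in> torus q"
  and torus_sc [simp]: "x \<in> torus q \<Longrightarrow> sc c * x \<in> torus q"
  unfolding torus_def
  by (rule op.span_add op.span_diff op.span_zero op.span_scale; assumption)+

lemma torus_sum: "(\<And>i. i \<in> I \<Longrightarrow> f i \<in> torus q) \<Longrightarrow> sum f I \<in> torus q"
  by (induction I rule: infinite_finite_induct) simp_all

lemma torus_mult [simp]:
  assumes "q \<noteq> 0" "x \<in> torus q" "y \<in> torus q"
  shows "x * y \<in> torus q"
proof -
  obtain F where F: "x = (\<Sum>m\<in>F. sc (cf x m) * mon q m)"
    by (rule torus_explicit[OF assms(2)])
  obtain G where G: "y = (\<Sum>m\<in>G. sc (cf y m) * mon q m)"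
    by (rule torus_explicit[OF assms(3)])
  have "x * y = (\<Sum>m\<in>F. \<Sum>n\<in>G. sc (cf x m) * mon q m * (sc (cf y n) * mon q n))"
    by (subst F, subst G) (rule sum_product)
  also have "\<dots> \<in> torus q"
    by (intro torus_sum) (simp add: sc_mult_scaled mon_mult[OF assms(1)])
  finally show ?thesis .
qed

lemma torus_power [simp]: "q \<noteq> 0 \<Longrightarrow> x \<in> torus q \<Longrightarrow> x ^ n \<in> torus q"
  by (induction n) simp_all

lemma cf_mult:
  assumes "finite F" "x = (\<Sum>m\<in>F. sc (cf x m) * mon q m)"
  shows "cf (x * y) n = (\<Sum>m\<in>F. cf x m * twist q m (n - m) * cf y (n - m))"
proof -
  have *: "cf (mon q m * y) n = twist q m (n - m) * cf y (n - m)" for m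
    by (simp add: cf_def)
  have "cf (x * y) n = cf (\<Sum>m\<in>F. sc (cf x m) * (mon q m * y)) n"
    by (subst assms(2)) (simp add: sum_distrib_right mult.assoc)
  then show ?thesis
    by (simp add: cf_sum * mult.assoc)
qed

section \<open>Leading exponents\<close>

lemma tri_add_less: "(m::tri) < n \<Longrightarrow> m + p < n + p"
  by (auto simp: less_prod_def' plus_prod_def)

lemma tri_add_le: "(m::tri) \<le> n \<Longrightarrow> m + p \<le> n + p"
  using tri_add_less[of m n p] by (auto simp: le_less)

lemma torus_eq_0_iff: "x \<in> torus q \<Longrightarrow> x = 0 \<longleftrightarrow> (\<forall>m. cf x m = 0)"
  by (erule torus_explicit) (metis (no_types, lifting) cf_0 mult_zero_left sc_0 sum.neutral)

lemma finite_support: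
  assumes "x \<in> torus q"
  shows "finite {m. cf x m \<noteq> 0}"
proof -
  obtain F where "finite F" "\<And>m. m \<notin> F \<Longrightarrow> cf x m = 0" "x = (\<Sum>m\<in>F. sc (cf x m) * mon q m)"
    by (rule torus_explicit[OF assms], rule that)
  then show ?thesis
    by (metis (mono_tags, lifting) finite_subset mem_Collect_eq subsetI)
qed

definition lead :: "'k::field qop \<Rightarrow> tri"
  where "lead x = Max {m. cf x m \<noteq> 0}"

lemma cf_lead_nonzero:
  assumes "x \<in> torus q" "x \<noteq> 0"
  shows "cf x (lead x) \<noteq> 0"
proof -
  have "{m. cf x m \<noteq> 0} \<noteq> {}"
    using torus_eq_0_iff[OF assms(1)] assms(2) by auto
  from Max_in[OF finite_support[OF assms(1)] this] show ?thesis
    by (simp add: lead_def)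
qed

lemma le_lead: "x \<in> torus q \<Longrightarrow> cf x m \<noteq> 0 \<Longrightarrow> m \<le> lead x"
  unfolding lead_def by (rule Max_ge) (use finite_support in auto)

lemma lead_eqI:
  assumes "x \<in> torus q" "cf x m \<noteq> 0" "\<And>n. m < n \<Longrightarrow> cf x n = 0"
  shows "lead x = m"
  using cf_lead_nonzero[OF assms(1)] le_lead[OF assms(1,2)] assms(2,3)
  by (metis cf_0 order.not_eq_order_implies_strict)

text \<open>
  The order of exponents is compatible with addition, so in the product only the two leading
  monomials contribute to the largest exponent. This makes the torus a domain.
\<close>

lemma lead_mult:
  assumes q: "q \<noteq> 0" and x: "x \<in> torus q" "x \<noteq> 0" and y: "y \<in> torus q" "y \<noteq> 0"
  shows "x * y \<noteq> 0" "lead (x * y) = lead x + lead y"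
    "cf (x * y) (lead x + lead y) = cf x (lead x) * twist q (lead x) (lead y) * cf y (lead y)"
proof -
  obtain F where F: "finite F" "\<And>m. m \<notin> F \<Longrightarrow> cf x m = 0" "x = (\<Sum>m\<in>F. sc (cf x m) * mon q m)"
    by (rule torus_explicit[OF x(1)], rule that)
  have cf: "cf (x * y) n = (\<Sum>m\<in>F. cf x m * twist q m (n - m) * cf y (n - m))" for n
    by (rule cf_mult[OF F(1,3)])
  have small: "cf x m * twist q m (n - m) * cf y (n - m) = 0"
    if "lead x + lead y \<le> n" "m \<noteq> lead x \<or> lead x + lead y < n" for m n
  proof (rule ccontr)
    assume "\<not> ?thesis"
    then have "cf x m \<noteq> 0" "cf y (n - m) \<noteq> 0"
      by auto
    then have le: "m \<le> lead x" "n - m \<le> lead y"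
      using le_lead x(1) y(1) by blast+
    have 1: "n \<le> lead y + m"
      using tri_add_le[OF le(2), of m] by simp
    have 2: "lead y + m \<le> lead y + lead x"
      using tri_add_le[OF le(1), of "lead y"] by (simp add: add.commute)
    show False
    proof (cases "m = lead x")
      case True
      then show ?thesis using that 1 by (auto simp: add.commute)
    next
      case False
      then have "lead y + m < lead y + lead x"
        using tri_add_less[of m "lead x" "lead y"] le(1) by (auto simp: add.commute)
      then show ?thesis using that(1) 1 by (auto simp: add.commute)
    qed
  qed
  let ?l = "lead x + lead y"
  have in_F: "lead x \<in> F"
    using F(2) cf_lead_nonzero[OF x] by blast
  show top: "cf (x * y) ?l = cf x (lead x) * twist q (lead x) (lead y) * cf y (lead y)"
    unfolding cf using small[of ?l]
    by (subst sum.remove[OF F(1) in_F]) (simp add: sum.neutral)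
  then have nz: "cf (x * y) ?l \<noteq> 0"
    using cf_lead_nonzero[OF x] cf_lead_nonzero[OF y] q by simp
  then show "x * y \<noteq> 0"
    by auto
  show "lead (x * y) = ?l"
  proof (rule lead_eqI[OF _ nz])
    show "x * y \<in> torus q" using q x y by simp
    show "cf (x * y) n = 0" if "?l < n" for n
      unfolding cf by (rule sum.neutral) (use small that in \<open>auto simp: less_imp_le\<close>)
  qed
qed

lemma torus_domain:
  "q \<noteq> 0 \<Longrightarrow> x \<in> torus q \<Longrightarrow> y \<in> torus q \<Longrightarrow> x * y = 0 \<longleftrightarrow> x = 0 \<or> y = 0"
  using lead_mult(1)[of q x y] by auto

lemma lead_power:
  assumes "q \<noteq> 0" "x \<in> torus q" "x \<noteq> 0"
  shows "x ^ n \<noteq> 0 \<and> lead (x ^ n) = (int n * fst (lead x), int n * fst (snd (lead x)), int n * snd (snd (lead x)))"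
proof (induction n)
  case 0
  have "lead (1 :: 'a qop) = 0"
    by (rule lead_eqI[of _ q]) (auto simp: cf_1)
  then show ?case by (simp add: zero_prod_def)
next
  case (Suc n)
  then show ?case
    using lead_mult[OF assms, of "x ^ n"] assms
    by (simp add: plus_prod_def algebra_simps)
qed

text \<open>
  Elements with distinct leading exponents cannot cancel each other's leading terms.
\<close>

lemma lead_combination:
  assumes "finite I" and f: "\<And>i. i \<in> I \<Longrightarrow> f i \<in> torus q \<and> f i \<noteq> 0"
    and inj: "inj_on (\<lambda>i. lead (f i)) I"
    and "i \<in> I" "c i \<noteq> 0"
  defines "x \<equiv> \<Sum>i\<in>I. sc (c i) * f i"
  shows "x \<noteq> 0" and "\<exists>j\<in>I. c j \<noteq> 0 \<and> lead x = lead (f j)" and "lead (f i) \<le> lead x"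
proof -
  define J where "J = {i\<in>I. c i \<noteq> 0}"
  define l where "l = Max ((\<lambda>i. lead (f i)) ` J)"
  have J: "finite J" "J \<noteq> {}" "i \<in> J"
    using assms(1,4,5) by (auto simp: J_def)
  have "l \<in> (\<lambda>i. lead (f i)) ` J"
    unfolding l_def using J by (intro Max_in) auto
  then obtain j where j: "j \<in> I" "c j \<noteq> 0" "l = lead (f j)"
    by (auto simp: J_def)
  have le: "lead (f i) \<le> l" if "i \<in> J" for i
    unfolding l_def using J that by (intro Max_ge) auto
  have cf: "cf x n = (\<Sum>i\<in>I. c i * cf (f i) n)" for n
    by (simp add: x_def cf_sum)
  have above: "c i * cf (f i) n = 0" if "i \<in> I" "l \<le> n" "i \<noteq> j \<or> l < n" for i n
  proof (rule ccontr)
    assume "\<not> ?thesis"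
    then have *: "i \<in> J" "cf (f i) n \<noteq> 0"
      using that by (auto simp: J_def)
    then have "n \<le> lead (f i)"
      using le_lead f that(1) by blast
    then have "n = l" "lead (f i) = l"
      using le[OF *(1)] that(2) by auto
    then show False
      using that j inj by (auto simp: inj_on_def)
  qed
  have "cf x l = c j * cf (f j) l"
    unfolding cf by (subst sum.remove[OF assms(1) j(1)]) (use above in \<open>simp add: sum.neutral\<close>)
  then have nz: "cf x l \<noteq> 0"
    using j cf_lead_nonzero f by auto
  then show "x \<noteq> 0" by auto
  have "lead x = l"
  proof (rule lead_eqI[OF _ nz])
    show "x \<in> torus q"
      unfolding x_def by (intro torus_sum) (use f in auto)
    show "cf x n = 0" if "l < n" for n
      unfolding cf by (rule sum.neutral) (use above that in auto)
  qed
  then show "\<exists>j\<in>I. c j \<noteq> 0 \<and> lead x = lead (f j)" "lead (f i) \<le> lead x"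
    using j le[OF J(3)] by auto
qed

section \<open>The generators\<close>

locale sl2q =
  fixes q :: "'k::field"
  assumes q [simp]: "q \<noteq> 0"
begin

definition "a = mon q (1, 1, 0)"
definition "b = mon q (1, 0, 0)"
definition "c = mon q (1, 0, 1)"
text \<open>
  The relation \<open>\<alpha>\<delta> = 1 + q\<beta>\<gamma>\<close> leaves no choice for \<open>\<delta>\<close> once \<open>\<alpha>\<close> is invertible.
\<close>

definition "d = mon q (-1, -1, 0) + sc q * mon q (1, -1, 1)"

lemma rels:
  "b * a = sc (inverse q) * (a * b)" "c * a = sc (inverse q) * (a * c)" "c * b = b * c"
  "b * d = sc q * (d * b)" "c * d = sc q * (d * c)"
  "a * d = 1 + sc q * (b * c)" "d * a = 1 + sc (inverse q) * (b * c)"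
  by (simp_all add: a_def b_def c_def d_def distrib_left distrib_right mon_mult twist_def mult.assoc
      sc_left_commute[of "mon q m" for m] plus_prod_def zero_prod_def[symmetric] power_int_minus
      field_simps power2_eq_square)

end

section \<open>The free algebra\<close>

text \<open>
  With words as an additive monoid under concatenation, the convolution product of finitely
  supported functions is the product of the free algebra.
\<close>

instantiation list :: (type) monoid_add
begin

definition zero_list :: "'a list" where "zero_list = []"

definition plus_list :: "'a list \<Rightarrow> 'a list \<Rightarrow> 'a list" where "plus_list = (@)"

instance
  by standard (simp_all add: zero_list_def plus_list_def)

end

lemma (in vector_space) span_family:
  assumes "x \<in> span (f ` I)"
  obtains F c where "finite F" "F \<subseteq> I" "x = (\<Sum>i\<in>F. scale (c i) (f i))"
proof -
  obtain T r where T: "finite T" "T \<subseteq> f ` I" "x = (\<Sum>y\<in>T. scale (r y) y)"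
    using assms unfolding span_explicit by auto
  let ?g = "inv_into I f"
  have g: "f (?g y) = y" "?g y \<in> I" if "y \<in> T" for y
    using that T(2) f_inv_into_f inv_into_into by (metis subsetD)+
  have "inj_on ?g T"
    by (metis g(1) inj_onI)
  from sum.reindex[OF this, of "\<lambda>i. scale (r (f i)) (f i)"]
  have "(\<Sum>i\<in>?g ` T. scale (r (f i)) (f i)) = x"
    using g by (simp add: T(3))
  then show ?thesis
    using that[of "?g ` T" "\<lambda>i. r (f i)"] T(1) g(2) by blast
qed

lemma free_mult: "(\<Sum>x\<in>keys p. \<Sum>y\<in>keys r.
    single (x @ y) (lookup p x * lookup r y)) = p * r"
proof -
  have "p * r = (\<Sum>x\<in>keys p. single x (lookup p x)) *
      (\<Sum>y\<in>keys r. single y (lookup r y))"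
    by (simp only: pm_sum_singles[symmetric])
  then show ?thesis
    by (simp only: sum_product mult_single plus_list_def)
qed

lemma free_alg_simps [simp]:
  "carrier (free_alg :: ('k::field, _) module) = UNIV" "mult (free_alg :: ('k, _) module) = (*)"
  "one (free_alg :: ('k, _) module) = 1" "zero (free_alg :: ('k, _) module) = 0"
  "add (free_alg :: ('k, _) module) = (+)" "smult (free_alg :: ('k, _) module) = pm_scale"
  by (simp_all add: free_alg_def free_space_def free_mult fun_eq_iff zero_list_def[symmetric])

lemma ring_free_alg: "ring (free_alg :: ('k::field, _) module)" (is "ring ?F")
proof (rule ringI)
  show "abelian_group ?F"
  proof (rule abelian_groupI)
    fix x :: "gen list \<Rightarrow>\<^sub>0 'k"
    show "\<exists>y\<in>carrier ?F. y \<oplus>\<^bsub>?F\<^esub> x = \<zero>\<^bsub>?F\<^esub>"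
      by (rule bexI[of _ "- x"]) simp_all
  qed (simp_all add: add_ac)
  show "monoid ?F"
    by (rule monoidI) (simp_all add: mult.assoc)
qed (simp_all add: distrib_left distrib_right)

lemma free_alg_uminus [simp]: "\<ominus>\<^bsub>free_alg\<^esub> x = - x"
  using abelian_group.minus_equality[OF ring.is_abelian_group[OF ring_free_alg], of "- x" x] by simp

lemma free_alg_minus [simp]: "x \<ominus>\<^bsub>free_alg\<^esub> y = x - y"
  by (simp add: a_minus_def)

lemma pm_scale_mult: "pm_scale c p = single [] c * p" for p :: "gen list \<Rightarrow>\<^sub>0 'k::field"
  using mult_map_scale_conv_mult[of c p] by (simp add: zero_list_def)

lemma pm_scale_central: "p * single [] c = pm_scale c p" for p :: "gen list \<Rightarrow>\<^sub>0 'k::field"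
proof -
  have "p * single [] c
      = (\<Sum>x\<in>keys p. single x (lookup p x)) * single [] c"
    by (simp only: pm_sum_singles[symmetric])
  also have "\<dots> = pm_scale c (\<Sum>x\<in>keys p. single x (lookup p x))"
    by (simp add: sum_distrib_right mult_single pm.scale_sum_right plus_list_def mult.commute)
  finally show ?thesis
    by (simp only: pm_sum_singles[symmetric])
qed

lemma pm_scale_times [simp]:
  "pm_scale c p * r = pm_scale c (p * r)" "p * pm_scale c r = pm_scale c (p * r)"
  for p :: "gen list \<Rightarrow>\<^sub>0 'k::field"
  by (metis pm_scale_mult mult.assoc, metis pm_scale_mult pm_scale_central mult.assoc)

lemma ideal_SUq2: "ideal (SUq2_ideal q) free_alg"
  unfolding SUq2_ideal_def by (rule ring.genideal_ideal[OF ring_free_alg]) simp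

lemma SUq2_ideal_closed [simp]:
  "0 \<in> SUq2_ideal q"
  "x \<in> SUq2_ideal q \<Longrightarrow> y \<in> SUq2_ideal q \<Longrightarrow> x + y \<in> SUq2_ideal q"
  "x \<in> SUq2_ideal q \<Longrightarrow> - x \<in> SUq2_ideal q"
  "x \<in> SUq2_ideal q \<Longrightarrow> x * y \<in> SUq2_ideal q"
  "x \<in> SUq2_ideal q \<Longrightarrow> y * x \<in> SUq2_ideal q"
  using additive_subgroup.zero_closed[OF ideal.axioms(1)[OF ideal_SUq2[of q]]]
    additive_subgroup.a_closed[OF ideal.axioms(1)[OF ideal_SUq2[of q]], of x y]
    ideal.I_l_closed[OF ideal_SUq2[of q], of x "- 1"]
    ideal.I_r_closed[OF ideal_SUq2[of q], of x y] ideal.I_l_closed[OF ideal_SUq2[of q], of x y]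
  by simp_all

lemma SUq2_ideal_diff [simp]:
  "x \<in> SUq2_ideal q \<Longrightarrow> y \<in> SUq2_ideal q \<Longrightarrow> x - y \<in> SUq2_ideal q"
  using SUq2_ideal_closed(2)[of x q "- y"] by simp

lemma SUq2_ideal_scale [simp]: "x \<in> SUq2_ideal q \<Longrightarrow> pm_scale c x \<in> SUq2_ideal q"
  by (simp add: pm_scale_mult)

lemma SUq2_ideal_minimal:
  assumes "SUq2_rels q \<subseteq> I" "0 \<in> I" "\<And>x y. x \<in> I \<Longrightarrow> y \<in> I \<Longrightarrow> x + y \<in> I"
    "\<And>x. x \<in> I \<Longrightarrow> - x \<in> I" "\<And>x y. x \<in> I \<Longrightarrow> x * y \<in> I" "\<And>x y. x \<in> I \<Longrightarrow> y * x \<in> I"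
  shows "SUq2_ideal q \<subseteq> I"
  unfolding SUq2_ideal_def
proof (rule ring.genideal_minimal[OF ring_free_alg])
  show "ideal I free_alg"
  proof (rule idealI[OF ring_free_alg])
    show "subgroup I (add_monoid free_alg)"
    proof (rule subgroup.intro)
      show "inv\<^bsub>add_monoid free_alg\<^esub> x \<in> I" if "x \<in> I" for x
        using free_alg_uminus[of x] assms(4)[OF that] by (simp only: a_inv_def)
    qed (use assms in auto)
  qed (use assms in auto)
qed (use assms in auto)

definition fgen :: "gen list \<Rightarrow> gen list \<Rightarrow>\<^sub>0 'k::field"
  where "fgen w = single w 1"

lemma fgen_mult: "fgen v * fgen w = fgen (v @ w)"
  by (simp add: fgen_def mult_single plus_list_def)

lemma fgen_Nil [simp]: "fgen [] = 1"
  by (simp add: fgen_def zero_list_def[symmetric])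

lemma free_gen_eq: "free_gen g = fgen [g]"
  by (simp add: free_gen_def fgen_def)

lemma SUq2_rels_eq: "SUq2_rels q =
  {fgen [Al, Be] - pm_scale q (fgen [Be, Al]), fgen [Al, Ga] - pm_scale q (fgen [Ga, Al]),
   fgen [Be, Ga] - fgen [Ga, Be], fgen [Be, De] - pm_scale q (fgen [De, Be]),
   fgen [Ga, De] - pm_scale q (fgen [De, Ga]),
   fgen [Al, De] - (fgen [De, Al] + pm_scale (q - inverse q) (fgen [Be, Ga])),
   fgen [Al, De] - pm_scale q (fgen [Be, Ga]) - 1}"
  by (simp add: SUq2_rels_def Let_def free_gen_eq fgen_mult)

section \<open>Monomial basis\<close>

definition SUq2_cong :: "'k::field \<Rightarrow> (gen list \<Rightarrow>\<^sub>0 'k) \<Rightarrow> (gen list \<Rightarrow>\<^sub>0 'k) \<Rightarrow> bool"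
  where "SUq2_cong q x y \<longleftrightarrow> x - y \<in> SUq2_ideal q"

lemma cong_refl [simp]: "SUq2_cong q x x"
  by (simp add: SUq2_cong_def)

lemma cong_sym: "SUq2_cong q x y \<Longrightarrow> SUq2_cong q y x"
  using SUq2_ideal_closed(3)[of "x - y" q] by (simp add: SUq2_cong_def)

lemma cong_trans [trans]: "SUq2_cong q x y \<Longrightarrow> SUq2_cong q y z \<Longrightarrow> SUq2_cong q x z"
  using SUq2_ideal_closed(2)[of "x - y" q "y - z"] by (simp add: SUq2_cong_def)

lemma cong_scale: "SUq2_cong q x y \<Longrightarrow> SUq2_cong q (pm_scale c x) (pm_scale c y)"
  using SUq2_ideal_scale[of "x - y" q c] by (simp add: SUq2_cong_def pm.scale_right_diff_distrib)

lemma cong_mult: "SUq2_cong q x y \<Longrightarrow> SUq2_cong q (u * x * v) (u * y * v)"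
  using SUq2_ideal_closed(4)[OF SUq2_ideal_closed(5), of "x - y" q u v]
  by (simp add: SUq2_cong_def left_diff_distrib right_diff_distrib)

lemma rel_in_ideal: "x \<in> SUq2_rels q \<Longrightarrow> x \<in> SUq2_ideal q"
  unfolding SUq2_ideal_def genideal_def by auto

lemma cong_rels:
  assumes "q \<noteq> 0"
  shows "SUq2_cong q (fgen [Be, Al]) (pm_scale (inverse q) (fgen [Al, Be]))"
    and "SUq2_cong q (fgen [Ga, Al]) (pm_scale (inverse q) (fgen [Al, Ga]))"
    and "SUq2_cong q (fgen [Ga, Be]) (pm_scale 1 (fgen [Be, Ga]))"
    and "SUq2_cong q (fgen [Be, De]) (pm_scale q (fgen [De, Be]))"
    and "SUq2_cong q (fgen [Ga, De]) (pm_scale q (fgen [De, Ga]))"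
    and "SUq2_cong q (fgen [Al, De]) (1 + pm_scale q (fgen [Be, Ga]))"
    and "SUq2_cong q (fgen [De, Al]) (1 + pm_scale (inverse q) (fgen [Be, Ga]))"
proof -
  note I = rel_in_ideal[of _ q, unfolded SUq2_rels_eq]
  have "SUq2_cong q (pm_scale (inverse q) (fgen [Al, Be])) (pm_scale (inverse q) (pm_scale q (fgen [Be, Al])))"
    by (rule cong_scale) (simp add: SUq2_cong_def I)
  then show "SUq2_cong q (fgen [Be, Al]) (pm_scale (inverse q) (fgen [Al, Be]))"
    using assms by (simp add: cong_sym)
  have "SUq2_cong q (pm_scale (inverse q) (fgen [Al, Ga])) (pm_scale (inverse q) (pm_scale q (fgen [Ga, Al])))"
    by (rule cong_scale) (simp add: SUq2_cong_def I)
  then show "SUq2_cong q (fgen [Ga, Al]) (pm_scale (inverse q) (fgen [Al, Ga]))"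
    using assms by (simp add: cong_sym)
  have "SUq2_cong q (fgen [Be, Ga]) (fgen [Ga, Be])"
    by (simp add: SUq2_cong_def I)
  then show "SUq2_cong q (fgen [Ga, Be]) (pm_scale 1 (fgen [Be, Ga]))"
    by (simp add: cong_sym)
  show "SUq2_cong q (fgen [Be, De]) (pm_scale q (fgen [De, Be]))"
    "SUq2_cong q (fgen [Ga, De]) (pm_scale q (fgen [De, Ga]))"
    by (simp_all add: SUq2_cong_def I)
  show ad: "SUq2_cong q (fgen [Al, De]) (1 + pm_scale q (fgen [Be, Ga]))"
    using I[of "fgen [Al, De] - pm_scale q (fgen [Be, Ga]) - 1"] by (simp add: SUq2_cong_def algebra_simps)
  have "fgen [Al, De] - (fgen [De, Al] + pm_scale (q - inverse q) (fgen [Be, Ga])) \<in> SUq2_ideal q"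
    by (simp add: I)
  from SUq2_ideal_diff[OF ad[unfolded SUq2_cong_def] this]
  show "SUq2_cong q (fgen [De, Al]) (1 + pm_scale (inverse q) (fgen [Be, Ga]))"
    by (simp add: SUq2_cong_def pm.scale_left_diff_distrib algebra_simps)
qed

lemma cong_move:
  assumes "SUq2_cong q (fgen [x, y]) (pm_scale r (fgen [y, x]))"
  shows "SUq2_cong q (fgen (u @ x # replicate n y @ v)) (pm_scale (r ^ n) (fgen (u @ replicate n y @ x # v)))"
proof (induction n arbitrary: u)
  case (Suc n)
  have "SUq2_cong q (fgen (u @ x # replicate (Suc n) y @ v)) (pm_scale r (fgen ((u @ [y]) @ x # replicate n y @ v)))"
    using cong_mult[OF assms, of "fgen u" "fgen (replicate n y @ v)"] by (simp add: fgen_mult)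
  also have "SUq2_cong q \<dots> (pm_scale r (pm_scale (r ^ n) (fgen ((u @ [y]) @ replicate n y @ x # v))))"
    by (rule cong_scale[OF Suc.IH])
  finally show ?case
    by simp
qed simp

text \<open>
  Because \<open>\<alpha>\<close> and \<open>\<delta>\<close> never occur together, one integer records both: a negative first exponent
  stands for a power of \<open>\<delta>\<close>.
\<close>

definition pbw_word :: "int \<times> nat \<times> nat \<Rightarrow> gen list"
  where "pbw_word = (\<lambda>(i, j, k). (if i \<ge> 0 then replicate (nat i) Al else replicate (nat (- i)) De)
    @ replicate j Be @ replicate k Ga)"

text \<open>
  The span is closed under left multiplication by letters: \<open>\<beta>\<close> and \<open>\<gamma>\<close> move past powers up to a
  scalar, and a product of \<open>\<alpha>\<close> and \<open>\<delta>\<close> cancels to \<open>1\<close> plus a multiple of \<open>\<beta>\<gamma>\<close>.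
\<close>

lemma pbw_spanning:
  assumes "q \<noteq> 0"
  shows "pm.span (range (\<lambda>n. fgen (pbw_word n)) \<union> SUq2_ideal q) = UNIV"
proof -
  let ?N = "pm.span (range (\<lambda>n. fgen (pbw_word n)) \<union> SUq2_ideal q)"
  have cong: "x \<in> ?N" if "SUq2_cong q x y" "y \<in> ?N" for x y
  proof -
    have "x - y \<in> ?N"
      using that(1) by (auto simp: SUq2_cong_def intro: pm.span_base)
    then show ?thesis
      using pm.span_add[OF _ that(2)] by fastforce
  qed
  have pos: "fgen (replicate i Al @ replicate j Be @ replicate k Ga) \<in> ?N" for i j k
    by (rule pm.span_base) (force simp: pbw_word_def intro!: image_eqI[of _ _ "(int i, j, k)"])
  have neg: "fgen (replicate i De @ replicate j Be @ replicate k Ga) \<in> ?N" for i j k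
  proof (cases "i = 0")
    case True
    then show ?thesis using pos[of 0] by simp
  next
    case False
    then show ?thesis
      by (intro pm.span_base) (force simp: pbw_word_def intro!: image_eqI[of _ _ "(- int i, j, k)"])
  qed
  have letters: "fgen (x # replicate i y @ replicate j Be @ replicate k Ga) \<in> ?N
      \<and> fgen (Be # Ga # replicate i y @ replicate j Be @ replicate k Ga) \<in> ?N"
    if x: "x \<in> {Be, Ga}" and y: "y \<in> {Al, De}" for x y i j k
  proof -
    have base: "fgen (replicate i y @ replicate j Be @ replicate k Ga) \<in> ?N" for j k
      using y pos neg by auto
    obtain r where r: "SUq2_cong q (fgen [Be, y]) (pm_scale r (fgen [y, Be]))"
      "SUq2_cong q (fgen [Ga, y]) (pm_scale r (fgen [y, Ga]))"
      using y cong_rels[OF assms] by blast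
    have Be: "SUq2_cong q (fgen (Be # replicate i y @ replicate j Be @ v))
        (pm_scale (r ^ i) (fgen (replicate i y @ replicate (Suc j) Be @ v)))" for j v
      using cong_move[OF r(1), of "[]" i "replicate j Be @ v"] by simp
    have Ga: "SUq2_cong q (fgen (u @ Ga # replicate i y @ replicate j Be @ replicate k Ga))
        (pm_scale (r ^ i) (fgen (u @ replicate i y @ replicate j Be @ replicate (Suc k) Ga)))" for u
    proof -
      have "SUq2_cong q (fgen (u @ Ga # replicate i y @ replicate j Be @ replicate k Ga))
          (pm_scale (r ^ i) (fgen ((u @ replicate i y) @ Ga # replicate j Be @ replicate k Ga)))"
        using cong_move[OF r(2), of u i] by simp
      also have "SUq2_cong q \<dots> (pm_scale (r ^ i) (pm_scale (1 ^ j)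
          (fgen ((u @ replicate i y) @ replicate j Be @ Ga # replicate k Ga))))"
        by (rule cong_scale[OF cong_move[OF cong_rels(3)[OF assms]]])
      finally show ?thesis
        by (simp add: replicate_append_same)
    qed
    have "fgen (Be # replicate i y @ replicate j Be @ replicate k Ga) \<in> ?N" for j k
      by (rule cong[OF Be]) (intro pm.span_scale base)
    moreover have "fgen (Ga # replicate i y @ replicate j Be @ replicate k Ga) \<in> ?N"
      by (rule cong[OF Ga[of "[]", simplified]]) (use base[of j "Suc k"] in \<open>simp add: pm.span_scale\<close>)
    moreover have "fgen (Be # Ga # replicate i y @ replicate j Be @ replicate k Ga) \<in> ?N"
      by (rule cong[OF Ga[of "[Be]", simplified]])
         (use calculation(1)[of j "Suc k"] in \<open>simp add: pm.span_scale\<close>)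
    ultimately show ?thesis
      using x by auto
  qed
  have cancel: "fgen (x # y # replicate i y @ replicate j Be @ replicate k Ga) \<in> ?N"
    if xy: "(x, y) = (Al, De) \<or> (x, y) = (De, Al)" for x y i j k
  proof -
    let ?v = "replicate i y @ replicate j Be @ replicate k Ga"
    obtain r where "SUq2_cong q (fgen [x, y]) (1 + pm_scale r (fgen [Be, Ga]))"
      using xy cong_rels[OF assms] by blast
    from cong_mult[OF this, of 1 "fgen ?v"]
    have "SUq2_cong q (fgen (x # y # ?v)) (fgen ?v + pm_scale r (fgen (Be # Ga # ?v)))"
      by (simp add: fgen_mult distrib_right)
    then show ?thesis
      by (rule cong) (intro pm.span_add pm.span_scale, use xy pos neg letters[of Be] in auto)
  qed
  have step: "fgen [x] * fgen (pbw_word n) \<in> ?N" for x n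
  proof -
    obtain i j k where n: "n = (i, j, k)"
      by (cases n)
    show ?thesis
    proof (cases "x \<in> {Be, Ga}")
      case True
      then show ?thesis
        using letters by (auto simp: n pbw_word_def fgen_mult)
    next
      case False
      show ?thesis
      proof (cases "i = 0 \<or> (x = Al \<longleftrightarrow> i > 0)")
        case True
        then show ?thesis
          using False pos[of "Suc (nat i)" j k] neg[of "Suc (nat (- i))" j k]
          by (cases x) (auto simp: n pbw_word_def fgen_mult)
      next
        case 2: False
        then obtain m where "nat \<bar>i\<bar> = Suc m"
          using not0_implies_Suc[of "nat \<bar>i\<bar>"] by auto
        then show ?thesis
          using 2 False cancel[of x Al m j k] cancel[of x De m j k]
          by (cases x) (auto simp: n pbw_word_def fgen_mult abs_if split: if_splits)
      qed
    qed
  qed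
  have mult: "fgen [x] * y \<in> ?N" if "y \<in> ?N" for x y
    using that
  proof (induction rule: pm.span_induct_alt)
    case base
    then show ?case by (simp add: pm.span_zero)
  next
    case (step c x' y')
    have "fgen [x] * x' \<in> ?N"
      using step(1) \<open>\<And>x n. fgen [x] * fgen (pbw_word n) \<in> ?N\<close> by (auto intro: pm.span_base)
    then show ?case
      using step(2) by (simp add: distrib_left pm.span_add pm.span_scale)
  qed
  have "fgen w \<in> ?N" for w
  proof (induction w)
    case Nil
    then show ?case using pos[of 0 0 0] by simp
  next
    case (Cons x w)
    then show ?case using mult[of "fgen w" x] by (simp add: fgen_mult)
  qed
  then have "single w r \<in> ?N" for w r
    using pm.span_scale[of "fgen w" _ r] by (simp add: fgen_def)
  then have "p \<in> ?N" for p
    by (subst pm_sum_singles) (rule pm.span_sum)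
  then show ?thesis by auto
qed

context sl2q
begin

fun gen_op :: "gen \<Rightarrow> 'k qop"
  where "gen_op Al = a" | "gen_op Be = b" | "gen_op Ga = c" | "gen_op De = d"

definition word_op :: "gen list \<Rightarrow> 'k qop"
  where "word_op w = prod_list (map gen_op w)"

definition ev :: "(gen list \<Rightarrow>\<^sub>0 'k) \<Rightarrow> 'k qop"
  where "ev = lin_ext (\<lambda>c x. sc c * x) word_op"

lemma word_op_simps [simp]: "word_op [] = 1" "word_op (g # w) = gen_op g * word_op w"
  "word_op (v @ w) = word_op v * word_op w"
  by (simp_all add: word_op_def)

lemma ev_add [simp]: "ev (p + r) = ev p + ev r"
  and ev_diff [simp]: "ev (p - r) = ev p - ev r"
  and ev_uminus [simp]: "ev (- p) = - ev p"
  and ev_scale [simp]: "ev (pm_scale t p) = sc t * ev p"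
  and ev_0 [simp]: "ev 0 = 0"
  and ev_single [simp]: "ev (single w t) = sc t * word_op w"
  and ev_sum: "ev (sum f I) = (\<Sum>i\<in>I. ev (f i))"
  unfolding ev_def by (rule op.lin_ext_add op.lin_ext_diff op.lin_ext_uminus op.lin_ext_scale
      op.lin_ext_zero op.lin_ext_single op.lin_ext_sum)+

lemma ev_fgen [simp]: "ev (fgen w) = word_op w"
  by (simp add: fgen_def)

lemma ev_1 [simp]: "ev 1 = 1"
  using ev_fgen[of "[]"] by simp

lemma ev_mult [simp]: "ev (p * r) = ev p * ev r"
proof -
  have "ev (p * r) = (\<Sum>v\<in>keys p. \<Sum>w\<in>keys r.
      sc (lookup p v) * word_op v * (sc (lookup r w) * word_op w))"
    unfolding free_mult[symmetric]
    by (simp add: ev_sum sc_mult_scaled)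
  then show ?thesis
    by (simp add: ev_def lin_ext_def sum_product)
qed

lemma ev_ideal: "p \<in> SUq2_ideal q \<Longrightarrow> ev p = 0"
proof -
  have "SUq2_ideal q \<subseteq> {p. ev p = 0}"
  proof (rule SUq2_ideal_minimal)
    have "a * b = sc q * (b * a)" "a * c = sc q * (c * a)"
      by (simp_all add: rels)
    moreover have "sc (q - inverse q) * (b * c) = sc q * (b * c) - sc (inverse q) * (b * c)"
      by (simp add: sc_diff left_diff_distrib)
    ultimately show "SUq2_rels q \<subseteq> {p. ev p = 0}"
      by (auto simp: SUq2_rels_eq rels(3-))
  qed auto
  then show "p \<in> SUq2_ideal q \<Longrightarrow> ev p = 0" by auto
qed

lemma gens_torus [simp]: "a \<in> torus q" "b \<in> torus q" "c \<in> torus q" "d \<in> torus q"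
  by (simp_all add: a_def b_def c_def d_def)

lemma lead_gens: "lead a = (1, 1, 0)" "lead b = (1, 0, 0)" "lead c = (1, 0, 1)" "lead d = (1, -1, 1)"
  by (rule lead_eqI[of _ q]; auto simp: a_def b_def c_def d_def cf_mon)+

lemma gens_nonzero [simp]: "a \<noteq> 0" "b \<noteq> 0" "c \<noteq> 0" "d \<noteq> 0"
proof -
  have "cf a (1, 1, 0) \<noteq> 0" "cf b (1, 0, 0) \<noteq> 0" "cf c (1, 0, 1) \<noteq> 0" "cf d (1, -1, 1) \<noteq> 0"
    by (simp_all add: a_def b_def c_def d_def cf_mon)
  then show "a \<noteq> 0" "b \<noteq> 0" "c \<noteq> 0" "d \<noteq> 0"
    by (metis cf_0)+
qed

lemma word_op_replicate [simp]: "word_op (replicate n g) = gen_op g ^ n"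
  by (induction n) simp_all

lemma pbw_lead:
  "word_op (pbw_word (i, j, k)) \<in> torus q" "word_op (pbw_word (i, j, k)) \<noteq> 0"
  "lead (word_op (pbw_word (i, j, k)))
    = (int (nat \<bar>i\<bar>) + int j + int k, i, (if i \<ge> 0 then 0 else - i) + int k)"
proof -
  define x where "x = (if i \<ge> 0 then a else d) ^ nat \<bar>i\<bar>"
  have x: "x \<in> torus q" "x \<noteq> 0" "lead x = (int (nat \<bar>i\<bar>), i, if i \<ge> 0 then 0 else - i)"
    using lead_power[OF q, of a "nat i"] lead_power[OF q, of d "nat (- i)"]
    by (auto simp: x_def lead_gens)
  have bj: "b ^ j \<in> torus q" "b ^ j \<noteq> 0" "lead (b ^ j) = (int j, 0, 0)"
    using lead_power[OF q, of b j] by (auto simp: lead_gens)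
  have ck: "c ^ k \<in> torus q" "c ^ k \<noteq> 0" "lead (c ^ k) = (int k, 0, int k)"
    using lead_power[OF q, of c k] by (auto simp: lead_gens)
  have eq: "word_op (pbw_word (i, j, k)) = x * (b ^ j * c ^ k)"
    by (simp add: pbw_word_def x_def)
  note bc = lead_mult[OF q bj(1,2) ck(1,2)]
  have bc_t: "b ^ j * c ^ k \<in> torus q" by simp
  note xbc = lead_mult[OF q x(1,2) bc_t bc(1)]
  show "word_op (pbw_word (i, j, k)) \<in> torus q" "word_op (pbw_word (i, j, k)) \<noteq> 0"
    "lead (word_op (pbw_word (i, j, k)))
    = (int (nat \<bar>i\<bar>) + int j + int k, i, (if i \<ge> 0 then 0 else - i) + int k)"
    unfolding eq using x bc_t xbc bc bj ck by (auto simp: plus_prod_def)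
qed

lemma pbw_lead_inj: "inj_on (\<lambda>n. lead (word_op (pbw_word n))) F"
  by (rule inj_onI) (auto simp: pbw_lead split: if_splits)

lemma ev_pbw:
  obtains F t where "finite F" "ev p = (\<Sum>n\<in>F. sc (t n) * word_op (pbw_word n))"
    "SUq2_cong q p (\<Sum>n\<in>F. pm_scale (t n) (fgen (pbw_word n)))"
proof -
  have "p \<in> pm.span (range (\<lambda>n. fgen (pbw_word n)) \<union> SUq2_ideal q)"
    by (simp add: pbw_spanning)
  then obtain h i where h: "h \<in> pm.span (range (\<lambda>n. fgen (pbw_word n)))"
    and i: "i \<in> pm.span (SUq2_ideal q)" and p: "p = h + i"
    by (auto simp: pm.span_Un)
  have i: "i \<in> SUq2_ideal q"
    using i by (induction rule: pm.span_induct_alt) simp_all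
  obtain F t where F: "finite F" "h = (\<Sum>n\<in>F. pm_scale (t n) (fgen (pbw_word n)))"
    using pm.span_family[OF h] by metis
  show ?thesis
    by (rule that[OF F(1), of t])
       (use i in \<open>simp_all add: p SUq2_cong_def F(2)[symmetric] ev_ideal, simp add: F(2) ev_sum\<close>)
qed

text \<open>
  The basis monomials span modulo the ideal, and their images have distinct leading exponents, so
  no combination of them is lost in the torus.
\<close>

lemma ev_eq_0_iff: "ev p = 0 \<longleftrightarrow> p \<in> SUq2_ideal q"
proof
  assume 0: "ev p = 0"
  obtain F t where F: "finite F" "ev p = (\<Sum>n\<in>F. sc (t n) * word_op (pbw_word n))"
    "SUq2_cong q p (\<Sum>n\<in>F. pm_scale (t n) (fgen (pbw_word n)))"
    by (rule ev_pbw)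
  have "t n = 0" if "n \<in> F" for n
  proof (rule ccontr)
    assume "t n \<noteq> 0"
    from lead_combination(1)[where f = "\<lambda>n. word_op (pbw_word n)" and q = q and c = t, OF F(1) _ pbw_lead_inj that this]
    show False
      using 0 F(2) pbw_lead by auto
  qed
  then have "(\<Sum>n\<in>F. pm_scale (t n) (fgen (pbw_word n))) = (0 :: gen list \<Rightarrow>\<^sub>0 'k)"
    by (intro sum.neutral) simp
  then show "p \<in> SUq2_ideal q"
    using F(3) by (simp add: SUq2_cong_def)
qed (rule ev_ideal)

definition alg :: "'k qop set"
  where "alg = range ev"

lemma alg_closed [simp]:
  "x \<in> alg \<Longrightarrow> y \<in> alg \<Longrightarrow> x + y \<in> alg" "x \<in> alg \<Longrightarrow> y \<in> alg \<Longrightarrow> x - y \<in> alg"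
  "x \<in> alg \<Longrightarrow> - x \<in> alg" "x \<in> alg \<Longrightarrow> y \<in> alg \<Longrightarrow> x * y \<in> alg" "x \<in> alg \<Longrightarrow> sc t * x \<in> alg"
  unfolding alg_def image_iff Bex_def
  by (metis UNIV_I ev_add, metis UNIV_I ev_diff, metis UNIV_I ev_uminus, metis UNIV_I ev_mult,
      metis UNIV_I ev_scale)

lemma gen_op_alg [simp]: "gen_op g \<in> alg"
  using rangeI[of ev "fgen [g]"] by (simp add: alg_def)

lemma alg_gens [simp]: "0 \<in> alg" "1 \<in> alg" "a \<in> alg" "b \<in> alg" "c \<in> alg" "d \<in> alg"
  using rangeI[of ev 0] rangeI[of ev 1] gen_op_alg[of Al] gen_op_alg[of Be] gen_op_alg[of Ga]
    gen_op_alg[of De]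
  by (simp_all add: alg_def)

lemma alg_torus:
  assumes "x \<in> alg"
  shows "x \<in> torus q"
proof -
  obtain F t where "finite F" "x = (\<Sum>n\<in>F. sc (t n) * word_op (pbw_word n))"
    using assms ev_pbw unfolding alg_def by (metis rangeE)
  then show ?thesis
    by (auto intro!: torus_sum simp: pbw_lead)
qed

text \<open>
  By lack of cancellation a leading exponent of the algebra is one of a basis monomial. Lower
  terms may violate the bounds: \<open>\<delta>\<close> involves \<open>\<alpha>\<^sup>-\<^sup>1\<close>, of negative degree.
\<close>

lemma alg_lead_bounds:
  assumes "x \<in> alg" "x \<noteq> 0" "lead x = (D, i, k)"
  shows "0 \<le> k" "k \<le> D" "\<bar>i\<bar> \<le> D"
proof -
  obtain F t where F: "finite F" "x = (\<Sum>n\<in>F. sc (t n) * word_op (pbw_word n))"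
    using assms(1) ev_pbw unfolding alg_def by (metis rangeE)
  have "\<exists>n\<in>F. t n \<noteq> 0"
  proof (rule ccontr)
    assume "\<not> ?thesis"
    then have "x = 0"
      unfolding F(2) by (intro sum.neutral) simp
    then show False
      using assms(2) by simp
  qed
  then obtain n where "n \<in> F" "t n \<noteq> 0"
    by blast
  from lead_combination(2)[where f = "\<lambda>n. word_op (pbw_word n)" and q = q and c = t, OF F(1) _ pbw_lead_inj this]
  obtain n where "lead x = lead (word_op (pbw_word n))"
    using F(2) pbw_lead by auto
  then show "0 \<le> k" "k \<le> D" "\<bar>i\<bar> \<le> D"
    using assms(3) by (cases n; auto simp: pbw_lead split: if_splits)+
qed

end

section \<open>The quantum sphere\<close>

text \<open>
  Applying functionals turns an identity of operators into one in the field, where arithmetic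
  collects like terms.
\<close>

lemma qop_eqI_functional:
  assumes "\<And>f. (\<And>x y. f (x + y) = f x + f y) \<Longrightarrow> (\<And>x y. f (x - y) = f x - f y) \<Longrightarrow>
    (\<And>x. f (- x) = - f x) \<Longrightarrow> (\<And>t x. f (sc t * x) = t * f x) \<Longrightarrow> f x = (f y :: 'k::field)"
  shows "x = (y :: 'k qop)"
proof (rule ccontr)
  assume "x \<noteq> y"
  then have "x - y \<notin> op.span {}"
    by simp
  from op.functional_separating[OF this] obtain f :: "'k qop \<Rightarrow> 'k"
    where f: "Vector_Spaces.linear (\<lambda>c x. sc c * x) (*) f" "f (x - y) = 1"
    by blast
  interpret Vector_Spaces.linear "\<lambda>c x. sc c * x :: 'k qop" "(*)" f by fact
  have "f x = f y"
    by (rule assms) (simp_all add: add diff neg scale)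
  then show False
    using f(2) by (simp add: diff)
qed

locale podles = sl2q q for q :: "'k::field" +
  fixes \<sigma> :: 'k
  assumes \<sigma>: "1 + \<sigma>\<^sup>2 \<noteq> 0"
begin

text \<open>With \<open>rels\<close> these rewrite words to combinations of words in which \<open>a\<close> or \<open>d\<close> precedes \<open>b\<close> and \<open>b\<close> precedes \<open>c\<close>.\<close>

lemma rels_assoc:
  "b * (a * x) = sc (inverse q) * (a * (b * x))" "c * (a * x) = sc (inverse q) * (a * (c * x))"
  "c * (b * x) = b * (c * x)"
  "b * (d * x) = sc q * (d * (b * x))" "c * (d * x) = sc q * (d * (c * x))"
  "a * (d * x) = x + sc q * (b * (c * x))" "d * (a * x) = x + sc (inverse q) * (b * (c * x))"
  by (simp_all add: mult.assoc[symmetric] rels) (simp_all add: rels distrib_right mult.assoc)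

lemma pull_sc:
  "a * sc t = sc t * a" "b * sc t = sc t * b" "c * sc t = sc t * c" "d * sc t = sc t * d"
  "a * (sc t * x) = sc t * (a * x)" "b * (sc t * x) = sc t * (b * x)"
  "c * (sc t * x) = sc t * (c * x)" "d * (sc t * x) = sc t * (d * x)"
  by (rule sc_central sc_left_commute)+

lemmas nf = rels rels_assoc pull_sc distrib_left distrib_right left_diff_distrib right_diff_distrib
  mult.assoc sc_mult[symmetric]

definition "xi = sc \<sigma> * (a * a - sc (inverse q) * (b * b)) + sc ((\<sigma>\<^sup>2 - 1) * inverse q) * (a * b)"
definition "eta = sc \<sigma> * (sc q * (c * c) - d * d) + sc (\<sigma>\<^sup>2 - 1) * (c * d)"
definition "zeta = sc \<sigma> * (sc q * (a * c) - b * d) + sc ((\<sigma>\<^sup>2 - 1) * q) * (b * c)"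

definition "u1 = a + sc \<sigma> * b"
definition "u2 = c + sc \<sigma> * d"
definition "w1 = d - sc (\<sigma> * q) * c"
definition "w2 = sc \<sigma> * a - sc (inverse q) * b"

text \<open>
  These are the factorization \<open>e = u v\<close> and \<open>v u = 1\<close>, cleared of the denominator \<open>1 + s\<^sup>2\<close>.
\<close>

lemma uw: "u1 * w1 = 1 - zeta" "u1 * w2 = xi" "u2 * w1 = - eta"
  "u2 * w2 = sc (\<sigma>\<^sup>2) + sc (inverse (q\<^sup>2)) * zeta"
  and wu: "w1 * u1 + w2 * u2 = sc (1 + \<sigma>\<^sup>2)"
proof -
  have s: "f (sc t) = t * f 1" if "\<And>t x. f (sc t * x) = t * f x" for f :: "'k qop \<Rightarrow> 'k" and t
    using that[of t 1] by simp
  show "u1 * w1 = 1 - zeta" "u1 * w2 = xi" "u2 * w1 = - eta"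
    "u2 * w2 = sc (\<sigma>\<^sup>2) + sc (inverse (q\<^sup>2)) * zeta" "w1 * u1 + w2 * u2 = sc (1 + \<sigma>\<^sup>2)"
    by (rule qop_eqI_functional,
        simp add: u1_def u2_def w1_def w2_def xi_def eta_def zeta_def nf s,
        simp add: field_simps power2_eq_square)+
qed

text \<open>The relations of the sphere are the four entries of \<open>e\<^sup>2 = e\<close>.\<close>

lemma uwuw: "u * w1 * (u1 * w) + u * w2 * (u2 * w) = sc (1 + \<sigma>\<^sup>2) * (u * w)"
proof -
  have "u * w1 * (u1 * w) + u * w2 * (u2 * w) = u * (w1 * u1 + w2 * u2) * w"
    by (simp add: distrib_left distrib_right mult.assoc)
  then show ?thesis
    by (simp only: wu sc_central[of u] mult.assoc)
qed

lemma sphere_rels: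
  "xi * zeta = sc (q\<^sup>2) * (zeta * xi)"
  "eta * zeta = sc (inverse (q\<^sup>2)) * (zeta * eta)"
  "xi * eta = (zeta - 1) * (zeta + sc (\<sigma>\<^sup>2))"
  "eta * xi = (sc (inverse (q\<^sup>2)) * zeta + sc (\<sigma>\<^sup>2)) * (sc (inverse (q\<^sup>2)) * zeta - 1)"
proof -
  have s: "f (sc t) = t * f 1" if "\<And>t x. f (sc t * x) = t * f x" for f :: "'k qop \<Rightarrow> 'k" and t
    using that[of t 1] by simp
  have p: "xi * (sc t * x) = sc t * (xi * x)" "zeta * (sc t * x) = sc t * (zeta * x)"
    "eta * (sc t * x) = sc t * (eta * x)" "xi * sc t = sc t * xi" "zeta * sc t = sc t * zeta"
    "eta * sc t = sc t * eta" for t x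
    by (rule sc_central sc_left_commute)+
  note n = p distrib_left distrib_right left_diff_distrib right_diff_distrib mult.assoc sc_mult[symmetric]
  note e = uwuw[of u1 w1] uwuw[of u1 w2] uwuw[of u2 w1] uwuw[of u2 w2]
  note e = e[unfolded uw]
  show "xi * zeta = sc (q\<^sup>2) * (zeta * xi)"
  proof (rule qop_eqI_functional)
    fix f :: "'k qop \<Rightarrow> 'k" assume f: "\<And>x y. f (x + y) = f x + f y" "\<And>x y. f (x - y) = f x - f y"
      "\<And>x. f (- x) = - f x" "\<And>t x. f (sc t * x) = t * f x"
    show "f (xi * zeta) = f (sc (q\<^sup>2) * (zeta * xi))"
      using arg_cong[OF e(2), of f]
      by (simp add: n f s[of f, OF f(4)]) (simp add: field_simps)
  qed
  show "eta * zeta = sc (inverse (q\<^sup>2)) * (zeta * eta)"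
  proof (rule qop_eqI_functional)
    fix f :: "'k qop \<Rightarrow> 'k" assume f: "\<And>x y. f (x + y) = f x + f y" "\<And>x y. f (x - y) = f x - f y"
      "\<And>x. f (- x) = - f x" "\<And>t x. f (sc t * x) = t * f x"
    show "f (eta * zeta) = f (sc (inverse (q\<^sup>2)) * (zeta * eta))"
      using arg_cong[OF e(3), of f]
      by (simp add: n f s[of f, OF f(4)])
  qed
  show "xi * eta = (zeta - 1) * (zeta + sc (\<sigma>\<^sup>2))"
  proof (rule qop_eqI_functional)
    fix f :: "'k qop \<Rightarrow> 'k" assume f: "\<And>x y. f (x + y) = f x + f y" "\<And>x y. f (x - y) = f x - f y"
      "\<And>x. f (- x) = - f x" "\<And>t x. f (sc t * x) = t * f x"
    show "f (xi * eta) = f ((zeta - 1) * (zeta + sc (\<sigma>\<^sup>2)))"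
      using arg_cong[OF e(1), of f]
      by (simp add: n f s[of f, OF f(4)] algebra_simps)
  qed
  show "eta * xi = (sc (inverse (q\<^sup>2)) * zeta + sc (\<sigma>\<^sup>2)) * (sc (inverse (q\<^sup>2)) * zeta - 1)"
  proof (rule qop_eqI_functional)
    fix f :: "'k qop \<Rightarrow> 'k" assume f: "\<And>x y. f (x + y) = f x + f y" "\<And>x y. f (x - y) = f x - f y"
      "\<And>x. f (- x) = - f x" "\<And>t x. f (sc t * x) = t * f x"
    show "f (eta * xi) = f ((sc (inverse (q\<^sup>2)) * zeta + sc (\<sigma>\<^sup>2)) * (sc (inverse (q\<^sup>2)) * zeta - 1))"
      using arg_cong[OF e(4), of f]
      by (simp add: n f s[of f, OF f(4)]) (simp add: algebra_simps)
  qed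
qed

inductive_set sphere :: "'k qop set" where
  sphere_sc: "sc t \<in> sphere"
| sphere_xi: "xi \<in> sphere"
| sphere_eta: "eta \<in> sphere"
| sphere_zeta: "zeta \<in> sphere"
| sphere_add: "x \<in> sphere \<Longrightarrow> y \<in> sphere \<Longrightarrow> x + y \<in> sphere"
| sphere_mult: "x \<in> sphere \<Longrightarrow> y \<in> sphere \<Longrightarrow> x * y \<in> sphere"

lemmas [simp] = sphere.intros

lemma sphere_0 [simp]: "0 \<in> sphere" and sphere_1 [simp]: "1 \<in> sphere"
  using sphere_sc[of 0] sphere_sc[of 1] by simp_all

lemma sphere_uminus [simp]: "x \<in> sphere \<Longrightarrow> - x \<in> sphere"
  using sphere_mult[OF sphere_sc[of "- 1"], of x] by (simp add: sc_uminus)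

lemma sphere_diff [simp]: "x \<in> sphere \<Longrightarrow> y \<in> sphere \<Longrightarrow> x - y \<in> sphere"
  using sphere_add[of x "- y"] by simp

lemma sphere_power [simp]: "x \<in> sphere \<Longrightarrow> x ^ n \<in> sphere"
  by (induction n) simp_all

lemma sphere_sum: "(\<And>i. i \<in> I \<Longrightarrow> f i \<in> sphere) \<Longrightarrow> sum f I \<in> sphere"
  by (induction I rule: infinite_finite_induct) simp_all

lemma alg_sc [simp]: "sc t \<in> alg"
  using alg_closed(5)[of 1 t] by simp

lemma sphere_gens_alg [simp]: "xi \<in> alg" "eta \<in> alg" "zeta \<in> alg" "u1 \<in> alg" "u2 \<in> alg" "w1 \<in> alg" "w2 \<in> alg"
  by (simp_all add: xi_def eta_def zeta_def u1_def u2_def w1_def w2_def)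

lemma sphere_alg: "x \<in> sphere \<Longrightarrow> x \<in> alg"
  by (induction rule: sphere.induct) simp_all

lemma sphere_torus: "x \<in> sphere \<Longrightarrow> x \<in> torus q"
  by (rule alg_torus[OF sphere_alg])

text \<open>
  The exponent of \<open>\<alpha>\<close> in the leading monomial of \<open>\<xi>\<close>, which is \<open>\<alpha>\<^sup>2\<close> unless \<open>s = 0\<close>, and then \<open>\<alpha>\<beta>\<close>.
\<close>

definition om :: int where "om = (if \<sigma> = 0 then 1 else 2)"

lemma lead_sphere_gens:
  "xi \<noteq> 0" "lead xi = (2, om, 0)" "zeta \<noteq> 0" "lead zeta = (2, om - 1, 1)" "eta \<noteq> 0" "lead eta = (2, om - 2, 2)"
proof -
  note n = a_def b_def c_def d_def distrib_left distrib_right mon_mult twist_def mult.assoc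
      left_diff_distrib right_diff_distrib
      sc_left_commute[of "mon q m" for m] plus_prod_def zero_prod_def power_int_minus cf_mon
  let ?i = "\<lambda>m n. if n = (m :: tri) then 1 else 0 :: 'k"
  have "cf xi n = \<sigma> * (?i (2, 2, 0) n - inverse q * ?i (2, 0, 0) n)
      + (\<sigma>\<^sup>2 - 1) * inverse q * ?i (2, 1, 0) n" for n
    by (simp add: xi_def n)
  then have "cf xi (2, om, 0) \<noteq> 0 \<and> (\<forall>n>(2, om, 0). cf xi n = 0)"
    unfolding om_def by (cases "\<sigma> = 0") auto
  then have xi: "cf xi (2, om, 0) \<noteq> 0" "(2, om, 0) < n \<Longrightarrow> cf xi n = 0" for n
    by blast+
  have "cf zeta n = \<sigma> * (q * ?i (2, 1, 1) n - q * ?i (0, -1, 0) n - q\<^sup>2 * ?i (2, -1, 1) n)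
      + (\<sigma>\<^sup>2 - 1) * q * ?i (2, 0, 1) n" for n
    by (simp add: zeta_def n power2_eq_square)
  then have "cf zeta (2, om - 1, 1) \<noteq> 0 \<and> (\<forall>n>(2, om - 1, 1). cf zeta n = 0)"
    unfolding om_def by (cases "\<sigma> = 0") auto
  then have zeta: "cf zeta (2, om - 1, 1) \<noteq> 0" "(2, om - 1, 1) < n \<Longrightarrow> cf zeta n = 0" for n
    by blast+
  have "cf eta n = \<sigma> * (q * ?i (2, 0, 2) n - cf (d * d) n)
      + (\<sigma>\<^sup>2 - 1) * (q * ?i (0, -1, 1) n + q\<^sup>2 * ?i (2, -1, 2) n)" for n
    by (simp add: eta_def n power2_eq_square)
  moreover have "cf (d * d) n = 0" if "(2, 0, 2) \<le> n" for n
    using that by (auto simp: n)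
  ultimately have "cf eta (2, om - 2, 2) \<noteq> 0 \<and> (\<forall>n>(2, om - 2, 2). cf eta n = 0)"
    unfolding om_def by (cases "\<sigma> = 0") auto
  then have eta: "cf eta (2, om - 2, 2) \<noteq> 0" "(2, om - 2, 2) < n \<Longrightarrow> cf eta n = 0" for n
    by blast+
  show "xi \<noteq> 0" "zeta \<noteq> 0" "eta \<noteq> 0"
    using xi zeta eta by (metis cf_0)+
  show "lead xi = (2, om, 0)" "lead zeta = (2, om - 1, 1)" "lead eta = (2, om - 2, 2)"
    by (rule lead_eqI[of _ q]; use xi zeta eta sphere_torus in auto)+
qed

text \<open>The indexing of this basis of the sphere is the one by leading exponents, see \<open>sb_lead\<close>.\<close>

definition sb :: "nat \<times> nat \<Rightarrow> 'k qop"
  where "sb = (\<lambda>(n, k). if k \<le> n then zeta ^ k * xi ^ (n - k) else zeta ^ (2 * n - k) * eta ^ (k - n))"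

definition sbI :: "(nat \<times> nat) set" where "sbI = {(n, k). k \<le> 2 * n}"

lemma sb_sphere [simp]: "sb i \<in> sphere"
  by (cases i) (simp add: sb_def)

lemma sb_lead:
  assumes "k \<le> 2 * n"
  shows "sb (n, k) \<noteq> 0 \<and> lead (sb (n, k)) = (2 * int n, om * int n - int k, int k)"
proof -
  have "lead (zeta ^ i * x ^ j) = (2 * int i + int j * fst (lead x),
      int i * (om - 1) + int j * fst (snd (lead x)), int i + int j * snd (snd (lead x)))
     \<and> zeta ^ i * x ^ j \<noteq> 0" if "x \<in> sphere" "x \<noteq> 0" for i j x
  proof -
    have 1: "zeta ^ i \<in> torus q" "x ^ j \<in> torus q"
      using that by (simp_all add: sphere_torus)
    have 2: "zeta ^ i \<noteq> 0" "lead (zeta ^ i) = (int i * 2, int i * (om - 1), int i)"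
      "x ^ j \<noteq> 0" "lead (x ^ j) = (int j * fst (lead x), int j * fst (snd (lead x)), int j * snd (snd (lead x)))"
      using lead_power[OF q, of zeta i] lead_power[OF q, of x j] that
      by (simp_all add: sphere_torus lead_sphere_gens)
    show ?thesis
      using lead_mult[OF q 1(1) 2(1) 1(2) 2(3)] by (simp add: 2 plus_prod_def)
  qed
  from this[of xi k "n - k"] this[of eta "2 * n - k" "k - n"] show ?thesis
    using assms by (auto simp: sb_def lead_sphere_gens of_nat_diff algebra_simps)
qed

lemma sb_torus: "i \<in> sbI \<Longrightarrow> sb i \<in> torus q \<and> sb i \<noteq> 0"
  using sb_lead by (auto simp: sbI_def sphere_torus)

lemma sb_lead_inj: "F \<subseteq> sbI \<Longrightarrow> inj_on (\<lambda>i. lead (sb i)) F"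
  by (rule inj_onI) (auto simp: sb_lead sbI_def subset_iff)

text \<open>
  The relations reduce a product of a generator and a basis element to basis elements, because
  \<open>\<xi>\<eta>\<close> and \<open>\<eta>\<xi>\<close> are polynomials in \<open>\<zeta>\<close>.
\<close>

lemma sphere_span: "x \<in> sphere \<longleftrightarrow> x \<in> op.span (sb ` sbI)"
proof
  let ?T = "op.span (sb ` sbI)"
  have zx: "zeta ^ i * xi ^ j \<in> ?T" for i j
    by (rule op.span_base) (force simp: sb_def sbI_def intro!: image_eqI[of _ _ "(i + j, i)"])
  have ze: "zeta ^ i * eta ^ j \<in> ?T" for i j
  proof (cases j)
    case 0
    then show ?thesis using zx[of i 0] by simp
  next
    case (Suc m)
    then show ?thesis
      by (intro op.span_base) (force simp: sb_def sbI_def intro!: image_eqI[of _ _ "(i + j, i + 2 * j)"])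
  qed
  have xz: "xi * (zeta ^ i * y) = sc ((q\<^sup>2) ^ i) * (zeta ^ i * (xi * y))"
    and ez: "eta * (zeta ^ i * y) = sc (inverse (q\<^sup>2) ^ i) * (zeta ^ i * (eta * y))" for i y
  proof (induction i)
    case (Suc i)
    have "xi * (zeta ^ Suc i * y) = xi * zeta * (zeta ^ i * y)"
      by (simp add: mult.assoc)
    also have "\<dots> = sc (q\<^sup>2) * (zeta * (xi * (zeta ^ i * y)))"
      by (simp only: sphere_rels mult.assoc)
    finally show "xi * (zeta ^ Suc i * y) = sc ((q\<^sup>2) ^ Suc i) * (zeta ^ Suc i * (xi * y))"
      by (simp only: Suc.IH sc_left_commute[of zeta] power_Suc sc_mult mult.assoc)
    have "eta * (zeta ^ Suc i * y) = eta * zeta * (zeta ^ i * y)"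
      by (simp add: mult.assoc)
    also have "\<dots> = sc (inverse (q\<^sup>2)) * (zeta * (eta * (zeta ^ i * y)))"
      by (simp only: sphere_rels mult.assoc)
    finally show "eta * (zeta ^ Suc i * y) = sc (inverse (q\<^sup>2) ^ Suc i) * (zeta ^ Suc i * (eta * y))"
      by (simp only: Suc.IH sc_left_commute[of zeta] power_Suc sc_mult mult.assoc)
  qed simp_all
  have quad: "zeta ^ i * ((sc r * zeta + sc s) * (sc t * zeta - 1) * x) \<in> ?T"
    if "\<And>i. zeta ^ i * x \<in> ?T" for i r s t x
  proof -
    have "zeta ^ i * ((sc r * zeta + sc s) * (sc t * zeta - 1) * x)
      = sc (r * t) * (zeta ^ Suc (Suc i) * x) + sc (s * t) * (zeta ^ Suc i * x)
        - sc r * (zeta ^ Suc i * x) - sc s * (zeta ^ i * x)"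
    proof -
      have z: "zeta ^ i * (zeta * y) = zeta ^ Suc i * y" for i y
        by (simp only: power_Suc2 mult.assoc)
      have "(sc r * zeta + sc s) * (sc t * zeta - 1) * x
          = sc (r * t) * (zeta * (zeta * x)) + sc (s * t) * (zeta * x) - sc r * (zeta * x) - sc s * x"
        by (simp add: distrib_left distrib_right left_diff_distrib right_diff_distrib mult.assoc
            sc_left_commute[of zeta])
      then show ?thesis
        by (simp only: distrib_left right_diff_distrib sc_left_commute[of "zeta ^ i"] z)
    qed
    then show ?thesis
      using that by (simp only: op.span_add op.span_diff op.span_scale)
  qed
  have gen: "zeta * y \<in> ?T \<and> xi * y \<in> ?T \<and> eta * y \<in> ?T" if y: "y \<in> sb ` sbI" for y
  proof -
    obtain i j where ij: "y = zeta ^ i * xi ^ j \<or> y = zeta ^ i * eta ^ Suc j"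
    proof -
      obtain n k where nk: "y = sb (n, k)"
        using y by auto
      show ?thesis
      proof (cases "k \<le> n")
        case True
        then show ?thesis using that[of k "n - k"] by (simp add: nk sb_def)
      next
        case False
        then have "k - n = Suc (k - n - 1)"
          by simp
        then have "eta ^ (k - n) = eta ^ Suc (k - n - 1)"
          by (rule arg_cong)
        with False show ?thesis using that[of "2 * n - k" "k - n - 1"] by (simp only: nk sb_def) simp
      qed
    qed
    have "zeta * y \<in> ?T"
      using ij zx[of "Suc i" j] ze[of "Suc i" "Suc j"] by (auto simp: mult.assoc)
    moreover have "xi * y \<in> ?T"
    proof -
      have "zeta ^ i * (xi * eta ^ Suc j) = zeta ^ i * ((sc 1 * zeta + sc (\<sigma>\<^sup>2)) * (sc 1 * zeta - 1) * eta ^ j)"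
      proof -
        have "xi * eta = (sc 1 * zeta + sc (\<sigma>\<^sup>2)) * (sc 1 * zeta - 1)"
          by (simp add: sphere_rels algebra_simps sc_central)
        then show ?thesis
          by (simp add: mult.assoc[symmetric])
      qed
      then have "zeta ^ i * (xi * eta ^ Suc j) \<in> ?T"
        using quad[of "eta ^ j"] ze by (simp only:)
      then show ?thesis
        using ij zx[of i "Suc j"] by (auto simp: xz op.span_scale)
    qed
    moreover have "eta * y \<in> ?T"
    proof -
      have "zeta ^ i * (eta * xi ^ Suc j) \<in> ?T" for j
      proof -
        have "zeta ^ i * (eta * xi ^ Suc j) = zeta ^ i *
          ((sc (inverse (q\<^sup>2)) * zeta + sc (\<sigma>\<^sup>2)) * (sc (inverse (q\<^sup>2)) * zeta - 1) * xi ^ j)"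
          by (simp only: power_Suc mult.assoc[of eta, symmetric] sphere_rels(4))
        then show ?thesis
          using quad[of "xi ^ j"] zx by (simp only:)
      qed
      from this[of "j - 1"] show ?thesis
        using ij ze[of i "Suc (Suc j)"] ze[of i 1] ez[of i 1]
        by (cases j) (auto simp: ez op.span_scale)
    qed
    ultimately show ?thesis by blast
  qed
  have step: "g * y \<in> ?T" if "y \<in> ?T" "g \<in> {zeta, xi, eta}" for g y
    using that(1)
  proof (induction rule: op.span_induct_alt)
    case (step t x y)
    have "g * x \<in> ?T"
      using gen step(1) that(2) by auto
    then show ?case
      using step(2) by (simp add: distrib_left sc_left_commute[of g] op.span_add op.span_scale)
  qed (simp add: op.span_zero)
  have "x * y \<in> ?T" if "y \<in> ?T" "x \<in> sphere" for x y
    using that(2,1)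
    by (induction arbitrary: y rule: sphere.induct)
       (auto simp: op.span_scale distrib_right op.span_add mult.assoc intro: step)
  from this[of 1 x] show "x \<in> ?T" if "x \<in> sphere"
    using that zx[of 0 0] by simp
  show "x \<in> sphere" if "x \<in> ?T"
    using that by (induction rule: op.span_induct_alt) auto
qed

text \<open>
  By lack of cancellation the degree bounds the whole expansion in the basis, which gives the
  dimension count behind the Ore conditions.
\<close>

lemma sphere_lead:
  assumes "x \<in> sphere" "x \<noteq> 0"
  obtains n k where "k \<le> 2 * n" "lead x = (2 * int n, om * int n - int k, int k)"
    "\<And>N. n \<le> N \<Longrightarrow> x \<in> op.span (sb ` {(n, k). k \<le> 2 * n \<and> n \<le> N})"
proof -
  have "x \<in> op.span (sb ` sbI)"
    using assms sphere_span by blast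
  from op.span_family[OF this] obtain F t
    where F: "finite F" "F \<subseteq> sbI" "x = (\<Sum>i\<in>F. sc (t i) * sb i)" by metis
  have f: "\<And>i. i \<in> F \<Longrightarrow> sb i \<in> torus q \<and> sb i \<noteq> 0"
    using F(2) sb_torus by blast
  have "\<exists>i\<in>F. t i \<noteq> 0"
  proof (rule ccontr)
    assume "\<not> ?thesis"
    then have "x = 0"
      unfolding F(3) by (intro sum.neutral) simp
    then show False
      using assms(2) by simp
  qed
  then obtain i where "i \<in> F" "t i \<noteq> 0" by blast
  note L = lead_combination[where f = sb and c = t, OF F(1) f sb_lead_inj[OF F(2)]]
  obtain n k where nk: "(n, k) \<in> F" "lead x = lead (sb (n, k))"
    using L(2)[OF _ \<open>i \<in> F\<close> \<open>t i \<noteq> 0\<close>] F(3) by auto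
  have k: "k \<le> 2 * n"
    using nk(1) F(2) by (auto simp: sbI_def)
  show ?thesis
  proof (rule that[OF k])
    show "lead x = (2 * int n, om * int n - int k, int k)"
      using nk(2) sb_lead[OF k] by simp
    fix N assume "n \<le> N"
    have "sc (t i) * sb i \<in> op.span (sb ` {(n, k). k \<le> 2 * n \<and> n \<le> N})" if "i \<in> F" for i
    proof (cases "t i = 0")
      case False
      obtain n' k' where i: "i = (n', k')" by (cases i)
      have k': "k' \<le> 2 * n'"
        using F(2) that by (auto simp: i sbI_def)
      have "lead (sb i) \<le> lead x"
        using L(3)[OF _ that False] F(3) by simp
      then have "n' \<le> n"
        using nk(2) sb_lead[OF k] sb_lead[OF k'] by (auto simp: i less_eq_prod_def)
      then show ?thesis
        using k' \<open>n \<le> N\<close> by (intro op.span_scale op.span_base) (auto simp: i)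
    qed (simp add: op.span_zero)
    then show "x \<in> op.span (sb ` {(n, k). k \<le> 2 * n \<and> n \<le> N})"
      unfolding F(3) by (rule op.span_sum)
  qed
qed

end

lemma (in vector_space) nontrivial_relation:
  assumes "finite I" "finite T" "card T < card I" "\<And>i. i \<in> I \<Longrightarrow> f i \<in> span T"
  shows "\<exists>c. (\<exists>i\<in>I. c i \<noteq> 0) \<and> (\<Sum>i\<in>I. scale (c i) (f i)) = 0"
proof (cases "inj_on f I")
  case True
  have "dependent (f ` I)"
  proof (rule ccontr)
    assume "\<not> dependent (f ` I)"
    from independent_span_bound[OF assms(2) this] assms(4) have "card (f ` I) \<le> card T"
      by auto
    then show False
      using assms(3) card_image[OF True] by simp
  qed
  then obtain u where u: "\<exists>v\<in>f ` I. u v \<noteq> 0" "(\<Sum>v\<in>f ` I. scale (u v) v) = 0"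
    using dependent_finite[of "f ` I"] assms(1) by auto
  then show ?thesis
    by (intro exI[of _ "\<lambda>i. u (f i)"]) (auto simp: sum.reindex[OF True])
next
  case False
  then obtain i j where ij: "i \<in> I" "j \<in> I" "i \<noteq> j" "f i = f j"
    by (auto simp: inj_on_def)
  let ?c = "\<lambda>k. (if k = i then 1 else 0) - (if k = j then 1 else 0) :: 'a"
  have "(\<Sum>k\<in>I. scale (?c k) (f k)) = 0"
    using ij assms(1) by (simp add: scale_left_diff_distrib sum_subtractf if_distrib[of "\<lambda>t. scale t _"]
        cong: if_cong)
  then show ?thesis
    using ij by (intro exI[of _ ?c]) auto
qed

context podles
begin

section \<open>The sphere is saturated in the algebra\<close>

definition lead_cone :: "tri set"
  where "lead_cone = {(D, i, k). 0 \<le> k \<and> k \<le> D \<and> \<bar>i\<bar> \<le> D}"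

lemma finite_below: "finite {m \<in> lead_cone. m < l}"
proof (rule finite_subset)
  show "{m \<in> lead_cone. m < l} \<subseteq> {0..fst l} \<times> {- fst l..fst l} \<times> {0..fst l}"
    by (auto simp: lead_cone_def less_prod_def')
qed simp

lemma lead_in_cone: "x \<in> alg \<Longrightarrow> x \<noteq> 0 \<Longrightarrow> lead x \<in> lead_cone"
  using alg_lead_bounds[of x] by (cases "lead x") (auto simp: lead_cone_def)

text \<open>
  The leading exponents of \<open>r\<close> and \<open>r x\<close> have the shape of \<open>sb_lead\<close>, hence so does their difference,
  the one of \<open>x\<close>; the bounds \<open>alg_lead_bounds\<close> are what is needed for its indices to be admissible. Thus
  some basis element of the sphere cancels the leading term of \<open>x\<close>, and induction applies because only
  finitely many exponents of the algebra lie below a given one.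
\<close>

lemma sphere_saturated:
  assumes r: "r \<in> sphere" "r \<noteq> 0" and "x \<in> alg" "r * x \<in> sphere"
  shows "x \<in> sphere"
  using assms(3,4)
proof (induction "if x = 0 then 0 else Suc (card {m \<in> lead_cone. m < lead x})" arbitrary: x rule: less_induct)
  case less
  show ?case
  proof (cases "x = 0")
    case False
    note x = less.prems(1) alg_torus[OF less.prems(1)] False
    have rx: "r * x \<noteq> 0" "lead (r * x) = lead r + lead x"
      using lead_mult[OF q sphere_torus[OF r(1)] r(2) x(2,3)] by auto
    obtain n k where nk: "lead r = (2 * int n, om * int n - int k, int k)"
      by (rule sphere_lead[OF r])
    obtain n' k' where nk': "lead (r * x) = (2 * int n', om * int n' - int k', int k')"
      by (rule sphere_lead[OF less.prems(2) rx(1)])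
    have lx: "lead x = (2 * (int n' - int n), om * (int n' - int n) - (int k' - int k), int k' - int k)"
      using rx(2) nk nk' by (cases "lead x") (simp add: algebra_simps)
    have le: "k \<le> k'" "int k' - int k \<le> 2 * (int n' - int n)"
      using alg_lead_bounds[OF x(1,3) lx] by auto
    define s where "s = sb (n' - n, k' - k)"
    have nn: "n \<le> n'"
      using le by presburger
    have nk2: "k' - k \<le> 2 * (n' - n)"
      using le nn by presburger
    have s: "s \<in> sphere" "s \<noteq> 0" "lead s = lead x"
      using sb_lead[OF nk2] nn le(1) by (simp_all add: s_def lx of_nat_diff)
    define t where "t = cf x (lead x) / cf s (lead s)"
    have cs: "cf s (lead x) \<noteq> 0"
      using cf_lead_nonzero[OF sphere_torus[OF s(1)] s(2)] s(3) by simp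
    define y where "y = x - sc t * s"
    have y: "y \<in> alg" "r * y \<in> sphere"
      using less.prems s(1) r(1) by (simp_all add: y_def sphere_alg right_diff_distrib sc_left_commute[of r])
    have "y \<in> sphere"
    proof (cases "y = 0")
      case False
      have "cf y (lead x) = 0"
        using cs by (simp add: y_def t_def s(3))
      moreover have "cf y m = 0" if "lead x < m" for m
      proof -
        have "cf x m = 0" "cf s m = 0"
          using le_lead[OF x(2), of m] le_lead[OF sphere_torus[OF s(1)], of m] that s(3)
          by (meson leD, metis leD)
        then show ?thesis
          by (simp add: y_def)
      qed
      moreover have "cf y (lead y) \<noteq> 0"
        using cf_lead_nonzero[OF alg_torus[OF y(1)] False] .
      ultimately have "lead y < lead x"
        by (metis linorder_cases)
      then have "{m \<in> lead_cone. m < lead y} \<subset> {m \<in> lead_cone. m < lead x}"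
        using lead_in_cone[OF y(1) False] by auto
      then have "card {m \<in> lead_cone. m < lead y} < card {m \<in> lead_cone. m < lead x}"
        by (rule psubset_card_mono[OF finite_below])
      then show ?thesis
        using less.hyps[OF _ y] \<open>x \<noteq> 0\<close> False by simp
    qed simp
    then have "y + sc t * s \<in> sphere"
      using s(1) by simp
    then show ?thesis
      by (simp add: y_def)
  qed simp
qed

section \<open>The Ore conditions\<close>

lemma sphere_domain: "x \<in> sphere \<Longrightarrow> y \<in> sphere \<Longrightarrow> x * y = 0 \<longleftrightarrow> x = 0 \<or> y = 0"
  using torus_domain[OF q sphere_torus sphere_torus] .

definition sbN :: "nat \<Rightarrow> (nat \<times> nat) set" where "sbN N = {(n, k). k \<le> 2 * n \<and> n \<le> N}"

lemma card_sbN: "finite (sbN N)" "card (sbN N) = (N + 1)\<^sup>2"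
proof -
  have eq: "sbN N = Sigma {..N} (\<lambda>n. {..2 * n})"
    by (auto simp: sbN_def)
  show "finite (sbN N)"
    by (simp add: eq)
  have "card (sbN N) = (\<Sum>n\<le>N. Suc (2 * n))"
    by (simp add: eq)
  also have "\<dots> = (N + 1)\<^sup>2"
    by (induction N) (simp_all add: power2_eq_square)
  finally show "card (sbN N) = (N + 1)\<^sup>2" .
qed

text \<open>
  Elements of degree at most \<open>2 N\<close> in the sphere form a space of dimension \<open>(N + 1)\<^sup>2\<close>. Two injective
  maps that raise the degree by at most \<open>2 D\<close> cannot have independent images for large \<open>N\<close>.
\<close>

lemma common_value:
  fixes g :: "bool \<Rightarrow> 'k qop \<Rightarrow> 'k qop"
  assumes add: "\<And>\<epsilon> x y. g \<epsilon> (x + y) = g \<epsilon> x + g \<epsilon> y"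
    and scale: "\<And>\<epsilon> t x. g \<epsilon> (sc t * x) = sc t * g \<epsilon> x"
    and sphere: "\<And>\<epsilon> x. x \<in> sphere \<Longrightarrow> g \<epsilon> x \<in> sphere"
    and nz: "\<And>\<epsilon> x. x \<in> sphere \<Longrightarrow> x \<noteq> 0 \<Longrightarrow> g \<epsilon> x \<noteq> 0 \<and> fst (lead (g \<epsilon> x)) \<le> fst (lead x) + 2 * int D"
  shows "\<exists>x\<in>sphere. \<exists>y\<in>sphere. x \<noteq> 0 \<and> y \<noteq> 0 \<and> g True x = g False y"
proof -
  \<comment> \<open>Large enough for \<open>(N + D + 1)\<^sup>2 < 2 (N + 1)\<^sup>2\<close>.\<close>
  define N where "N = 3 * D + 2"
  have g0: "g \<epsilon> 0 = 0" for \<epsilon>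
    using scale[of \<epsilon> 0 0] by simp
  have gsum: "g \<epsilon> (sum f I) = (\<Sum>i\<in>I. g \<epsilon> (f i))" for \<epsilon> f and I :: "(nat \<times> nat) set"
    by (induction I rule: infinite_finite_induct) (simp_all add: g0 add)
  let ?f = "\<lambda>(\<epsilon>, i). g \<epsilon> (sb i)"
  have "?f p \<in> op.span (sb ` sbN (N + D))" if p_in: "p \<in> UNIV \<times> sbN N" for p
  proof -
    obtain \<epsilon> n k where p: "p = (\<epsilon>, n, k)" "k \<le> 2 * n" "n \<le> N"
      using p_in by (cases p) (auto simp: sbN_def)
    have x: "sb (n, k) \<in> sphere" "sb (n, k) \<noteq> 0" "fst (lead (sb (n, k))) = 2 * int n"
      using sb_lead[OF p(2)] by simp_all
    obtain n' k' where n': "lead (g \<epsilon> (sb (n, k))) = (2 * int n', om * int n' - int k', int k')"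
      "\<And>N. n' \<le> N \<Longrightarrow> g \<epsilon> (sb (n, k)) \<in> op.span (sb ` {(n, k). k \<le> 2 * n \<and> n \<le> N})"
      by (rule sphere_lead[OF sphere[OF x(1)] conjunct1[OF nz[OF x(1,2)]]], rule that)
    have "n' \<le> N + D"
      using nz[OF x(1,2), of \<epsilon>] n'(1) x(3) p(3) by simp
    then show ?thesis
      using n'(2) by (simp add: p(1) sbN_def)
  qed
  moreover have "card (sb ` sbN (N + D)) < card (UNIV \<times> sbN N :: (bool \<times> nat \<times> nat) set)"
  proof -
    have "card (sb ` sbN (N + D)) \<le> (N + D + 1)\<^sup>2"
      using card_image_le[OF card_sbN(1)] card_sbN(2) by metis
    also have "\<dots> < 2 * (N + 1)\<^sup>2"
      by (simp add: N_def power2_eq_square algebra_simps)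
    also have "\<dots> = card (UNIV \<times> sbN N :: (bool \<times> nat \<times> nat) set)"
      by (simp add: card_cartesian_product card_sbN)
    finally show ?thesis .
  qed
  ultimately obtain t where t: "\<exists>p\<in>UNIV \<times> sbN N. t p \<noteq> 0"
    "(\<Sum>p\<in>UNIV \<times> sbN N. sc (t p) * ?f p) = 0"
    using op.nontrivial_relation[of "UNIV \<times> sbN N :: (bool \<times> nat \<times> nat) set" "sb ` sbN (N + D)" ?f]
      card_sbN(1) by auto
  define z where "z \<epsilon> = (\<Sum>i\<in>sbN N. sc (t (\<epsilon>, i)) * sb i)" for \<epsilon>
  have "(\<Sum>p\<in>UNIV \<times> sbN N. sc (t p) * ?f p) = (\<Sum>\<epsilon>\<in>UNIV. \<Sum>i\<in>sbN N. sc (t (\<epsilon>, i)) * g \<epsilon> (sb i))"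
    by (simp add: sum.cartesian_product split_def)
  also have "\<dots> = g True (z True) + g False (z False)"
    by (simp add: UNIV_bool z_def gsum scale add.commute)
  finally have rel: "g True (z True) + g False (z False) = 0"
    using t(2) by simp
  have zs: "z \<epsilon> \<in> sphere" for \<epsilon>
    unfolding z_def by (intro sphere_sum) simp
  obtain \<epsilon> i where "i \<in> sbN N" "t (\<epsilon>, i) \<noteq> 0"
    using t(1) by auto
  moreover have "sbN N \<subseteq> sbI"
    by (auto simp: sbN_def sbI_def)
  ultimately have "z \<epsilon> \<noteq> 0"
    unfolding z_def
    by (intro lead_combination(1)[where f = sb and c = "\<lambda>i. t (\<epsilon>, i)" and q = q and i = i])
       (use card_sbN(1) sb_torus sb_lead_inj in auto)
  then have "z \<epsilon>' \<noteq> 0" for \<epsilon>'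
    using rel nz[OF zs, of True] nz[OF zs, of False] g0 by (cases \<epsilon>; cases \<epsilon>') auto
  moreover have "g False (- z False) = - g False (z False)"
    using scale[of False "- 1" "z False"] by (simp add: sc_uminus)
  then have "g True (z True) = g False (- z False)"
    using rel by (metis eq_neg_iff_add_eq_0)
  ultimately show ?thesis
    using zs by (intro bexI[of _ "z True"] bexI[of _ "- z False"]) auto
qed

lemma degree_mult:
  assumes "x \<in> sphere" "y \<in> sphere" "x \<noteq> 0" "y \<noteq> 0"
  shows "x * y \<noteq> 0" "fst (lead (x * y)) = fst (lead x) + fst (lead y)"
  using lead_mult[OF q sphere_torus _ sphere_torus, of x y] assms by simp_all

lemma common_multiples:
  assumes r: "r \<in> sphere" "r \<noteq> 0" "r' \<in> sphere" "r' \<noteq> 0"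
  shows "\<exists>x\<in>sphere. \<exists>y\<in>sphere. x \<noteq> 0 \<and> y \<noteq> 0 \<and> x * r = y * r'"
    and "\<exists>x\<in>sphere. \<exists>y\<in>sphere. x \<noteq> 0 \<and> y \<noteq> 0 \<and> r * x = r' * y"
proof -
  have "\<exists>n. fst (lead x) = 2 * int n" if "x \<in> sphere" "x \<noteq> 0" for x
    by (rule sphere_lead[OF that]) auto
  then obtain n n' where n: "fst (lead r) = 2 * int n" "fst (lead r') = 2 * int n'"
    using r by meson
  show "\<exists>x\<in>sphere. \<exists>y\<in>sphere. x \<noteq> 0 \<and> y \<noteq> 0 \<and> x * r = y * r'"
    using common_value[of "\<lambda>\<epsilon> x. x * (if \<epsilon> then r else r')" "max n n'"] r n
    by (auto simp: distrib_right mult.assoc degree_mult)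
  show "\<exists>x\<in>sphere. \<exists>y\<in>sphere. x \<noteq> 0 \<and> y \<noteq> 0 \<and> r * x = r' * y"
    using common_value[of "\<lambda>\<epsilon> x. (if \<epsilon> then r else r') * x" "max n n'"] r n
    by (auto simp: distrib_left sc_left_commute[of r] sc_left_commute[of r'] degree_mult)
qed

section \<open>Linear maps to the sphere\<close>

definition right_submodule :: "'k qop set \<Rightarrow> bool"
  where "right_submodule M \<longleftrightarrow> 0 \<in> M \<and> (\<forall>x\<in>M. \<forall>y\<in>M. x + y \<in> M) \<and> (\<forall>x\<in>M. \<forall>s\<in>sphere. x * s \<in> M)"

definition right_hom :: "'k qop set \<Rightarrow> ('k qop \<Rightarrow> 'k qop) \<Rightarrow> bool"
  where "right_hom M \<phi> \<longleftrightarrow> (\<forall>x\<in>M. \<phi> x \<in> sphere) \<and> (\<forall>x\<in>M. \<forall>y\<in>M. \<phi> (x + y) = \<phi> x + \<phi> y)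
    \<and> (\<forall>x\<in>M. \<forall>s\<in>sphere. \<phi> (x * s) = \<phi> x * s)"

text \<open>
  Adjoining \<open>v\<close>, either its multiples by the sphere meet \<open>M\<close> in \<open>0\<close> and \<open>v\<close> can be sent to \<open>0\<close>, or \<open>v x \<in> M\<close> for some \<open>x \<noteq> 0\<close>. Then the value at \<open>v\<close>
  has to be the fraction \<open>\<phi>(v x) x\<^sup>-\<^sup>1\<close>, whose denominator is moved to the left by the left Ore condition
  and absorbed into the factor \<open>z\<close>. The right Ore condition shows that the extension is well defined.
\<close>

lemma extend_right_hom:
  assumes M: "right_submodule M" and \<phi>: "right_hom M \<phi>"
  shows "\<exists>M' \<phi>' z. right_submodule M' \<and> right_hom M' \<phi>' \<and> insert v M \<subseteq> M' \<and>
    z \<in> sphere \<and> z \<noteq> 0 \<and> (\<forall>m\<in>M. \<phi>' m = z * \<phi> m)"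
proof -
  note Mc = M[unfolded right_submodule_def]
  note \<phi>c = \<phi>[unfolded right_hom_def]
  have M_neg: "- x \<in> M" if "x \<in> M" for x
    using Mc that sphere_sc[of "- 1"] by (metis mult_1_right mult_minus_right sc_1 sc_uminus)
  have \<phi>0: "\<phi> 0 = 0"
    using \<phi>c Mc by (metis mult_zero_right sphere_0)
  have \<phi>_neg: "\<phi> (- x) = - \<phi> x" if "x \<in> M" for x
    using \<phi>c Mc that sphere_sc[of "- 1"] by (metis mult_1_right mult_minus_right sc_1 sc_uminus)
  have "\<exists>z p. z \<in> sphere \<and> p \<in> sphere \<and> z \<noteq> 0 \<and>
    (\<forall>m\<in>M. \<forall>s\<in>sphere. m + v * s = 0 \<longrightarrow> z * \<phi> m + p * s = 0)"
  proof (cases "\<exists>x\<in>sphere. x \<noteq> 0 \<and> v * x \<in> M")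
    case False
    have "z = 0" if "m \<in> M" "s \<in> sphere" "m + v * s = 0" "z = \<phi> m" for m s z
    proof -
      have "v * s = - m"
        using that(3) by (simp add: eq_neg_iff_add_eq_0 add.commute)
      then have "s = 0"
        using False M_neg that(1,2) by metis
      then show ?thesis
        using that \<phi>0 by simp
    qed
    then show ?thesis
      by (intro exI[of _ 1] exI[of _ 0]) auto
  next
    case True
    then obtain x where x: "x \<in> sphere" "x \<noteq> 0" "v * x \<in> M" by blast
    obtain z p where zp: "z \<in> sphere" "p \<in> sphere" "z \<noteq> 0" "z * \<phi> (v * x) = p * x"
    proof (cases "\<phi> (v * x) = 0")
      case True
      then show ?thesis using that[of 1 0] by simp
    next
      case False
      then show ?thesis
        using common_multiples(1)[of "\<phi> (v * x)" x] \<phi>c x that by blast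
    qed
    have "z * \<phi> m + p * s = 0" if ms: "m \<in> M" "s \<in> sphere" "m + v * s = 0" for m s
    proof (cases "s = 0")
      case True
      then show ?thesis using ms \<phi>0 by simp
    next
      case False
      obtain y y' where y: "y \<in> sphere" "y' \<in> sphere" "y \<noteq> 0" "s * y = x * y'"
        using common_multiples(2)[OF ms(2) False x(1,2)] by blast
      have "m = - (v * s)"
        using ms(3) by (simp add: eq_neg_iff_add_eq_0)
      then have "m * y = - (v * x * y')"
        by (simp add: mult.assoc y(4))
      then have "\<phi> m * y = - (\<phi> (v * x) * y')"
        using \<phi>c Mc \<phi>_neg x(3) y(1,2) ms(1) by metis
      then have "z * \<phi> m * y = - (z * \<phi> (v * x) * y')"
        by (simp add: mult.assoc)
      then have "z * \<phi> m * y = - (p * s * y)"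
        by (simp add: zp(4) mult.assoc y(4))
      then have "(z * \<phi> m + p * s) * y = 0"
        by (simp add: distrib_right)
      moreover have "z * \<phi> m + p * s \<in> sphere"
        using zp(1,2) ms(1,2) \<phi>c by simp
      ultimately show ?thesis
        using sphere_domain y(1,3) by blast
    qed
    then show ?thesis
      using zp by blast
  qed
  then obtain z p where zp: "z \<in> sphere" "p \<in> sphere" "z \<noteq> 0"
    "\<And>m s. m \<in> M \<Longrightarrow> s \<in> sphere \<Longrightarrow> m + v * s = 0 \<Longrightarrow> z * \<phi> m + p * s = 0"
    by blast
  define M' where "M' = {m + v * s | m s. m \<in> M \<and> s \<in> sphere}"
  define \<phi>' where "\<phi>' w = (let (m, s) = (SOME (m, s). m \<in> M \<and> s \<in> sphere \<and> w = m + v * s)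
    in z * \<phi> m + p * s)" for w
  have \<phi>': "\<phi>' (m + v * s) = z * \<phi> m + p * s" if ms: "m \<in> M" "s \<in> sphere" for m s
  proof -
    define ms' where "ms' = (SOME (m', s'). m' \<in> M \<and> s' \<in> sphere \<and> m + v * s = m' + v * s')"
    obtain m' s' where eq: "ms' = (m', s')" by (cases ms')
    have "case ms' of (m', s') \<Rightarrow> m' \<in> M \<and> s' \<in> sphere \<and> m + v * s = m' + v * s'"
      unfolding ms'_def by (rule someI[of _ "(m, s)"]) (use ms in auto)
    then have ms': "m' \<in> M" "s' \<in> sphere" "m + v * s = m' + v * s'"
      by (simp_all add: eq)
    have "(m + - m') + v * (s - s') = 0"
      using ms'(3) by (simp add: right_diff_distrib algebra_simps)
    moreover have "m + - m' \<in> M"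
      using Mc M_neg ms(1) ms'(1) by blast
    ultimately have "z * \<phi> (m + - m') + p * (s - s') = 0"
      using zp(4) ms(2) ms'(2) by (metis sphere_diff)
    moreover have "\<phi> (m + - m') = \<phi> m + - \<phi> m'"
      using \<phi>c M_neg \<phi>_neg ms(1) ms'(1) by metis
    ultimately have "z * (\<phi> m + - \<phi> m') + p * (s - s') = 0"
      by simp
    then show ?thesis
      unfolding \<phi>'_def ms'_def[symmetric] eq by (simp add: right_diff_distrib algebra_simps)
  qed
  have M'I: "w \<in> M'" if "m \<in> M" "s \<in> sphere" "w = m + v * s" for w m s
    using that by (auto simp: M'_def)
  have sub: "right_submodule M'"
    unfolding right_submodule_def
  proof (intro conjI ballI)
    show "0 \<in> M'"
      using Mc by (intro M'I[of 0 0]) auto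
    fix w assume "w \<in> M'"
    then obtain m s where w: "m \<in> M" "s \<in> sphere" "w = m + v * s" by (auto simp: M'_def)
    show "w + w' \<in> M'" if w'_in: "w' \<in> M'" for w'
    proof -
      obtain m' s' where w': "m' \<in> M" "s' \<in> sphere" "w' = m' + v * s'"
        using w'_in by (auto simp: M'_def)
      show ?thesis
        by (rule M'I[of "m + m'" "s + s'"]) (use w w' Mc in \<open>auto simp: distrib_left\<close>)
    qed
    show "w * t \<in> M'" if "t \<in> sphere" for t
      by (rule M'I[of "m * t" "s * t"]) (use w that Mc in \<open>auto simp: distrib_right mult.assoc\<close>)
  qed
  have hom: "right_hom M' \<phi>'"
    unfolding right_hom_def
  proof (intro conjI ballI)
    fix w assume "w \<in> M'"
    then obtain m s where w: "m \<in> M" "s \<in> sphere" "w = m + v * s" by (auto simp: M'_def)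
    show "\<phi>' w \<in> sphere"
      using w zp \<phi>c by (simp add: \<phi>')
    show "\<phi>' (w + w') = \<phi>' w + \<phi>' w'" if w'_in: "w' \<in> M'" for w'
    proof -
      obtain m' s' where w': "m' \<in> M" "s' \<in> sphere" "w' = m' + v * s'"
        using w'_in by (auto simp: M'_def)
      have "w + w' = (m + m') + v * (s + s')"
        by (simp add: w w' distrib_left)
      moreover have "m + m' \<in> M" "s + s' \<in> sphere"
        using w w' Mc by auto
      ultimately have "\<phi>' (w + w') = z * \<phi> (m + m') + p * (s + s')"
        using \<phi>' by simp
      then show ?thesis
        using w w' \<phi>c by (simp add: \<phi>' distrib_left)
    qed
    show "\<phi>' (w * t) = \<phi>' w * t" if "t \<in> sphere" for t
    proof -
      have "w * t = m * t + v * (s * t)"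
        by (simp add: w distrib_right mult.assoc)
      then show ?thesis
        using w that Mc \<phi>c by (simp add: \<phi>' distrib_right mult.assoc)
    qed
  qed
  have "m \<in> M'" "\<phi>' m = z * \<phi> m" if "m \<in> M" for m
    using M'I[of m 0 m] \<phi>'[of m 0] that by simp_all
  moreover have "v \<in> M'"
    using Mc by (intro M'I[of 0 1]) auto
  ultimately show ?thesis
    using sub hom zp(1,3) by (intro exI[of _ M'] exI[of _ \<phi>'] exI[of _ z]) auto
qed

lemma right_hom_on_finite:
  assumes "finite F"
  shows "\<exists>M \<phi>. right_submodule M \<and> right_hom M \<phi> \<and> insert 1 F \<subseteq> M \<and> \<phi> 1 \<noteq> 0"
  using assms
proof (induction F)
  case empty
  show ?case
    by (intro exI[of _ sphere] exI[of _ "\<lambda>x. x"]) (auto simp: right_submodule_def right_hom_def)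
next
  case (insert v F)
  then obtain M \<phi> where M: "right_submodule M" "right_hom M \<phi>" "insert 1 F \<subseteq> M" "\<phi> 1 \<noteq> 0"
    by blast
  from extend_right_hom[OF M(1,2), of v] obtain M' \<phi>' z where M':
    "right_submodule M'" "right_hom M' \<phi>'" "insert v M \<subseteq> M'" "z \<in> sphere" "z \<noteq> 0"
    "\<forall>m\<in>M. \<phi>' m = z * \<phi> m" by blast
  have "\<phi>' 1 \<noteq> 0"
    using M M' sphere_domain[OF M'(4), of "\<phi> 1"] by (auto simp: right_hom_def)
  then show ?case
    using M M' by (intro exI[of _ M'] exI[of _ \<phi>']) auto
qed

definition bilinear_form :: "('k qop \<Rightarrow> 'k qop \<Rightarrow> 'k) \<Rightarrow> bool"
  where "bilinear_form m \<longleftrightarrow> (\<forall>x x' y. m (x + x') y = m x y + m x' y) \<and> (\<forall>x y y'. m x (y + y') = m x y + m x y')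
    \<and> (\<forall>t x y. m (sc t * x) y = t * m x y) \<and> (\<forall>t x y. m x (sc t * y) = t * m x y)"

definition balanced :: "('k qop \<Rightarrow> 'k qop \<Rightarrow> 'k) \<Rightarrow> bool"
  where "balanced l \<longleftrightarrow> bilinear_form l \<and> (\<forall>s\<in>sphere. \<forall>x y. l (x * s) y = l x (s * y))"

text \<open>
  The relations of the tensor square over the sphere, inside the free vector space on pairs.
\<close>

definition balancing_rels :: "(('k qop \<times> 'k qop) \<Rightarrow>\<^sub>0 'k) set"
  where "balancing_rels = (let \<delta> = \<lambda>x y. single (x, y) 1 in
      {\<delta> (x + x') y - \<delta> x y - \<delta> x' y | x x' y. True}
    \<union> {\<delta> x (y + y') - \<delta> x y - \<delta> x y' | x y y'. True}
    \<union> {\<delta> (sc t * x) y - single (x, y) t | t x y. True}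
    \<union> {\<delta> x (sc t * y) - single (x, y) t | t x y. True}
    \<union> {\<delta> (x * s) y - \<delta> x (s * y) | x s y. s \<in> sphere})"

text \<open>
  A right linear map defined on a part of the algebra only sees those relations whose first
  components it contains; a single relation involves finitely many of them.
\<close>

lemma balancing_rel_killed:
  assumes "r \<in> balancing_rels"
  shows "\<exists>A. finite A \<and> (\<forall>M \<phi>. right_submodule M \<and> right_hom M \<phi> \<and> A \<subseteq> M \<longrightarrow>
    lin_ext (\<lambda>c x. sc c * x) (\<lambda>(x, y). \<phi> x * y) r = 0)"
proof -
  note L = op.lin_ext_diff
  consider x x' y where "r = single (x + x', y) 1 - single (x, y) 1 - single (x', y) 1"
    | x y y' where "r = single (x, y + y') 1 - single (x, y) 1 - single (x, y') 1"
    | t x y where "r = single (sc t * x, y) 1 - single (x, y) t"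
    | t x y where "r = single (x, sc t * y) 1 - single (x, y) t"
    | x s y where "s \<in> sphere" "r = single (x * s, y) 1 - single (x, s * y) 1"
    using assms unfolding balancing_rels_def Let_def by blast
  then show ?thesis
  proof cases
    case 1
    then show ?thesis
      by (intro exI[of _ "{x, x'}"]) (auto simp: L right_hom_def distrib_right)
  next
    case 2
    then show ?thesis
      by (intro exI[of _ "{}"]) (auto simp: L distrib_left)
  next
    case 3
    have "lin_ext (\<lambda>c x. sc c * x) (\<lambda>(x, y). \<phi> x * y) r = 0" if "right_hom M \<phi>" "x \<in> M" for M \<phi>
    proof -
      have "\<phi> (sc t * x) = sc t * \<phi> x"
        using that unfolding right_hom_def by (metis sc_central sphere_sc)
      then show ?thesis
        by (simp add: 3 L mult.assoc)
    qed
    then show ?thesis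
      by (intro exI[of _ "{x}"]) auto
  next
    case 4
    then show ?thesis
      by (intro exI[of _ "{}"]) (auto simp: L sc_left_commute)
  next
    case 5
    then show ?thesis
      by (intro exI[of _ "{x}"]) (auto simp: L right_hom_def mult.assoc)
  qed
qed

text \<open>
  If no balanced form distinguishes \<open>1 \<otimes> x\<close> from \<open>x \<otimes> 1\<close>, then their difference is a finite combination of
  relations. A right linear map \<open>\<phi>\<close> on a submodule containing the finitely many first components
  involved gives \<open>\<phi>(1) x = \<phi>(x)\<close>.
\<close>

lemma balanced_imp_sphere:
  assumes x: "x \<in> alg" and bal: "\<And>l. balanced l \<Longrightarrow> l 1 x = l x 1"
  shows "x \<in> sphere"
proof -
  let ?z = "single (1, x) 1 - single (x, 1) 1 :: ('k qop \<times> 'k qop) \<Rightarrow>\<^sub>0 'k"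
  have "?z \<in> pm.span balancing_rels"
  proof (rule ccontr)
    assume "\<not> ?thesis"
    from pm.functional_separating[OF this] obtain f where
      f: "Vector_Spaces.linear pm_scale (*) f" "\<forall>y\<in>balancing_rels. f y = 0" "f ?z = 1" by blast
    have f_add: "f (u + v) = f u + f v" and f_scale: "f (pm_scale t u) = t * f u" for u v t
      using f(1) by (simp_all add: Vector_Spaces.linear_iff)
    have f_diff: "f (u - v) = f u - f v" for u v
      using f_add[of "u - v" v] by simp
    let ?l = "\<lambda>x y. f (single (x, y) 1)"
    have single: "f (single (x, y) t) = t * ?l x y" for x y t
      using f_scale[of t "single (x, y) 1"] by simp
    have zero: "f (u - v) = 0 \<Longrightarrow> f u = f v" for u v
      by (simp add: f_diff)
    have "balanced ?l"
      unfolding balanced_def bilinear_form_def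
    proof (intro conjI allI ballI)
      fix x x' y y' :: "'k qop" and t :: 'k
      have "f (single (x + x', y) 1 - single (x, y) 1 - single (x', y) 1) = 0"
        "f (single (x, y + y') 1 - single (x, y) 1 - single (x, y') 1) = 0"
        "f (single (sc t * x, y) 1 - single (x, y) t) = 0"
        "f (single (x, sc t * y) 1 - single (x, y) t) = 0"
        by (rule f(2)[rule_format]; unfold balancing_rels_def Let_def; blast)+
      then show "?l (x + x') y = ?l x y + ?l x' y" "?l x (y + y') = ?l x y + ?l x y'"
        "?l (sc t * x) y = t * ?l x y" "?l x (sc t * y) = t * ?l x y"
        by (simp_all add: f_diff single[of _ _ t] f_add algebra_simps)
    next
      fix x s y assume "s \<in> sphere"
      then have "f (single (x * s, y) 1 - single (x, s * y) 1) = 0"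
        by (intro f(2)[rule_format]) (unfold balancing_rels_def Let_def, blast)
      then show "?l (x * s) y = ?l x (s * y)"
        by (rule zero)
    qed
    from bal[OF this] f(3) show False
      by (simp add: f_diff)
  qed
  then obtain T c where T: "finite T" "T \<subseteq> balancing_rels" "?z = (\<Sum>r\<in>T. pm_scale (c r) r)"
    unfolding pm.span_explicit by blast
  have "\<forall>r\<in>T. \<exists>A. finite A \<and> (\<forall>M \<phi>. right_submodule M \<and> right_hom M \<phi> \<and> A \<subseteq> M \<longrightarrow>
    lin_ext (\<lambda>c x. sc c * x) (\<lambda>(x, y). \<phi> x * y) r = 0)"
    using T(2) balancing_rel_killed by blast
  then obtain A where A: "\<And>r. r \<in> T \<Longrightarrow> finite (A r)"
    "\<And>r M \<phi>. r \<in> T \<Longrightarrow> right_submodule M \<Longrightarrow> right_hom M \<phi> \<Longrightarrow> A r \<subseteq> M \<Longrightarrow>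
      lin_ext (\<lambda>c x. sc c * x) (\<lambda>(x, y). \<phi> x * y) r = 0"
    by metis
  have "finite (insert x (\<Union>r\<in>T. A r))"
    using T(1) A(1) by blast
  from right_hom_on_finite[OF this] obtain M \<phi> where M: "right_submodule M" "right_hom M \<phi>"
    "x \<in> M" "1 \<in> M" "(\<Union>r\<in>T. A r) \<subseteq> M" "\<phi> 1 \<noteq> 0"
    by auto
  have "lin_ext (\<lambda>c x. sc c * x) (\<lambda>(x, y). \<phi> x * y) ?z = 0"
    unfolding T(3) op.lin_ext_sum op.lin_ext_scale
    by (intro sum.neutral ballI) (use A(2)[OF _ M(1,2)] M(5) in \<open>auto simp: UN_subset_iff\<close>)
  then have "\<phi> 1 * x = \<phi> x"
    by (simp add: op.lin_ext_diff)
  moreover have "\<phi> 1 \<in> sphere" "\<phi> x \<in> sphere"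
    using M by (auto simp: right_hom_def)
  ultimately show ?thesis
    using sphere_saturated[of "\<phi> 1" x] M(6) x by simp
qed

end

context podles
begin

section \<open>The coproduct acting on bilinear forms\<close>

lemma bilinear_formD:
  assumes "bilinear_form m"
  shows "m (x + x') y = m x y + m x' y" "m x (y + y') = m x y + m x y'"
    "m (sc t * x) y = t * m x y" "m x (sc t * y) = t * m x y"
    "m (x - x') y = m x y - m x' y" "m x (y - y') = m x y - m x y'"
    "m (- x) y = - m x y" "m x (- y) = - m x y"
    "m (sc t) y = t * m 1 y" "m x (sc t) = t * m x 1" "m 0 y = 0" "m x 0 = 0"
proof -
  note B = assms[unfolded bilinear_form_def]
  show 1: "m (x + x') y = m x y + m x' y" "m x (y + y') = m x y + m x y'"
    "m (sc t * x) y = t * m x y" "m x (sc t * y) = t * m x y" for x x' y y' t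
    using B by blast+
  show 2: "m (- x) y = - m x y" "m x (- y) = - m x y" for x y
    using 1(3)[of "- 1" x y] 1(4)[of x "- 1" y] by (simp_all add: sc_uminus)
  show "m (x - x') y = m x y - m x' y" "m x (y - y') = m x y - m x y'"
    using 1(1)[of x "- x'" y] 1(2)[of x y "- y'"] 2 by simp_all
  show "m (sc t) y = t * m 1 y" "m x (sc t) = t * m x 1"
    using 1(3)[of t 1 y] 1(4)[of x t 1] by simp_all
  show "m 0 y = 0" "m x 0 = 0"
    using 1(3)[of 0 0 y] 1(4)[of x 0 0] by simp_all
qed

text \<open>
  If a form \<open>m\<close> is written as \<open>m(x \<otimes> y)\<close>, the generator \<open>t\<close> sends it to \<open>m((x \<otimes> y) \<Delta>(t))\<close>.
\<close>

fun coact_gen :: "gen \<Rightarrow> ('k qop \<Rightarrow> 'k qop \<Rightarrow> 'k) \<Rightarrow> 'k qop \<Rightarrow> 'k qop \<Rightarrow> 'k" where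
  "coact_gen Al m x y = m (x * a) (y * a) + m (x * b) (y * c)"
| "coact_gen Be m x y = m (x * a) (y * b) + m (x * b) (y * d)"
| "coact_gen Ga m x y = m (x * c) (y * a) + m (x * d) (y * c)"
| "coact_gen De m x y = m (x * c) (y * b) + m (x * d) (y * d)"

text \<open>
  The generator \<open>t\<close> sends \<open>m\<close> to the form \<open>m(x S(t\<^sub>1) \<otimes> t\<^sub>2 y)\<close>, where \<open>S\<close> is the antipode.
\<close>

fun adjoint_gen :: "gen \<Rightarrow> ('k qop \<Rightarrow> 'k qop \<Rightarrow> 'k) \<Rightarrow> 'k qop \<Rightarrow> 'k qop \<Rightarrow> 'k" where
  "adjoint_gen Al m x y = m (x * d) (a * y) - inverse q * m (x * b) (c * y)"
| "adjoint_gen Be m x y = m (x * d) (b * y) - inverse q * m (x * b) (d * y)"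
| "adjoint_gen Ga m x y = m (x * a) (c * y) - q * m (x * c) (a * y)"
| "adjoint_gen De m x y = m (x * a) (d * y) - q * m (x * c) (b * y)"

definition coact_poly where "coact_poly P m x y = lin_ext (*) (\<lambda>w. foldr coact_gen w m x y) P"
text \<open>
  The coproduct acts as a homomorphism but the adjoint action reverses products, hence the reversed
  words.
\<close>

definition adjoint_poly where "adjoint_poly P m x y = lin_ext (*) (\<lambda>w. foldr adjoint_gen (rev w) m x y) P"

lemma lin_ext_fun_add:
  "lin_ext (*) (\<lambda>w. f w + g w) P = lin_ext (*) f P + (lin_ext (*) g P :: 'k)"
  by (simp add: lin_ext_def sum.distrib distrib_left)

lemma lin_ext_fun_scale: "lin_ext (*) (\<lambda>w. t * f w) P = t * (lin_ext (*) f P :: 'k)"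
  by (simp add: lin_ext_def sum_distrib_left mult.left_commute)

lemma lin_ext_fun_diff:
  "lin_ext (*) (\<lambda>w. f w - g w) P = lin_ext (*) f P - (lin_ext (*) g P :: 'k)"
  by (simp add: lin_ext_def sum_subtractf right_diff_distrib)

lemma coact_gen_bilinear: "bilinear_form m \<Longrightarrow> bilinear_form (coact_gen g m)"
  unfolding bilinear_form_def[of "coact_gen g m"]
  by (cases g) (simp_all add: distrib_right mult.assoc bilinear_formD distrib_left)

lemma adjoint_gen_bilinear: "bilinear_form m \<Longrightarrow> bilinear_form (adjoint_gen g m)"
  unfolding bilinear_form_def[of "adjoint_gen g m"]
  by (cases g) (simp_all add: distrib_right distrib_left mult.assoc pull_sc bilinear_formD algebra_simps)

lemma foldr_bilinear:
  "bilinear_form m \<Longrightarrow> bilinear_form (foldr coact_gen w m)" "bilinear_form m \<Longrightarrow> bilinear_form (foldr adjoint_gen w m)"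
  by (induction w) (simp_all add: coact_gen_bilinear adjoint_gen_bilinear)

lemma act_bilinear:
  "bilinear_form m \<Longrightarrow> bilinear_form (coact_poly P m)" "bilinear_form m \<Longrightarrow> bilinear_form (adjoint_poly P m)"
  unfolding bilinear_form_def[of "coact_poly P m"] bilinear_form_def[of "adjoint_poly P m"] coact_poly_def adjoint_poly_def
  by (simp_all add: bilinear_formD(1-4)[OF foldr_bilinear(1)] bilinear_formD(1-4)[OF foldr_bilinear(2)]
      lin_ext_fun_add lin_ext_fun_scale)

lemma foldr_lin_ext:
  "foldr coact_gen v (\<lambda>x y. lin_ext (*) (\<lambda>w. F w x y) R) x y = lin_ext (*) (\<lambda>w. foldr coact_gen v (F w) x y) R"
  "foldr adjoint_gen v (\<lambda>x y. lin_ext (*) (\<lambda>w. F w x y) R) x y = lin_ext (*) (\<lambda>w. foldr adjoint_gen v (F w) x y) R"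
proof (induction v arbitrary: x y)
  case (Cons g v)
  case 1
  show ?case
    by (cases g) (simp_all add: Cons.IH(1) lin_ext_fun_add)
  case 2
  show ?case
    by (cases g) (simp_all add: Cons.IH(2) lin_ext_fun_diff lin_ext_fun_scale)
qed simp_all

lemma lin_ext_mult: "lin_ext (*) f (P * R) = lin_ext (*) (\<lambda>v. lin_ext (*) (\<lambda>w. f (v @ w)) R) P"
  for f :: "gen list \<Rightarrow> 'k"
  unfolding free_mult[symmetric]
  by (simp add: pm_sum_sum) (simp add: lin_ext_def sum_distrib_left mult.assoc)

lemma lin_ext_swap: "lin_ext (*) (\<lambda>v. lin_ext (*) (\<lambda>w. f v w) R) P
    = (lin_ext (*) (\<lambda>w. lin_ext (*) (\<lambda>v. f v w) P) R :: 'k)"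
  unfolding lin_ext_def by (simp add: sum_distrib_left mult.left_commute) (rule sum.swap)

lemma coact_poly_mult: "coact_poly (P * R) m = coact_poly P (coact_poly R m)"
  by (intro ext) (simp add: coact_poly_def[abs_def] lin_ext_mult foldr_lin_ext)

lemma adjoint_poly_mult: "adjoint_poly (P * R) m = adjoint_poly R (adjoint_poly P m)"
proof (intro ext)
  fix x y
  have "adjoint_poly (P * R) m x y = lin_ext (*) (\<lambda>v. lin_ext (*) (\<lambda>w. foldr adjoint_gen (rev w) (foldr adjoint_gen (rev v) m) x y) R) P"
    by (simp add: adjoint_poly_def lin_ext_mult)
  also have "\<dots> = adjoint_poly R (adjoint_poly P m) x y"
    by (subst lin_ext_swap) (simp add: adjoint_poly_def[abs_def] foldr_lin_ext)
  finally show "adjoint_poly (P * R) m x y = adjoint_poly R (adjoint_poly P m) x y" .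
qed

lemma act_single [simp]:
  "coact_poly (fgen w) m = foldr coact_gen w m" "adjoint_poly (fgen w) m = foldr adjoint_gen (rev w) m"
  "coact_poly 1 m = m" "adjoint_poly 1 m = m"
  "coact_poly 0 m = (\<lambda>_ _. 0)" "adjoint_poly 0 m = (\<lambda>_ _. 0)"
proof -
  show *: "coact_poly (fgen w) m = foldr coact_gen w m" "adjoint_poly (fgen w) m = foldr adjoint_gen (rev w) m" for w
    by (simp_all add: coact_poly_def adjoint_poly_def fgen_def fun_eq_iff)
  show "coact_poly 1 m = m" "adjoint_poly 1 m = m"
    using *[of "[]"] by simp_all
  show "coact_poly 0 m = (\<lambda>_ _. 0)" "adjoint_poly 0 m = (\<lambda>_ _. 0)"
    by (simp_all add: coact_poly_def adjoint_poly_def fun_eq_iff)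
qed

lemma act_linear:
  "coact_poly (P + R) m x y = coact_poly P m x y + coact_poly R m x y"
  "coact_poly (P - R) m x y = coact_poly P m x y - coact_poly R m x y"
  "coact_poly (- P) m x y = - coact_poly P m x y"
  "coact_poly (pm_scale t P) m x y = t * coact_poly P m x y"
  "adjoint_poly (P + R) m x y = adjoint_poly P m x y + adjoint_poly R m x y"
  "adjoint_poly (P - R) m x y = adjoint_poly P m x y - adjoint_poly R m x y"
  "adjoint_poly (- P) m x y = - adjoint_poly P m x y"
  "adjoint_poly (pm_scale t P) m x y = t * adjoint_poly P m x y"
  by (simp_all add: coact_poly_def adjoint_poly_def pm_sum_add pm_sum_diff pm_sum_uminus pm_sum_scale)

lemma act_zero_form: "coact_poly P (\<lambda>_ _. 0) = (\<lambda>_ _. 0)" "adjoint_poly P (\<lambda>_ _. 0) = (\<lambda>_ _. 0)"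
proof -
  have "foldr coact_gen w (\<lambda>_ _. 0) = (\<lambda>_ _. 0)" "foldr adjoint_gen w (\<lambda>_ _. 0) = (\<lambda>_ _. 0)" for w
    by (induction w, simp, rule ext, rule ext, rename_tac g w x y, case_tac g; simp)+
  then show "coact_poly P (\<lambda>_ _. 0) = (\<lambda>_ _. 0)" "adjoint_poly P (\<lambda>_ _. 0) = (\<lambda>_ _. 0)"
    by (simp_all add: coact_poly_def adjoint_poly_def lin_ext_def fun_eq_iff)
qed

lemma coact_poly_rels:
  assumes "P \<in> SUq2_rels q" "bilinear_form m"
  shows "coact_poly P m x y = 0"
  using assms(1) unfolding SUq2_rels_eq
  by (elim insertE emptyE; simp add: act_linear nf sc_left_commute[of x] sc_left_commute[of y]
      bilinear_formD[OF assms(2)]; simp add: field_simps)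

lemma adjoint_poly_rels:
  assumes "P \<in> SUq2_rels q" "bilinear_form m"
  shows "adjoint_poly P m x y = 0"
  using assms(1) unfolding SUq2_rels_eq
  by (elim insertE emptyE; simp add: act_linear nf sc_left_commute[of x]
      bilinear_formD[OF assms(2)]; simp add: field_simps)

lemma act_ideal:
  assumes "P \<in> SUq2_ideal q" "bilinear_form m"
  shows "coact_poly P m x y = 0" "adjoint_poly P m x y = 0"
proof -
  let ?I = "{P. \<forall>m. bilinear_form m \<longrightarrow> coact_poly P m = (\<lambda>_ _. 0) \<and> adjoint_poly P m = (\<lambda>_ _. 0)}"
  have "SUq2_ideal q \<subseteq> ?I"
    by (rule SUq2_ideal_minimal)
       (auto simp: coact_poly_rels adjoint_poly_rels fun_eq_iff act_linear coact_poly_mult adjoint_poly_mult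
          act_bilinear act_zero_form[unfolded fun_eq_iff] intro!: ext
          intro: arg_cong[of _ "\<lambda>_ _. 0" "\<lambda>m. coact_poly _ m _ _", THEN trans]
            arg_cong[of _ "\<lambda>_ _. 0" "\<lambda>m. adjoint_poly _ m _ _", THEN trans])
  then show "coact_poly P m x y = 0" "adjoint_poly P m x y = 0"
    using assms by (auto simp: fun_eq_iff)
qed

text \<open>
  The actions descend to the algebra by \<open>act_ideal\<close>; a representative in the free algebra is chosen to
  define them there.
\<close>

definition lift :: "'k qop \<Rightarrow> gen list \<Rightarrow>\<^sub>0 'k"
  where "lift p = (SOME P. ev P = p)"

lemma ev_lift [simp]: "p \<in> alg \<Longrightarrow> ev (lift p) = p"
  unfolding lift_def alg_def by (auto intro: someI)

definition "coact p = coact_poly (lift p)"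
definition "adjoint p = adjoint_poly (lift p)"

lemma act_cong:
  assumes "ev P = ev R" "bilinear_form m"
  shows "coact_poly P m = coact_poly R m" "adjoint_poly P m = adjoint_poly R m"
proof -
  have "P - R \<in> SUq2_ideal q"
    using assms(1) by (simp add: ev_eq_0_iff[symmetric])
  from act_ideal[OF this assms(2)] show "coact_poly P m = coact_poly R m" "adjoint_poly P m = adjoint_poly R m"
    by (auto simp: fun_eq_iff act_linear)
qed

lemma coact_ev: "bilinear_form m \<Longrightarrow> coact (ev P) m = coact_poly P m"
  and adjoint_ev: "bilinear_form m \<Longrightarrow> adjoint (ev P) m = adjoint_poly P m"
  using act_cong[of "lift (ev P)" P m] by (simp_all add: coact_def adjoint_def alg_def)

lemma coact_bilinear: "bilinear_form m \<Longrightarrow> bilinear_form (coact p m)"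
  and adjoint_bilinear: "bilinear_form m \<Longrightarrow> bilinear_form (adjoint p m)"
  by (simp_all add: coact_def adjoint_def act_bilinear)

lemma coact_simps:
  assumes "bilinear_form m"
  shows "p \<in> alg \<Longrightarrow> r \<in> alg \<Longrightarrow> coact (p + r) m x y = coact p m x y + coact r m x y"
    "p \<in> alg \<Longrightarrow> r \<in> alg \<Longrightarrow> coact (p - r) m x y = coact p m x y - coact r m x y"
    "p \<in> alg \<Longrightarrow> coact (sc t * p) m x y = t * coact p m x y"
    "p \<in> alg \<Longrightarrow> r \<in> alg \<Longrightarrow> coact (p * r) m = coact p (coact r m)"
    "coact a m = coact_gen Al m" "coact b m = coact_gen Be m" "coact c m = coact_gen Ga m" "coact d m = coact_gen De m"
    "coact (sc t) m x y = t * m x y" "coact 1 m = m"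
proof -
  have g: "coact (gen_op g) m = coact_gen g m" for g
    using coact_ev[OF assms, of "fgen [g]"] by simp
  show "coact a m = coact_gen Al m" "coact b m = coact_gen Be m" "coact c m = coact_gen Ga m" "coact d m = coact_gen De m"
    using g[of Al] g[of Be] g[of Ga] g[of De] by simp_all
  show 1: "coact 1 m = m"
    using coact_ev[OF assms, of 1] by simp
  show s: "coact (sc t * p) m x y = t * coact p m x y" if "p \<in> alg" for p
    using that coact_ev[OF assms, of "pm_scale t (lift p)"] by (simp add: act_linear coact_def)
  show "coact (sc t) m x y = t * m x y"
    using s[of 1] 1 by simp
  assume p: "p \<in> alg" "r \<in> alg"
  show "coact (p + r) m x y = coact p m x y + coact r m x y"
    using p coact_ev[OF assms, of "lift p + lift r"] by (simp add: act_linear coact_def)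
  show "coact (p - r) m x y = coact p m x y - coact r m x y"
    using p coact_ev[OF assms, of "lift p - lift r"] by (simp add: act_linear coact_def)
  show "coact (p * r) m = coact p (coact r m)"
    using p coact_ev[OF assms, of "lift p * lift r"] by (simp add: coact_poly_mult coact_def)
qed

lemma adjoint_simps:
  assumes "bilinear_form m"
  shows "p \<in> alg \<Longrightarrow> r \<in> alg \<Longrightarrow> adjoint (p + r) m x y = adjoint p m x y + adjoint r m x y"
    "p \<in> alg \<Longrightarrow> r \<in> alg \<Longrightarrow> adjoint (p - r) m x y = adjoint p m x y - adjoint r m x y"
    "p \<in> alg \<Longrightarrow> adjoint (sc t * p) m x y = t * adjoint p m x y"
    "p \<in> alg \<Longrightarrow> r \<in> alg \<Longrightarrow> adjoint (p * r) m = adjoint r (adjoint p m)"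
    "adjoint a m = adjoint_gen Al m" "adjoint b m = adjoint_gen Be m" "adjoint c m = adjoint_gen Ga m" "adjoint d m = adjoint_gen De m"
    "adjoint (sc t) m x y = t * m x y" "adjoint 1 m = m"
proof -
  have g: "adjoint (gen_op g) m = adjoint_gen g m" for g
    using adjoint_ev[OF assms, of "fgen [g]"] by simp
  show "adjoint a m = adjoint_gen Al m" "adjoint b m = adjoint_gen Be m" "adjoint c m = adjoint_gen Ga m" "adjoint d m = adjoint_gen De m"
    using g[of Al] g[of Be] g[of Ga] g[of De] by simp_all
  show 1: "adjoint 1 m = m"
    using adjoint_ev[OF assms, of 1] by simp
  show s: "adjoint (sc t * p) m x y = t * adjoint p m x y" if "p \<in> alg" for p
    using that adjoint_ev[OF assms, of "pm_scale t (lift p)"] by (simp add: act_linear adjoint_def)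
  show "adjoint (sc t) m x y = t * m x y"
    using s[of 1] 1 by simp
  assume p: "p \<in> alg" "r \<in> alg"
  show "adjoint (p + r) m x y = adjoint p m x y + adjoint r m x y"
    using p adjoint_ev[OF assms, of "lift p + lift r"] by (simp add: act_linear adjoint_def)
  show "adjoint (p - r) m x y = adjoint p m x y - adjoint r m x y"
    using p adjoint_ev[OF assms, of "lift p - lift r"] by (simp add: act_linear adjoint_def)
  show "adjoint (p * r) m = adjoint r (adjoint p m)"
    using p adjoint_ev[OF assms, of "lift p * lift r"] by (simp add: adjoint_poly_mult adjoint_def)
qed

lemma adjoint_scalar_inside:
  "bilinear_form m \<Longrightarrow> p \<in> alg \<Longrightarrow> adjoint p (adjoint (sc t) m) x y = t * adjoint p m x y"
  using adjoint_simps(3,4)[of m] by (metis alg_sc)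

section \<open>Coinvariance\<close>

text \<open>
  These are the forms that depend on the second argument only through the coalgebra \<open>C\<close>.
\<close>

definition kills_J :: "('k qop \<Rightarrow> 'k qop \<Rightarrow> 'k) \<Rightarrow> bool"
  where "kills_J m \<longleftrightarrow> bilinear_form m \<and> (\<forall>x. \<forall>y\<in>alg. m x ((xi - sc \<sigma>) * y) = 0 \<and>
    m x ((eta + sc \<sigma>) * y) = 0 \<and> m x (zeta * y) = 0)"

lemma kills_J_bilinear: "kills_J m \<Longrightarrow> bilinear_form m"
  by (simp add: kills_J_def)

lemma kills_J_mult:
  assumes "kills_J m" "y \<in> alg"
  shows "m x (xi * y) = \<sigma> * m x y" "m x (eta * y) = - \<sigma> * m x y" "m x (zeta * y) = 0"
proof -
  note B = bilinear_formD[OF kills_J_bilinear[OF assms(1)]]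
  have "m x ((xi - sc \<sigma>) * y) = 0" "m x ((eta + sc \<sigma>) * y) = 0" and z: "m x (zeta * y) = 0"
    using assms by (auto simp: kills_J_def)
  then show "m x (xi * y) = \<sigma> * m x y" "m x (eta * y) = - \<sigma> * m x y"
    by (simp_all add: distrib_right left_diff_distrib B add_eq_0_iff)
  show "m x (zeta * y) = 0" by (rule z)
qed

lemma kills_J_gens:
  assumes "kills_J m"
  shows "m x xi = \<sigma> * m x 1" "m x eta = - \<sigma> * m x 1" "m x zeta = 0"
  using kills_J_mult[OF assms, of 1 x] by simp_all

lemma coact_gen_kills_J:
  assumes "kills_J m"
  shows "kills_J (coact_gen g m)"
  unfolding kills_J_def
proof (intro conjI allI ballI)
  show "bilinear_form (coact_gen g m)"
    by (rule coact_gen_bilinear[OF kills_J_bilinear[OF assms]])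
  fix x y assume "y \<in> alg"
  then have "m x' ((xi - sc \<sigma>) * (y * gen_op g')) = 0" "m x' ((eta + sc \<sigma>) * (y * gen_op g')) = 0"
    "m x' (zeta * (y * gen_op g')) = 0" for x' g'
    using assms by (simp_all add: kills_J_def)
  note * = this[where g' = Al] this[where g' = Be] this[where g' = Ga] this[where g' = De]
  show "coact_gen g m x ((xi - sc \<sigma>) * y) = 0" "coact_gen g m x ((eta + sc \<sigma>) * y) = 0"
    "coact_gen g m x (zeta * y) = 0"
    using * by (cases g; simp add: mult.assoc)+
qed

lemma coact_kills_J:
  assumes "kills_J m"
  shows "kills_J (coact p m)"
proof -
  have *: "kills_J (foldr coact_gen w m)" for w
    by (induction w) (simp_all add: assms coact_gen_kills_J)
  note bilin = kills_J_bilinear[OF assms]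
  have "coact_poly P m x y = 0" if "\<And>w. foldr coact_gen w m x y = 0" for P x y
    by (simp add: coact_poly_def that lin_ext_def)
  then show ?thesis
    using * coact_bilinear[OF bilin] by (auto simp: kills_J_def coact_def)
qed

text \<open>
  For a generator \<open>z\<close> of the sphere the second legs of \<open>\<Delta>(z)\<close> are again combinations of \<open>\<xi>\<close>, \<open>\<eta>\<close>, \<open>\<zeta>\<close> and \<open>1\<close>.
  The form replaces them by their counits, which leaves \<open>z\<close> in the first leg.
\<close>

lemma coact_sphere:
  assumes "z \<in> sphere" "kills_J n"
  shows "coact z n x 1 = n (x * z) 1"
  using assms
proof (induction arbitrary: n x rule: sphere.induct)
  case (sphere_sc t)
  then show ?case
    by (simp add: coact_simps kills_J_bilinear sc_central[of x] bilinear_formD)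
next
  case sphere_xi
  note b = kills_J_bilinear[OF sphere_xi]
  note B = bilinear_formD[OF b]
  have "coact xi n x 1 = n (x * (a * a)) xi + inverse q * n (x * (b * b)) eta
    + inverse q * (1 + inverse q ^ 2) * n (x * (a * b)) zeta
    + (\<sigma>\<^sup>2 - 1) * inverse q * n (x * (a * b)) 1"
    by (simp add: xi_def eta_def zeta_def coact_simps b coact_gen_bilinear nf sc_left_commute[of x] B)
       (simp add: field_simps power2_eq_square)
  also have "\<dots> = n (x * xi) 1"
    by (simp only: kills_J_gens[OF sphere_xi])
       (simp add: xi_def distrib_left right_diff_distrib sc_left_commute[of x] B algebra_simps)
  finally show ?case .
next
  case sphere_eta
  note b = kills_J_bilinear[OF sphere_eta]
  note B = bilinear_formD[OF b]
  have "coact eta n x 1 = q * n (x * (c * c)) xi + n (x * (d * d)) eta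
    + (1 + inverse q ^ 2) * n (x * (c * d)) zeta + (\<sigma>\<^sup>2 - 1) * n (x * (c * d)) 1"
    by (simp add: xi_def eta_def zeta_def coact_simps b coact_gen_bilinear nf sc_left_commute[of x] B)
       (simp add: field_simps power2_eq_square)
  also have "\<dots> = n (x * eta) 1"
    by (simp only: kills_J_gens[OF sphere_eta])
       (simp add: eta_def distrib_left right_diff_distrib sc_left_commute[of x] B algebra_simps)
  finally show ?case .
next
  case sphere_zeta
  note b = kills_J_bilinear[OF sphere_zeta]
  note B = bilinear_formD[OF b]
  have "coact zeta n x 1 = q * n (x * (a * c)) xi + n (x * (b * d)) eta + n x zeta
    + (q + inverse q) * n (x * (b * c)) zeta + (\<sigma>\<^sup>2 - 1) * q * n (x * (b * c)) 1"
    by (simp add: xi_def eta_def zeta_def coact_simps b coact_gen_bilinear nf sc_left_commute[of x] B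
        field_simps)
  also have "\<dots> = n (x * zeta) 1"
    by (simp only: kills_J_gens[OF sphere_zeta])
       (simp add: zeta_def distrib_left right_diff_distrib sc_left_commute[of x] B algebra_simps)
  finally show ?case .
next
  case (sphere_add z z')
  then show ?case
    by (simp add: coact_simps kills_J_bilinear sphere_alg distrib_left bilinear_formD)
next
  case (sphere_mult z z')
  then show ?case
    by (simp add: coact_simps kills_J_bilinear sphere_alg coact_kills_J mult.assoc)
qed

text \<open>
  Apply \<open>\<pi>\<close> to the second row of \<open>u = e u\<close>; modulo \<open>J\<close> the entries of \<open>e\<close> become scalars.
\<close>

lemma kills_J_u2:
  assumes "kills_J m"
  shows "m x u2 = \<sigma> * m x u1"
proof -
  note B = bilinear_formD[OF kills_J_bilinear[OF assms]]
  have "sc (1 + \<sigma>\<^sup>2) * u2 = u2 * (w1 * u1 + w2 * u2)"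
    by (simp only: wu sc_central)
  also have "\<dots> = - eta * u1 + (sc (\<sigma>\<^sup>2) + sc (inverse (q\<^sup>2)) * zeta) * u2"
    by (simp only: distrib_left mult.assoc[symmetric] uw)
  finally have "(1 + \<sigma>\<^sup>2) * m x u2 = m x (- eta * u1 + (sc (\<sigma>\<^sup>2) + sc (inverse (q\<^sup>2)) * zeta) * u2)"
    by (metis B(4))
  also have "\<dots> = \<sigma> * m x u1 + \<sigma>\<^sup>2 * m x u2"
    by (simp add: B distrib_right mult.assoc kills_J_mult[OF assms])
  finally show ?thesis
    by (simp add: algebra_simps)
qed

lemma coact_u:
  assumes "kills_J m"
  shows "coact u1 m x 1 = m (x * u1) u1" "coact u2 m x 1 = m (x * u2) u1"
proof -
  note b = kills_J_bilinear[OF assms]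
  note B = bilinear_formD[OF b]
  have "coact u1 m x 1 = m (x * a) u1 + m (x * b) u2" "coact u2 m x 1 = m (x * c) u1 + m (x * d) u2"
    by (simp_all add: u1_def u2_def coact_simps b coact_gen_bilinear B algebra_simps)
  moreover have "x * u1 = x * a + sc \<sigma> * (x * b)" "x * u2 = x * c + sc \<sigma> * (x * d)"
    by (simp_all only: u1_def u2_def distrib_left sc_left_commute[of x])
  ultimately show "coact u1 m x 1 = m (x * u1) u1" "coact u2 m x 1 = m (x * u2) u1"
    by (simp_all only: kills_J_u2[OF assms] B)
qed

text \<open>
  This puts \<open>x u\<^sub>1 + y u\<^sub>2\<close> into the line bundle.
\<close>

lemma coact_row:
  assumes "kills_J m" "x \<in> sphere" "y \<in> sphere"
  shows "coact (x * u1 + y * u2) m 1 1 = m (x * u1 + y * u2) u1"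
  using assms
  by (simp add: coact_simps kills_J_bilinear sphere_alg coact_sphere coact_kills_J coact_u bilinear_formD)

text \<open>
  The legs of \<open>\<Delta>(w\<^sub>j)\<close> on the right are combinations of \<open>w\<^sub>1\<close> and \<open>w\<^sub>2\<close>, and \<open>u\<^sub>1 w\<^sub>1\<close> and \<open>u\<^sub>1 w\<^sub>2\<close> lie in the sphere. Hence
  multiplication by \<open>w\<^sub>j\<close> turns elements that transform by the group-like \<open>\<pi>(u\<^sub>1)\<close> into coinvariant ones.
\<close>

lemma coact_w:
  assumes "kills_J m"
  shows "coact w1 m x u1 = m (x * w1) 1" "coact w2 m x u1 = m (x * w2) 1"
proof -
  note b = kills_J_bilinear[OF assms]
  note B = bilinear_formD[OF b]
  have "coact w1 m x y = m (x * d) (y * w1) - q * m (x * c) (y * w2)"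
    "coact w2 m x y = m (x * a) (y * w2) - inverse q * m (x * b) (y * w1)" for y
    by (simp_all add: w1_def w2_def coact_simps b coact_gen_bilinear B distrib_left right_diff_distrib
        sc_left_commute[of y] algebra_simps)
  then have "coact w1 m x u1 = m (x * d) 1 - q * (\<sigma> * m (x * c) 1)"
    "coact w2 m x u1 = \<sigma> * m (x * a) 1 - inverse q * m (x * b) 1"
    by (simp_all only: uw kills_J_gens[OF assms] B) simp_all
  then show "coact w1 m x u1 = m (x * w1) 1" "coact w2 m x u1 = m (x * w2) 1"
    by (simp_all add: B w1_def w2_def right_diff_distrib sc_left_commute[of x])
qed

text \<open>
  Since \<open>\<Delta>(z)\<close> has its second legs in the sphere, a balanced form moves them to the left, where
  \<open>S(z\<^sub>1) z\<^sub>2\<close> is the counit of \<open>z\<close>. Consequently the map \<open>c \<mapsto> S(c\<^sub>1) \<otimes> c\<^sub>2\<close> is well defined on \<open>C\<close>.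
\<close>

lemma adjoint_balanced:
  assumes "balanced l"
  shows "adjoint xi l = (\<lambda>x y. \<sigma> * l x y)" "adjoint eta l = (\<lambda>x y. - \<sigma> * l x y)" "adjoint zeta l = (\<lambda>_ _. 0)"
proof -
  have b: "bilinear_form l" and bal: "\<And>s x y. s \<in> sphere \<Longrightarrow> l x (s * y) = l (x * s) y"
    using assms by (simp_all add: balanced_def)
  note B = bilinear_formD[OF b]
  \<comment> \<open>Normalization by \<open>q p = 1\<close> keeps the scalars polynomial.\<close>
  define p where "p = inverse q"
  have p: "q * p = 1" "p * q = 1"
    by (simp_all add: p_def)
  have pq: "q * (p * t) = t" "p * (q * t) = t" for t
    by (simp_all add: p_def)
  have gen: "adjoint z l x y = \<tau> * l x y"
    if "z \<in> {xi, eta, zeta}" "adjoint z l x y = l (x * A) (xi * y) + l (x * B') (eta * y) + l (x * C) (zeta * y) + l (x * E) y"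
      "A * xi + B' * eta + C * zeta + E = sc \<tau>" for A B' C E z x y \<tau>
  proof -
    have "adjoint z l x y = l (x * (A * xi + B' * eta + C * zeta + E)) y"
      by (simp only: that(2) distrib_left B mult.assoc[symmetric] bal sphere.intros)
    then show ?thesis
      by (simp only: that(3) sc_central[of x] B)
  qed
  show "adjoint xi l = (\<lambda>x y. \<sigma> * l x y)"
  proof (intro ext)
    fix x y
    show "adjoint xi l x y = \<sigma> * l x y"
    proof (rule gen)
      show "adjoint xi l x y = l (x * (d * d)) (xi * y) + l (x * (sc (p * p * p) * (b * b))) (eta * y)
        + l (x * (sc (- p * p * (1 + p * p)) * (b * d))) (zeta * y)
        + l (x * (sc (- p * p * (\<sigma>\<^sup>2 - 1)) * (b * d))) y"
        by (simp add: xi_def eta_def zeta_def adjoint_simps adjoint_scalar_inside b adjoint_gen_bilinear nf sc_left_commute[of x] B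
            p_def[symmetric]) (simp add: algebra_simps p pq)
      show "d * d * xi + sc (p * p * p) * (b * b) * eta + sc (- p * p * (1 + p * p)) * (b * d) * zeta
        + sc (- p * p * (\<sigma>\<^sup>2 - 1)) * (b * d) = sc \<sigma>"
        by (rule qop_eqI_functional) (simp add: xi_def eta_def zeta_def nf p_def[symmetric] algebra_simps p pq)
    qed simp
  qed
  show "adjoint eta l = (\<lambda>x y. - \<sigma> * l x y)"
  proof (intro ext)
    fix x y
    show "adjoint eta l x y = - \<sigma> * l x y"
    proof (rule gen)
      show "adjoint eta l x y = l (x * (sc (q * q * q) * (c * c))) (xi * y) + l (x * (a * a)) (eta * y)
        + l (x * (sc (- q * (1 + p * p)) * (a * c))) (zeta * y)
        + l (x * (sc (- q * (\<sigma>\<^sup>2 - 1)) * (a * c))) y"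
        by (simp add: xi_def eta_def zeta_def adjoint_simps adjoint_scalar_inside b adjoint_gen_bilinear nf sc_left_commute[of x] B
            p_def[symmetric]) (simp add: algebra_simps p pq)
      show "sc (q * q * q) * (c * c) * xi + a * a * eta + sc (- q * (1 + p * p)) * (a * c) * zeta
        + sc (- q * (\<sigma>\<^sup>2 - 1)) * (a * c) = sc (- \<sigma>)"
        by (rule qop_eqI_functional) (simp add: sc_uminus xi_def eta_def zeta_def nf p_def[symmetric] algebra_simps p pq)
    qed simp
  qed
  show "adjoint zeta l = (\<lambda>_ _. 0)"
  proof (intro ext)
    fix x y
    have "adjoint zeta l x y = 0 * l x y"
    proof (rule gen)
      show "adjoint zeta l x y = l (x * (sc (- q * q) * (c * d))) (xi * y) + l (x * (sc (- p) * (a * b))) (eta * y)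
        + l (x * (1 + sc (q + p) * (b * c))) (zeta * y)
        + l (x * (sc (q * (\<sigma>\<^sup>2 - 1)) * (b * c))) y"
        by (simp add: xi_def eta_def zeta_def adjoint_simps adjoint_scalar_inside b adjoint_gen_bilinear nf sc_left_commute[of x] B
            p_def[symmetric]) (simp add: algebra_simps p pq)
      show "sc (- q * q) * (c * d) * xi + sc (- p) * (a * b) * eta + (1 + sc (q + p) * (b * c)) * zeta
        + sc (q * (\<sigma>\<^sup>2 - 1)) * (b * c) = sc 0"
        by (rule qop_eqI_functional) (simp add: xi_def eta_def zeta_def nf p_def[symmetric] algebra_simps p pq)
    qed simp
    then show "adjoint zeta l x y = 0" by simp
  qed
qed

text \<open>
  In Sweedler notation this is \<open>x w\<^sub>1 S(w\<^sub>2) S(y\<^sub>1) \<otimes> y\<^sub>2 w\<^sub>3 = x S(y\<^sub>1) \<otimes> y\<^sub>2 w\<close>.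
\<close>

lemma coact_gen_antipode:
  assumes F: "\<And>y. y \<in> alg \<Longrightarrow> M y = adjoint y l" and l: "bilinear_form l" and y: "y \<in> alg"
  shows "foldr coact_gen w (\<lambda>x y. M y x z) x y = adjoint y l x (word_op w * z)"
  using y
proof (induction w arbitrary: x y)
  case Nil
  then show ?case by (simp add: F)
next
  case (Cons g w)
  note B = bilinear_formD[OF adjoint_bilinear[OF l, of y]]
  show ?case
    using Cons.prems
    by (cases g; simp add: Cons.IH adjoint_simps adjoint_bilinear l nf sc_left_commute[of x] B; simp add: field_simps)
qed

lemma bilinear_form_sum:
  assumes "bilinear_form m"
  shows "m x (sum f I) = (\<Sum>i\<in>I. m x (f i))"
  by (induction I rule: infinite_finite_induct) (simp_all add: bilinear_formD[OF assms])

lemma bilinear_form_ev: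
  assumes "bilinear_form m"
  shows "lin_ext (*) (\<lambda>w. m x (word_op w * z)) P = m x (ev P * z)"
  by (simp add: ev_def lin_ext_def sum_distrib_right bilinear_form_sum[OF assms] mult.assoc
      bilinear_formD[OF assms])

text \<open>
  The form \<open>m(x, y) = l(x S(y\<^sub>1), y\<^sub>2)\<close> kills \<open>J\<close>. Its values on \<open>\<Delta>(p)\<close> and on \<open>p \<otimes> 1\<close> are \<open>l(1, p)\<close> and \<open>l(p, 1)\<close>.
  The projection onto the algebra serves only to define \<open>m\<close> for all operators.
\<close>

lemma coinvariant_balanced:
  assumes l: "balanced l" and p: "p \<in> alg"
    and inv: "\<And>m. kills_J m \<Longrightarrow> coact p m 1 1 = m p 1"
  shows "l 1 p = l p 1"
proof -
  have b: "bilinear_form l"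
    using l by (simp add: balanced_def)
  have "op.subspace alg"
    by (rule op.subspaceI) simp_all
  from op.linear_projection_onto[OF this] obtain pr where
    pr: "Vector_Spaces.linear (\<lambda>c x. sc c * x) (\<lambda>c x. sc c * x) pr" "\<And>x. pr x \<in> alg"
      "\<And>x. x \<in> alg \<Longrightarrow> pr x = x"
    by blast
  have pr_lin: "pr (x + y) = pr x + pr y" "pr (sc t * x) = sc t * pr x" for x y t
    using pr(1) by (simp_all add: Vector_Spaces.linear_iff)
  define m where "m x y = adjoint (pr y) l x 1" for x y
  have gop0: "adjoint z l = (\<lambda>_ _. 0)"
    if "z = (xi - sc \<sigma>) * y \<or> z = (eta + sc \<sigma>) * y \<or> z = zeta * y" "y \<in> alg" for z y
  proof -
    have "adjoint (xi - sc \<sigma>) l = (\<lambda>_ _. 0)" "adjoint (eta + sc \<sigma>) l = (\<lambda>_ _. 0)" "adjoint zeta l = (\<lambda>_ _. 0)"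
      by (simp_all add: fun_eq_iff adjoint_simps b adjoint_balanced[OF l])
    moreover have "adjoint y (\<lambda>_ _. 0) = (\<lambda>_ _. 0)"
      by (simp add: adjoint_def act_zero_form)
    ultimately show ?thesis
      using that by (auto simp: adjoint_simps b)
  qed
  have "bilinear_form m"
    unfolding bilinear_form_def m_def
    using bilinear_formD[OF adjoint_bilinear[OF b]]
    by (simp add: pr(2) pr_lin adjoint_simps adjoint_scalar_inside b)
  moreover have "m x z = 0"
    if "z = (xi - sc \<sigma>) * y \<or> z = (eta + sc \<sigma>) * y \<or> z = zeta * y" "y \<in> alg" for x y z
  proof -
    have "z \<in> alg"
      using that by auto
    then show ?thesis
      by (simp only: m_def pr(3) gop0[OF that])
  qed
  ultimately have "kills_J m"
    unfolding kills_J_def by blast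
  moreover have "coact p m 1 1 = l 1 p"
  proof -
    have "coact_poly (lift p) m 1 1 = lin_ext (*) (\<lambda>w. l 1 (word_op w * 1)) (lift p)"
      unfolding coact_poly_def m_def[abs_def]
      using coact_gen_antipode[of "\<lambda>y. adjoint (pr y) l" l 1 _ 1 1] pr(3) b by (simp add: adjoint_simps)
    also have "\<dots> = l 1 (p * 1)"
      using p by (simp only: bilinear_form_ev[OF b] ev_lift)
    finally show ?thesis
      by (simp add: coact_def)
  qed
  moreover have "m p 1 = l p 1"
    using pr(3)[of 1] by (simp add: m_def adjoint_simps b)
  ultimately show ?thesis
    using inv by metis
qed

lemma coinvariant_imp_row:
  assumes p: "p \<in> alg" and inv: "\<And>m. kills_J m \<Longrightarrow> coact p m 1 1 = m p u1"
  shows "p * w1 \<in> sphere" "p * w2 \<in> sphere"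
proof -
  have *: "p * w \<in> sphere" if w: "w \<in> alg" "\<And>m x. kills_J m \<Longrightarrow> coact w m x u1 = m (x * w) 1" for w
  proof (rule balanced_imp_sphere)
    show "p * w \<in> alg"
      using p w(1) by simp
    show "l 1 (p * w) = l (p * w) 1" if "balanced l" for l
    proof (rule coinvariant_balanced[OF that])
      show "p * w \<in> alg"
        using p w(1) by simp
      show "coact (p * w) m 1 1 = m (p * w) 1" if "kills_J m" for m
        using inv[OF coact_kills_J[OF that, of w]] w(2)[OF that, of p] p w(1) kills_J_bilinear[OF that]
        by (simp add: coact_simps)
    qed
  qed
  show "p * w1 \<in> sphere" "p * w2 \<in> sphere"
    by (rule *; simp add: coact_w)+
qed

end

section \<open>Tensors are separated by bilinear forms\<close>

lemma free_space_simps: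
  "carrier (free_space B f e) = {p. keys p \<subseteq> B}"
  "zero (free_space B f e) = 0" "add (free_space B f e) = (+)"
  "smult (free_space B f e) = (\<lambda>c. pm_scale c)"
  "one (free_space B f e) = single e 1"
  "mult (free_space B f e) = (\<lambda>p r. \<Sum>x\<in>keys p. \<Sum>y\<in>keys r.
        single (f x y) (lookup p x * lookup r y))"
  by (simp_all add: free_space_def)

lemma pm_keys_closed:
  "keys (0 :: 'x \<Rightarrow>\<^sub>0 'k::field) \<subseteq> B"
  "keys p \<subseteq> B \<Longrightarrow> keys r \<subseteq> B \<Longrightarrow> keys (p + r) \<subseteq> B"
  "keys p \<subseteq> B \<Longrightarrow> keys (pm_scale t p) \<subseteq> B"
  for p r :: "'x \<Rightarrow>\<^sub>0 'k::field"
  using Poly_Mapping.keys_add[of p r] by (auto simp: in_keys_iff subset_iff)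

lemma submodule_free_spaceI:
  assumes "H \<subseteq> carrier (free_space B f e)" "0 \<in> H" "\<And>x y. x \<in> H \<Longrightarrow> y \<in> H \<Longrightarrow> x + y \<in> H"
    "\<And>c x. x \<in> H \<Longrightarrow> pm_scale c x \<in> H"
  shows "submodule H (scalars :: 'k::field ring) (free_space B f e)"
proof (intro submodule.intro subgroup.intro submodule_axioms.intro)
  fix x assume x: "x \<in> H"
  have neg: "- x \<in> H"
    using assms(4)[OF x, of "- 1"] by simp
  have "inv\<^bsub>add_monoid (free_space B f e)\<^esub> x = - x"
    unfolding m_inv_def
    by (rule the_equality) (use x neg assms(1) in \<open>auto simp: free_space_simps eq_neg_iff_add_eq_0 add.commute\<close>)
  then show "inv\<^bsub>add_monoid (free_space B f e)\<^esub> x \<in> H"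
    using neg by simp
qed (use assms in \<open>auto simp: free_space_simps\<close>)

lemma submodule_free_spaceD:
  assumes "submodule H (scalars :: 'k::field ring) (free_space B f e)"
  shows "0 \<in> H" "x \<in> H \<Longrightarrow> y \<in> H \<Longrightarrow> x + y \<in> H" "x \<in> H \<Longrightarrow> pm_scale c x \<in> H"
  using subgroup.one_closed[OF submodule.axioms(1)[OF assms]]
    subgroup.m_closed[OF submodule.axioms(1)[OF assms], of x y]
    submodule.smult_closed[OF assms, of c x]
  by (simp_all add: free_space_simps scalars_def)

lemma lin_span_closed:
  fixes B :: "'x set" and f :: "'x \<Rightarrow> 'x \<Rightarrow> 'x" and e :: 'x and S :: "('x \<Rightarrow>\<^sub>0 'k::field) set"
  defines "L \<equiv> lin_span (free_space B f e) S"
  shows "0 \<in> L" "x \<in> L \<Longrightarrow> y \<in> L \<Longrightarrow> x + y \<in> L" "x \<in> L \<Longrightarrow> pm_scale c x \<in> L" "S \<subseteq> L"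
  unfolding L_def lin_span_def
  using submodule_free_spaceD[of _ B f e] by (auto; blast)+

lemma lin_span_minimal:
  fixes f :: "'x \<Rightarrow> 'x \<Rightarrow> 'x" and S :: "('x \<Rightarrow>\<^sub>0 'k::field) set"
  assumes "S \<subseteq> H" "H \<subseteq> carrier (free_space B f e)" "0 \<in> H" "\<And>x y. x \<in> H \<Longrightarrow> y \<in> H \<Longrightarrow> x + y \<in> H"
    "\<And>c x. x \<in> H \<Longrightarrow> pm_scale c x \<in> H"
  shows "lin_span (free_space B f e) S \<subseteq> H"
  unfolding lin_span_def using submodule_free_spaceI[OF assms(2-5)] assms(1) by blast

lemma lin_span_functional:
  fixes f :: "'x \<Rightarrow> 'x \<Rightarrow> 'x" and S :: "('x \<Rightarrow>\<^sub>0 'k::field) set"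
  assumes "z \<notin> lin_span (free_space B f e) S"
  obtains g where "Vector_Spaces.linear pm_scale (*) g" "\<And>y. y \<in> S \<Longrightarrow> g y = 0" "g z = 1"
proof -
  obtain H where H: "submodule H (scalars :: 'k ring) (free_space B f e)" "S \<subseteq> H" "z \<notin> H"
    using assms unfolding lin_span_def by blast
  have "pm.subspace H"
    by (rule pm.subspaceI) (use submodule_free_spaceD[OF H(1)] in auto)
  then have "z \<notin> pm.span H"
    using H(3) by (simp add: pm.span_eq_iff[THEN iffD2])
  from pm.functional_separating[OF this] show ?thesis
    using that H(2) by blast
qed

definition tval :: "('v \<Rightarrow> 'w \<Rightarrow> 'k::field) \<Rightarrow> (('v \<times> 'w) \<Rightarrow>\<^sub>0 'k) \<Rightarrow> 'k"
  where "tval m = lin_ext (*) (\<lambda>(v, w). m v w)"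

definition bilinear_on :: "('k::field, 'v) module \<Rightarrow> ('k, 'w) module \<Rightarrow> ('v \<Rightarrow> 'w \<Rightarrow> 'k) \<Rightarrow> bool"
  where "bilinear_on V W m \<longleftrightarrow>
    (\<forall>v\<in>carrier V. \<forall>v'\<in>carrier V. \<forall>w\<in>carrier W. m (v \<oplus>\<^bsub>V\<^esub> v') w = m v w + m v' w) \<and>
    (\<forall>v\<in>carrier V. \<forall>w\<in>carrier W. \<forall>w'\<in>carrier W. m v (w \<oplus>\<^bsub>W\<^esub> w') = m v w + m v w') \<and>
    (\<forall>t. \<forall>v\<in>carrier V. \<forall>w\<in>carrier W. m (t \<odot>\<^bsub>V\<^esub> v) w = t * m v w) \<and>
    (\<forall>t. \<forall>v\<in>carrier V. \<forall>w\<in>carrier W. m v (t \<odot>\<^bsub>W\<^esub> w) = t * m v w)"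

definition pairs :: "('k::field, 'v) module \<Rightarrow> ('k, 'w) module \<Rightarrow> (('v \<times> 'w) \<Rightarrow>\<^sub>0 'k) set"
  where "pairs V W = {p. keys p \<subseteq> carrier V \<times> carrier W}"

definition tclass :: "('k::field, 'v) module \<Rightarrow> ('k, 'w) module \<Rightarrow> (('v \<times> 'w) \<Rightarrow>\<^sub>0 'k) \<Rightarrow> (('v \<times> 'w) \<Rightarrow>\<^sub>0 'k) set"
  where "tclass V W z = tensor_kernel V W +>\<^bsub>pair_space V W\<^esub> z"

lemma tval_simps [simp]:
  "tval m (p + r) = tval m p + tval m r" "tval m (p - r) = tval m p - tval m r"
  "tval m (pm_scale t p) = t * tval m p" "tval m 0 = 0" "tval m (single (v, w) t) = t * m v w"
  by (simp_all add: tval_def pm_sum_add pm_sum_diff pm_sum_scale)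

lemma tval_sum: "tval m (sum f I) = (\<Sum>i\<in>I. tval m (f i))"
  by (simp add: tval_def pm_sum_sum)

lemma tval_cong:
  assumes "z \<in> pairs V W" "\<And>v w. v \<in> carrier V \<Longrightarrow> w \<in> carrier W \<Longrightarrow> m v w = m' v w"
  shows "tval m z = tval m' z"
  unfolding tval_def lin_ext_def
  by (rule sum.cong) (use assms in \<open>auto simp: pairs_def\<close>)

lemma pairs_closed [simp]:
  "0 \<in> pairs V W" "p \<in> pairs V W \<Longrightarrow> r \<in> pairs V W \<Longrightarrow> p + r \<in> pairs V W"
  "p \<in> pairs V W \<Longrightarrow> pm_scale t p \<in> pairs V W"
  "v \<in> carrier V \<Longrightarrow> w \<in> carrier W \<Longrightarrow> single (v, w) t \<in> pairs V W"
  by (simp_all add: pairs_def pm_keys_closed)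

lemma pairs_sum: "(\<And>i. i \<in> I \<Longrightarrow> f i \<in> pairs V W) \<Longrightarrow> sum f I \<in> pairs V W"
  by (induction I rule: infinite_finite_induct) simp_all

lemma pairs_diff [simp]: "p \<in> pairs V W \<Longrightarrow> r \<in> pairs V W \<Longrightarrow> p - r \<in> pairs V W"
  using pairs_closed(2)[of p V W "pm_scale (- 1) r"] pairs_closed(3)[of r V W "- 1"] by simp

lemma pair_space_simps:
  "carrier (pair_space V W) = pairs V W" "zero (pair_space V W) = 0" "add (pair_space V W) = (+)"
  "smult (pair_space V W) = (\<lambda>c. pm_scale c)"
  by (simp_all add: pair_space_def free_space_simps pairs_def)

definition closed_space :: "('k, 'v) module \<Rightarrow> bool"
  where "closed_space V \<longleftrightarrow> (\<forall>v\<in>carrier V. \<forall>v'\<in>carrier V. v \<oplus>\<^bsub>V\<^esub> v' \<in> carrier V) \<and>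
    (\<forall>t. \<forall>v\<in>carrier V. t \<odot>\<^bsub>V\<^esub> v \<in> carrier V)"

lemma kernel_closed:
  "0 \<in> tensor_kernel V W"
  "x \<in> tensor_kernel V W \<Longrightarrow> y \<in> tensor_kernel V W \<Longrightarrow> x + y \<in> tensor_kernel V W"
  "x \<in> tensor_kernel V W \<Longrightarrow> pm_scale c x \<in> tensor_kernel V W"
  unfolding tensor_kernel_def pair_space_def
  by (rule lin_span_closed; assumption?)+

lemma kernel_uminus: "x \<in> tensor_kernel V W \<Longrightarrow> - x \<in> tensor_kernel V W"
  using kernel_closed(3)[of x V W "- 1"] by simp

lemma kernel_tval:
  assumes "closed_space V" "closed_space W" "z \<in> tensor_kernel V W"
  shows "z \<in> pairs V W" "bilinear_on V W m \<Longrightarrow> tval m z = 0"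
proof -
  have "tensor_kernel V W \<subseteq> {z \<in> pairs V W. \<forall>m. bilinear_on V W m \<longrightarrow> tval m z = 0}"
    unfolding tensor_kernel_def pair_space_def
  proof (rule lin_span_minimal)
    show "bilinear_rels V W \<subseteq> {z \<in> pairs V W. \<forall>m. bilinear_on V W m \<longrightarrow> tval m z = 0}"
      using assms(1,2) by (auto simp: bilinear_rels_def Let_def bilinear_on_def closed_space_def)
  qed (auto simp: free_space_simps pairs_def[symmetric])
  then show "z \<in> pairs V W" "bilinear_on V W m \<Longrightarrow> tval m z = 0"
    using assms(3) by auto
qed

text \<open>
  A functional that separates a vector from the subspace of relations is a bilinear form.
\<close>

lemma kernelI:
  assumes "\<And>m. bilinear_on V W m \<Longrightarrow> tval m z = 0"
  shows "z \<in> tensor_kernel V W"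
proof (rule ccontr)
  assume "\<not> ?thesis"
  then obtain g where g: "Vector_Spaces.linear pm_scale (*) g"
    "\<And>y. y \<in> bilinear_rels V W \<Longrightarrow> g y = 0" "g z = 1"
    unfolding tensor_kernel_def pair_space_def by (rule lin_span_functional) blast
  have g_add: "g (u + v) = g u + g v" and g_scale: "g (pm_scale t u) = t * g u" for u v t
    using g(1) by (simp_all add: Vector_Spaces.linear_iff)
  have g_diff: "g (u - v) = g u - g v" for u v
    using g_add[of "u - v" v] by simp
  let ?m = "\<lambda>v w. g (single (v, w) 1)"
  have single: "g (single (v, w) t) = t * ?m v w" for v w t
    using g_scale[of t "single (v, w) 1"] by simp
  have "bilinear_on V W ?m"
    unfolding bilinear_on_def
  proof (intro conjI ballI allI)
    fix v v' w w' t
    assume v: "v \<in> carrier V" and w: "w \<in> carrier W"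
    note rel = g(2)[unfolded bilinear_rels_def Let_def]
    show "?m (v \<oplus>\<^bsub>V\<^esub> v') w = ?m v w + ?m v' w" if "v' \<in> carrier V"
    proof -
      have "g (single (v \<oplus>\<^bsub>V\<^esub> v', w) 1 - single (v, w) 1 - single (v', w) 1) = 0"
        by (rule rel) (use v w that in blast)
      then show ?thesis by (simp add: g_diff g_add algebra_simps)
    qed
    show "?m v (w \<oplus>\<^bsub>W\<^esub> w') = ?m v w + ?m v w'" if "w' \<in> carrier W"
    proof -
      have "g (single (v, w \<oplus>\<^bsub>W\<^esub> w') 1 - single (v, w) 1 - single (v, w') 1) = 0"
        by (rule rel) (use v w that in blast)
      then show ?thesis by (simp add: g_diff g_add algebra_simps)
    qed
    have "g (single (t \<odot>\<^bsub>V\<^esub> v, w) 1 - single (v, w) t) = 0"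
      "g (single (v, t \<odot>\<^bsub>W\<^esub> w) 1 - single (v, w) t) = 0"
      by (rule rel; use v w in blast)+
    then show "?m (t \<odot>\<^bsub>V\<^esub> v) w = t * ?m v w" "?m v (t \<odot>\<^bsub>W\<^esub> w) = t * ?m v w"
      by (simp_all add: g_diff single[of _ _ t])
  qed
  from assms[OF this] have "g z = 0"
    using linear_eq_lin_ext[OF g(1), of z] by (simp add: tval_def split_def)
  then show False
    using g(3) by simp
qed

lemma mem_tclass: "y \<in> tclass V W z \<longleftrightarrow> y - z \<in> tensor_kernel V W"
proof -
  have "tclass V W z = (\<lambda>h. h + z) ` tensor_kernel V W"
    by (auto simp: tclass_def a_r_coset_def r_coset_def pair_space_simps)
  then show ?thesis
    by (auto simp: image_iff) (metis diff_add_cancel)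
qed

lemma tclass_eqI_kernel:
  assumes "z - z' \<in> tensor_kernel V W"
  shows "tclass V W z = tclass V W z'"
proof -
  have "y - z \<in> tensor_kernel V W \<longleftrightarrow> y - z' \<in> tensor_kernel V W" for y
    using kernel_closed(2)[of "y - z" V W "z - z'"] kernel_closed(2)[of "y - z'" V W "- (z - z')"]
      kernel_uminus[OF assms] assms by auto
  then show ?thesis
    by (auto simp: mem_tclass)
qed

lemma tclass_eqI:
  assumes "\<And>m. bilinear_on V W m \<Longrightarrow> tval m z = tval m z'"
  shows "tclass V W z = tclass V W z'"
  by (rule tclass_eqI_kernel[OF kernelI]) (simp add: assms)

lemma tclass_self: "z \<in> tclass V W z"
  by (simp add: mem_tclass kernel_closed)

lemma tclass_tval:
  assumes "closed_space V" "closed_space W" "y \<in> tclass V W z" "bilinear_on V W m"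
  shows "tval m y = tval m z"
  using kernel_tval(2)[OF assms(1,2) _ assms(4), of "y - z"] assms(3) by (simp add: mem_tclass)

lemma tclass_pairs:
  assumes "closed_space V" "closed_space W" "y \<in> tclass V W z" "z \<in> pairs V W"
  shows "y \<in> pairs V W"
  using pairs_closed(2)[OF kernel_tval(1)[OF assms(1,2), of "y - z"] assms(4)] assms(3)
  by (simp add: mem_tclass)

lemma tclass_eq_iff:
  assumes "closed_space V" "closed_space W"
  shows "tclass V W z = tclass V W z' \<longleftrightarrow> (\<forall>m. bilinear_on V W m \<longrightarrow> tval m z = tval m z')"
  using tclass_eqI tclass_tval[OF assms] tclass_self by metis

lemma quot_space_simps:
  "carrier (quot_space V W) = a_rcosets\<^bsub>V\<^esub> W" "mult (quot_space V W) = rcoset_mult V W"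
  "one (quot_space V W) = W +>\<^bsub>V\<^esub> \<one>\<^bsub>V\<^esub>" "zero (quot_space V W) = W" "add (quot_space V W) = set_add V"
  "smult (quot_space V W) = (\<lambda>c Q. \<Union>x\<in>Q. W +>\<^bsub>V\<^esub> c \<odot>\<^bsub>V\<^esub> x)"
  by (simp_all add: quot_space_def ring.extend_def module.fields_def FactRing_def)

lemma tensor_carrier: "carrier (tensor V W) = tclass V W ` pairs V W"
  by (auto simp: tensor_def quot_space_simps A_RCOSETS_def RCOSETS_def pair_space_simps tclass_def
      a_r_coset_def)

lemma tensor_zero: "zero (tensor V W) = tclass V W 0"
  using mem_tclass[of _ V W 0] by (auto simp: tensor_def quot_space_simps)

lemma tensor_add: "tclass V W z \<oplus>\<^bsub>tensor V W\<^esub> tclass V W z' = tclass V W (z + z')"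
proof -
  have eq: "tclass V W z \<oplus>\<^bsub>tensor V W\<^esub> tclass V W z'
      = {x + y | x y. x \<in> tclass V W z \<and> y \<in> tclass V W z'}"
    by (simp add: tensor_def quot_space_simps set_add_def set_mult_def pair_space_simps) blast
  show ?thesis
  proof (intro equalityI subsetI)
    fix u assume "u \<in> tclass V W z \<oplus>\<^bsub>tensor V W\<^esub> tclass V W z'"
    then obtain x y where "u = x + y" "x - z \<in> tensor_kernel V W" "y - z' \<in> tensor_kernel V W"
      unfolding eq mem_tclass by blast
    then show "u \<in> tclass V W (z + z')"
      using kernel_closed(2)[of "x - z" V W "y - z'"] by (simp add: mem_tclass algebra_simps)
  next
    fix u assume "u \<in> tclass V W (z + z')"
    then have "u = (u - z') + z'" "(u - z') - z \<in> tensor_kernel V W" "z' - z' \<in> tensor_kernel V W"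
      by (simp_all add: mem_tclass algebra_simps kernel_closed)
    then show "u \<in> tclass V W z \<oplus>\<^bsub>tensor V W\<^esub> tclass V W z'"
      unfolding eq mem_tclass by blast
  qed
qed

lemma tensor_smult: "c \<odot>\<^bsub>tensor V W\<^esub> tclass V W z = tclass V W (pm_scale c z)"
proof -
  have const: "tclass V W (pm_scale c y) = tclass V W (pm_scale c z)" if "y \<in> tclass V W z" for y
  proof -
    have "pm_scale c (y - z) \<in> tensor_kernel V W"
      using that by (intro kernel_closed(3)) (simp add: mem_tclass)
    then have k: "pm_scale c y - pm_scale c z \<in> tensor_kernel V W"
      by (simp add: pm.scale_right_diff_distrib)
    then show ?thesis
      by (rule tclass_eqI_kernel)
  qed
  have "c \<odot>\<^bsub>tensor V W\<^esub> tclass V W z = (\<Union>y\<in>tclass V W z. tclass V W (pm_scale c y))"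
    by (simp only: tensor_def quot_space_simps tclass_def pair_space_simps)
  also have "\<dots> = tclass V W (pm_scale c z)"
    by (rule UN_constant_eq[OF tclass_self]) (rule ballI, rule const)
  finally show ?thesis .
qed

lemma pure_tensor_tclass: "pure_tensor V W v w = tclass V W (single (v, w) 1)"
  by (simp add: pure_tensor_def tclass_def)

lemma abelian_monoid_tensor: "abelian_monoid (tensor V W)"
  by (rule abelian_monoidI) (auto simp: tensor_carrier tensor_add tensor_zero add_ac intro!: imageI)

lemma tensor_finsum:
  assumes "finite K" "\<And>k. k \<in> K \<Longrightarrow> F k = tclass V W (G k)" "\<And>k. k \<in> K \<Longrightarrow> G k \<in> pairs V W"
  shows "(\<Oplus>\<^bsub>tensor V W\<^esub>k\<in>K. F k) = tclass V W (\<Sum>k\<in>K. G k)"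
  using assms
proof (induction K)
  case empty
  then show ?case
    by (simp add: abelian_monoid.finsum_empty[OF abelian_monoid_tensor] tensor_zero)
next
  case (insert k K)
  have "(\<Oplus>\<^bsub>tensor V W\<^esub>k\<in>insert k K. F k) = F k \<oplus>\<^bsub>tensor V W\<^esub> (\<Oplus>\<^bsub>tensor V W\<^esub>k\<in>K. F k)"
    by (rule abelian_monoid.finsum_insert[OF abelian_monoid_tensor])
       (use insert in \<open>auto simp: tensor_carrier\<close>)
  then show ?case
    using insert by (simp add: tensor_add)
qed

context sl2q
begin

section \<open>The quotient algebra\<close>

text \<open>
  As the kernel of the evaluation is the ideal of relations, its fibres are the cosets, that is,
  the elements of the quotient algebra.
\<close>

definition cls :: "'k qop \<Rightarrow> 'k SUq2_el"
  where "cls x = {P. ev P = x}"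

lemma cls_eq: "SUq2_ideal q +>\<^bsub>free_alg\<^esub> P = cls (ev P)"
proof -
  have "R \<in> SUq2_ideal q +>\<^bsub>free_alg\<^esub> P \<longleftrightarrow> R - P \<in> SUq2_ideal q" for R
    by (auto simp: a_r_coset_def r_coset_def) (metis diff_add_cancel)
  then show ?thesis
    by (auto simp: cls_def ev_eq_0_iff[symmetric])
qed

lemma cls_inject [simp]: "x \<in> alg \<Longrightarrow> cls x = cls y \<longleftrightarrow> x = y"
  by (auto simp: cls_def alg_def)

lemma SUq2_carrier: "carrier (SUq2 q) = cls ` alg"
proof -
  have "a_rcosets\<^bsub>free_alg\<^esub> I = range (\<lambda>P. I +>\<^bsub>free_alg\<^esub> P)" for I :: "(gen list \<Rightarrow>\<^sub>0 'k) set"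
    by (auto simp: A_RCOSETS_def RCOSETS_def a_r_coset_def)
  then show ?thesis
    by (simp add: SUq2_def quot_space_simps cls_eq alg_def image_image)
qed

lemma cls_carrier [simp]: "x \<in> alg \<Longrightarrow> cls x \<in> carrier (SUq2 q)"
  by (simp add: SUq2_carrier)

lemma SUq2_one [simp]: "\<one>\<^bsub>SUq2 q\<^esub> = cls 1"
  by (simp add: SUq2_def quot_space_simps cls_eq)

lemma SUq2_zero [simp]: "\<zero>\<^bsub>SUq2 q\<^esub> = cls 0"
  by (auto simp: SUq2_def quot_space_simps cls_def ev_eq_0_iff)

lemma SUq2_add [simp]:
  assumes "x \<in> alg" "y \<in> alg"
  shows "cls x \<oplus>\<^bsub>SUq2 q\<^esub> cls y = cls (x + y)"
proof -
  obtain P where P: "ev P = x"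
    using assms(1) by (auto simp: alg_def)
  have "cls x \<oplus>\<^bsub>SUq2 q\<^esub> cls y = {u + v | u v. ev u = x \<and> ev v = y}"
    by (auto simp: SUq2_def quot_space_simps set_add_def set_mult_def cls_def)
  moreover have "\<exists>u v. R = u + v \<and> ev u = x \<and> ev v = y" if "ev R = x + y" for R
    by (rule exI[of _ P], rule exI[of _ "R - P"]) (simp add: P that)
  ultimately show ?thesis
    by (auto simp: cls_def)
qed

lemma SUq2_mult [simp]:
  assumes "x \<in> alg" "y \<in> alg"
  shows "cls x \<otimes>\<^bsub>SUq2 q\<^esub> cls y = cls (x * y)"
proof -
  obtain P R where "ev P = x" "ev R = y"
    using assms by (auto simp: alg_def)
  moreover have "cls x \<otimes>\<^bsub>SUq2 q\<^esub> cls y = (\<Union>u\<in>cls x. \<Union>v\<in>cls y. cls (ev u * ev v))"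
    by (simp add: SUq2_def quot_space_simps rcoset_mult_def cls_eq)
  ultimately show ?thesis
    by (auto simp: cls_def)
qed

lemma SUq2_smult [simp]:
  assumes "x \<in> alg"
  shows "t \<odot>\<^bsub>SUq2 q\<^esub> cls x = cls (sc t * x)"
proof -
  obtain P where "ev P = x"
    using assms by (auto simp: alg_def)
  moreover have "t \<odot>\<^bsub>SUq2 q\<^esub> cls x = (\<Union>u\<in>cls x. cls (sc t * ev u))"
    by (simp add: SUq2_def quot_space_simps cls_eq)
  ultimately show ?thesis
    by (auto simp: cls_def)
qed

lemma SUq2_carrierE:
  assumes "v \<in> carrier (SUq2 q)"
  obtains x where "x \<in> alg" "v = cls x"
  using assms by (auto simp: SUq2_carrier)

lemma ring_SUq2: "ring (SUq2 q)"
proof (rule ringI)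
  show "abelian_group (SUq2 q)"
  proof (rule abelian_groupI)
    show "\<exists>y\<in>carrier (SUq2 q). y \<oplus>\<^bsub>SUq2 q\<^esub> v = \<zero>\<^bsub>SUq2 q\<^esub>" if "v \<in> carrier (SUq2 q)" for v
    proof -
      obtain x where "x \<in> alg" "v = cls x"
        using \<open>v \<in> carrier (SUq2 q)\<close> by (rule SUq2_carrierE)
      then show ?thesis
        by (intro bexI[of _ "cls (- x)"]) simp_all
    qed
  qed (auto simp: SUq2_carrier add_ac)
  show "monoid (SUq2 q)"
    by (rule monoidI) (auto simp: SUq2_carrier mult.assoc)
qed (auto simp: SUq2_carrier distrib_left distrib_right)

lemma SUq2_uminus [simp]:
  assumes "x \<in> alg"
  shows "\<ominus>\<^bsub>SUq2 q\<^esub> cls x = cls (- x)"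
  using abelian_group.minus_equality[OF ring.is_abelian_group[OF ring_SUq2], of "cls (- x)" "cls x"] assms
  by simp

lemma SUq2_minus [simp]:
  "x \<in> alg \<Longrightarrow> y \<in> alg \<Longrightarrow> cls x \<ominus>\<^bsub>SUq2 q\<^esub> cls y = cls (x - y)"
  by (simp add: a_minus_def)

lemma SUq2_gen_eq [simp]: "SUq2_gen q g = cls (gen_op g)"
  by (simp add: SUq2_gen_def free_gen_eq cls_eq)

lemma closed_SUq2 [simp]: "closed_space (SUq2 q)"
  by (auto simp: closed_space_def SUq2_carrier)

section \<open>The coproduct\<close>

abbreviation (input) tmult where "tmult \<equiv> mult (pair_space (SUq2 q) (SUq2 q))"

lemma tval_tmult:
  "tval m (tmult p r) = tval (\<lambda>v w. tval (\<lambda>v' w'. m (v \<otimes>\<^bsub>SUq2 q\<^esub> v') (w \<otimes>\<^bsub>SUq2 q\<^esub> w')) r) p"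
  by (simp add: pair_space_def free_space_simps tval_sum split_def)
     (simp add: tval_def lin_ext_def split_def sum_distrib_left mult.assoc)

lemma pairs_tmult [simp]:
  assumes "p \<in> pairs (SUq2 q) (SUq2 q)" "r \<in> pairs (SUq2 q) (SUq2 q)"
  shows "tmult p r \<in> pairs (SUq2 q) (SUq2 q)"
proof -
  have m: "v \<otimes>\<^bsub>SUq2 q\<^esub> w \<in> carrier (SUq2 q)" if "v \<in> carrier (SUq2 q)" "w \<in> carrier (SUq2 q)" for v w
    using that by (auto simp: SUq2_carrier)
  show ?thesis
    unfolding pair_space_def free_space_simps
    by (intro pairs_sum) (use assms m in \<open>auto simp: pairs_def split_def subset_iff\<close>)
qed

lemma tval_fun:
  "tval (\<lambda>v w. m v w + m' v w) z = tval m z + tval m' z" "tval (\<lambda>v w. t * m v w) z = t * tval m z"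
  by (simp_all add: tval_def lin_ext_def split_def sum.distrib distrib_left sum_distrib_left
      mult.left_commute)

lemma bilinear_on_mult:
  assumes "bilinear_on (SUq2 q) (SUq2 q) m"
  shows "v \<in> carrier (SUq2 q) \<Longrightarrow> w \<in> carrier (SUq2 q) \<Longrightarrow>
      bilinear_on (SUq2 q) (SUq2 q) (\<lambda>v' w'. m (v \<otimes>\<^bsub>SUq2 q\<^esub> v') (w \<otimes>\<^bsub>SUq2 q\<^esub> w'))"
    and "v \<in> carrier (SUq2 q) \<Longrightarrow> w \<in> carrier (SUq2 q) \<Longrightarrow>
      bilinear_on (SUq2 q) (SUq2 q) (\<lambda>v' w'. m (v' \<otimes>\<^bsub>SUq2 q\<^esub> v) (w' \<otimes>\<^bsub>SUq2 q\<^esub> w))"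
proof -
  have m: "m (cls (x + x')) (cls y) = m (cls x) (cls y) + m (cls x') (cls y)"
    "m (cls x) (cls (y + y')) = m (cls x) (cls y) + m (cls x) (cls y')"
    "m (cls (sc t * x)) (cls y) = t * m (cls x) (cls y)"
    "m (cls x) (cls (sc t * y)) = t * m (cls x) (cls y)"
    if "x \<in> alg" "x' \<in> alg" "y \<in> alg" "y' \<in> alg" for x x' y y' t
    using assms that unfolding bilinear_on_def SUq2_carrier by fastforce+
  show "v \<in> carrier (SUq2 q) \<Longrightarrow> w \<in> carrier (SUq2 q) \<Longrightarrow>
      bilinear_on (SUq2 q) (SUq2 q) (\<lambda>v' w'. m (v \<otimes>\<^bsub>SUq2 q\<^esub> v') (w \<otimes>\<^bsub>SUq2 q\<^esub> w'))"
    by (auto simp: bilinear_on_def SUq2_carrier m distrib_left sc_left_commute)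
  show "v \<in> carrier (SUq2 q) \<Longrightarrow> w \<in> carrier (SUq2 q) \<Longrightarrow>
      bilinear_on (SUq2 q) (SUq2 q) (\<lambda>v' w'. m (v' \<otimes>\<^bsub>SUq2 q\<^esub> v) (w' \<otimes>\<^bsub>SUq2 q\<^esub> w))"
    by (auto simp: bilinear_on_def SUq2_carrier m distrib_right mult.assoc)
qed

lemma bilinear_on_tval:
  assumes m: "bilinear_on (SUq2 q) (SUq2 q) m" and r: "r \<in> pairs (SUq2 q) (SUq2 q)"
  shows "bilinear_on (SUq2 q) (SUq2 q) (\<lambda>v w. tval (\<lambda>v' w'. m (v \<otimes>\<^bsub>SUq2 q\<^esub> v') (w \<otimes>\<^bsub>SUq2 q\<^esub> w')) r)"
proof -
  have B: "m ((v \<oplus>\<^bsub>SUq2 q\<^esub> v') \<otimes>\<^bsub>SUq2 q\<^esub> u) (w \<otimes>\<^bsub>SUq2 q\<^esub> u')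
      = m (v \<otimes>\<^bsub>SUq2 q\<^esub> u) (w \<otimes>\<^bsub>SUq2 q\<^esub> u') + m (v' \<otimes>\<^bsub>SUq2 q\<^esub> u) (w \<otimes>\<^bsub>SUq2 q\<^esub> u')"
    "m (v \<otimes>\<^bsub>SUq2 q\<^esub> u) ((w \<oplus>\<^bsub>SUq2 q\<^esub> w') \<otimes>\<^bsub>SUq2 q\<^esub> u')
      = m (v \<otimes>\<^bsub>SUq2 q\<^esub> u) (w \<otimes>\<^bsub>SUq2 q\<^esub> u') + m (v \<otimes>\<^bsub>SUq2 q\<^esub> u) (w' \<otimes>\<^bsub>SUq2 q\<^esub> u')"
    "m ((t \<odot>\<^bsub>SUq2 q\<^esub> v) \<otimes>\<^bsub>SUq2 q\<^esub> u) (w \<otimes>\<^bsub>SUq2 q\<^esub> u') = t * m (v \<otimes>\<^bsub>SUq2 q\<^esub> u) (w \<otimes>\<^bsub>SUq2 q\<^esub> u')"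
    "m (v \<otimes>\<^bsub>SUq2 q\<^esub> u) ((t \<odot>\<^bsub>SUq2 q\<^esub> w) \<otimes>\<^bsub>SUq2 q\<^esub> u') = t * m (v \<otimes>\<^bsub>SUq2 q\<^esub> u) (w \<otimes>\<^bsub>SUq2 q\<^esub> u')"
    if "u \<in> carrier (SUq2 q)" "u' \<in> carrier (SUq2 q)" "v \<in> carrier (SUq2 q)" "v' \<in> carrier (SUq2 q)"
      "w \<in> carrier (SUq2 q)" "w' \<in> carrier (SUq2 q)" for u u' v v' w w' t
    using bilinear_on_mult(2)[OF m that(1,2)] that(3-) unfolding bilinear_on_def by blast+
  show ?thesis
    unfolding bilinear_on_def tval_fun[symmetric]
    by (intro conjI ballI allI; rule tval_cong[OF r]; rule B; assumption)
qed

text \<open>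
  The product of cosets is a union over representatives. All of them give the same coset, since
  a bilinear form composed with multiplication by a fixed tensor is again a bilinear form.
\<close>

lemma tensor_mult:
  assumes z: "z \<in> pairs (SUq2 q) (SUq2 q)" "z' \<in> pairs (SUq2 q) (SUq2 q)"
  shows "tclass (SUq2 q) (SUq2 q) z \<otimes>\<^bsub>tensor (SUq2 q) (SUq2 q)\<^esub> tclass (SUq2 q) (SUq2 q) z'
    = tclass (SUq2 q) (SUq2 q) (tmult z z')"
proof -
  let ?cl = "tclass (SUq2 q) (SUq2 q)"
  have const: "?cl (tmult u v) = ?cl (tmult z z')" if u: "u \<in> ?cl z" and v: "v \<in> ?cl z'" for u v
  proof (rule tclass_eqI)
    fix m assume m: "bilinear_on (SUq2 q) (SUq2 q) m"
    have vp: "v \<in> pairs (SUq2 q) (SUq2 q)"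
      by (rule tclass_pairs[OF _ _ v z(2)]) simp_all
    have "tval m (tmult u v) = tval m (tmult z v)"
      unfolding tval_tmult by (rule tclass_tval[OF _ _ u bilinear_on_tval[OF m vp]]) simp_all
    also have "\<dots> = tval m (tmult z z')"
      unfolding tval_tmult
      by (rule tval_cong[OF z(1)], rule tclass_tval[OF _ _ v bilinear_on_mult(1)[OF m]]) simp_all
    finally show "tval m (tmult u v) = tval m (tmult z z')" .
  qed
  have "?cl z \<otimes>\<^bsub>tensor (SUq2 q) (SUq2 q)\<^esub> ?cl z' = (\<Union>u\<in>?cl z. \<Union>v\<in>?cl z'. ?cl (tmult u v))"
    by (simp only: tensor_def quot_space_simps rcoset_mult_def tclass_def)
  also have "\<dots> = (\<Union>u\<in>?cl z. ?cl (tmult z z'))"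
    by (rule SUP_cong[OF refl], rule UN_constant_eq[OF tclass_self], rule ballI, rule const)
  also have "\<dots> = ?cl (tmult z z')"
    by (rule UN_constant_eq[OF tclass_self]) simp
  finally show ?thesis .
qed

fun gen_pairs :: "gen \<Rightarrow> ('k SUq2_el \<times> 'k SUq2_el) \<Rightarrow>\<^sub>0 'k" where
  "gen_pairs Al = single (cls a, cls a) 1 + single (cls b, cls c) 1"
| "gen_pairs Be = single (cls a, cls b) 1 + single (cls b, cls d) 1"
| "gen_pairs Ga = single (cls c, cls a) 1 + single (cls d, cls c) 1"
| "gen_pairs De = single (cls c, cls b) 1 + single (cls d, cls d) 1"

lemma gen_pairs [simp]: "gen_pairs g \<in> pairs (SUq2 q) (SUq2 q)"
  by (cases g) simp_all

lemma coproduct_gen_eq: "coproduct_gen q g = tclass (SUq2 q) (SUq2 q) (gen_pairs g)"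
  by (cases g) (simp_all add: pure_tensor_tclass tensor_add)

fun word_pairs :: "gen list \<Rightarrow> ('k SUq2_el \<times> 'k SUq2_el) \<Rightarrow>\<^sub>0 'k" where
  "word_pairs [] = single (cls 1, cls 1) 1"
| "word_pairs (g # w) = tmult (gen_pairs g) (word_pairs w)"

lemma word_pairs [simp]: "word_pairs w \<in> pairs (SUq2 q) (SUq2 q)"
  by (induction w) simp_all

lemma coproduct_word:
  "foldr (\<lambda>g u. coproduct_gen q g \<otimes>\<^bsub>tensor (SUq2 q) (SUq2 q)\<^esub> u) w \<one>\<^bsub>tensor (SUq2 q) (SUq2 q)\<^esub>
    = tclass (SUq2 q) (SUq2 q) (word_pairs w)"
proof (induction w)
  case Nil
  show ?case
    by (simp add: tensor_def quot_space_simps tclass_def) (simp add: pair_space_def free_space_simps)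
next
  case (Cons g w)
  then show ?case
    by (simp add: coproduct_gen_eq tensor_mult)
qed

definition poly_pairs :: "(gen list \<Rightarrow>\<^sub>0 'k) \<Rightarrow> ('k SUq2_el \<times> 'k SUq2_el) \<Rightarrow>\<^sub>0 'k"
  where "poly_pairs P = (\<Sum>w\<in>keys P. pm_scale (lookup P w) (word_pairs w))"

lemma poly_pairs [simp]: "poly_pairs P \<in> pairs (SUq2 q) (SUq2 q)"
  unfolding poly_pairs_def by (rule pairs_sum) simp

lemma coproduct_poly:
  "free_eval (tensor (SUq2 q) (SUq2 q)) (coproduct_gen q) P = tclass (SUq2 q) (SUq2 q) (poly_pairs P)"
  unfolding free_eval_def poly_pairs_def
  by (rule tensor_finsum) (simp_all add: coproduct_word tensor_smult)

end

context podles
begin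

lemma tval_word_pairs:
  assumes n: "\<And>x y. x \<in> alg \<Longrightarrow> y \<in> alg \<Longrightarrow> n x y = m (cls x) (cls y)"
    and "x \<in> alg" "y \<in> alg"
  shows "tval (\<lambda>v w. m (cls x \<otimes>\<^bsub>SUq2 q\<^esub> v) (cls y \<otimes>\<^bsub>SUq2 q\<^esub> w)) (word_pairs w) = foldr coact_gen w n x y"
  using assms(2,3)
proof (induction w arbitrary: x y)
  case Nil
  then show ?case by (simp add: n)
next
  case (Cons g w)
  have step: "tval (\<lambda>v' w'. m (cls x \<otimes>\<^bsub>SUq2 q\<^esub> (cls u \<otimes>\<^bsub>SUq2 q\<^esub> v')) (cls y \<otimes>\<^bsub>SUq2 q\<^esub> (cls u' \<otimes>\<^bsub>SUq2 q\<^esub> w'))) (word_pairs w)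
    = foldr coact_gen w n (x * u) (y * u')" if "u \<in> alg" "u' \<in> alg" for u u'
  proof -
    have "tval (\<lambda>v' w'. m (cls x \<otimes>\<^bsub>SUq2 q\<^esub> (cls u \<otimes>\<^bsub>SUq2 q\<^esub> v')) (cls y \<otimes>\<^bsub>SUq2 q\<^esub> (cls u' \<otimes>\<^bsub>SUq2 q\<^esub> w'))) (word_pairs w)
      = tval (\<lambda>v' w'. m (cls (x * u) \<otimes>\<^bsub>SUq2 q\<^esub> v') (cls (y * u') \<otimes>\<^bsub>SUq2 q\<^esub> w')) (word_pairs w)"
      by (rule tval_cong[OF word_pairs]) (use that Cons.prems in \<open>auto simp: SUq2_carrier mult.assoc\<close>)
    then show ?thesis
      using Cons.IH Cons.prems that by simp
  qed
  show ?case
    by (cases g) (simp_all add: tval_tmult step)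
qed

lemma tval_poly_pairs:
  assumes n: "\<And>x y. x \<in> alg \<Longrightarrow> y \<in> alg \<Longrightarrow> n x y = m (cls x) (cls y)"
  shows "tval m (poly_pairs P) = coact_poly P n 1 1"
proof -
  have "tval m (word_pairs w) = foldr coact_gen w n 1 1" for w
  proof -
    have "tval m (word_pairs w) = tval (\<lambda>v w. m (cls 1 \<otimes>\<^bsub>SUq2 q\<^esub> v) (cls 1 \<otimes>\<^bsub>SUq2 q\<^esub> w)) (word_pairs w)"
      by (rule tval_cong[OF word_pairs]) (auto simp: SUq2_carrier)
    then show ?thesis
      using tval_word_pairs[of n m 1 1, OF n] by simp
  qed
  then show ?thesis
    by (simp add: poly_pairs_def tval_sum coact_poly_def lin_ext_def)
qed

text \<open>
  Composing with a linear projection onto the algebra extends a form to all operators. The last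
  property keeps track of forms that kill a subspace in the second argument.
\<close>

lemma bilinear_on_extend:
  assumes m: "bilinear_on (SUq2 q) (SUq2 q) m"
  obtains n where "bilinear_form n" "\<And>x y. x \<in> alg \<Longrightarrow> y \<in> alg \<Longrightarrow> n x y = m (cls x) (cls y)"
    "\<And>x. \<exists>x'\<in>alg. \<forall>y\<in>alg. n x y = m (cls x') (cls y)"
proof -
  have "op.subspace alg"
    by (rule op.subspaceI) simp_all
  from op.linear_projection_onto[OF this] obtain pr where
    pr: "Vector_Spaces.linear (\<lambda>c x. sc c * x) (\<lambda>c x. sc c * x) pr" "\<And>x. pr x \<in> alg"
      "\<And>x. x \<in> alg \<Longrightarrow> pr x = x"
    by blast
  have pr_lin: "pr (x + y) = pr x + pr y" "pr (sc t * x) = sc t * pr x" for x y t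
    using pr(1) by (simp_all add: Vector_Spaces.linear_iff)
  have m: "m (cls (pr x + pr x')) (cls (pr y)) = m (cls (pr x)) (cls (pr y)) + m (cls (pr x')) (cls (pr y))"
    "m (cls (pr x)) (cls (pr y + pr y')) = m (cls (pr x)) (cls (pr y)) + m (cls (pr x)) (cls (pr y'))"
    "m (cls (sc t * pr x)) (cls (pr y)) = t * m (cls (pr x)) (cls (pr y))"
    "m (cls (pr x)) (cls (sc t * pr y)) = t * m (cls (pr x)) (cls (pr y))" for x x' y y' t
    using m pr(2) unfolding bilinear_on_def SUq2_carrier
    by (metis (no_types, lifting) SUq2_add imageI, metis (no_types, lifting) SUq2_add imageI,
        metis (no_types, lifting) SUq2_smult imageI, metis (no_types, lifting) SUq2_smult imageI)
  show ?thesis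
  proof (rule that[of "\<lambda>x y. m (cls (pr x)) (cls (pr y))"])
    show "bilinear_form (\<lambda>x y. m (cls (pr x)) (cls (pr y)))"
      by (simp add: bilinear_form_def pr_lin pr(2) m)
    show "\<exists>x'\<in>alg. \<forall>y\<in>alg. m (cls (pr x)) (cls (pr y)) = m (cls x') (cls y)" for x
      using pr by (intro bexI[of _ "pr x"]) auto
  qed (simp add: pr(3))
qed

lemma coproduct_eq:
  assumes "x \<in> alg"
  shows "coproduct q (cls x) = tclass (SUq2 q) (SUq2 q) (poly_pairs (lift x))"
proof -
  have const: "tclass (SUq2 q) (SUq2 q) (poly_pairs P) = tclass (SUq2 q) (SUq2 q) (poly_pairs (lift x))"
    if "P \<in> cls x" for P
  proof (rule tclass_eqI)
    fix m assume "bilinear_on (SUq2 q) (SUq2 q) m"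
    then obtain n where n: "bilinear_form n" "\<And>x y. x \<in> alg \<Longrightarrow> y \<in> alg \<Longrightarrow> n x y = m (cls x) (cls y)"
      by (rule bilinear_on_extend) blast
    have "coact_poly P n = coact_poly (lift x) n"
      by (rule act_cong(1)[OF _ n(1)]) (use that assms in \<open>simp add: cls_def\<close>)
    then show "tval m (poly_pairs P) = tval m (poly_pairs (lift x))"
      by (simp add: tval_poly_pairs[of n m, OF n(2)])
  qed
  have "lift x \<in> cls x"
    using assms by (simp add: cls_def)
  then show ?thesis
    unfolding coproduct_def coproduct_poly
    by (rule UN_constant_eq) (rule ballI, rule const)
qed

end

lemma left_moduleD:
  assumes "left_module R M"
  shows "\<lbrakk>a \<in> carrier R; x \<in> carrier M\<rbrakk> \<Longrightarrow> a \<odot>\<^bsub>M\<^esub> x \<in> carrier M"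
    and "\<lbrakk>a \<in> carrier R; b \<in> carrier R; x \<in> carrier M\<rbrakk> \<Longrightarrow>
      (a \<oplus>\<^bsub>R\<^esub> b) \<odot>\<^bsub>M\<^esub> x = a \<odot>\<^bsub>M\<^esub> x \<oplus>\<^bsub>M\<^esub> b \<odot>\<^bsub>M\<^esub> x"
    and "\<lbrakk>a \<in> carrier R; x \<in> carrier M; y \<in> carrier M\<rbrakk> \<Longrightarrow>
      a \<odot>\<^bsub>M\<^esub> (x \<oplus>\<^bsub>M\<^esub> y) = a \<odot>\<^bsub>M\<^esub> x \<oplus>\<^bsub>M\<^esub> a \<odot>\<^bsub>M\<^esub> y"
    and "\<lbrakk>a \<in> carrier R; b \<in> carrier R; x \<in> carrier M\<rbrakk> \<Longrightarrow>
      (a \<otimes>\<^bsub>R\<^esub> b) \<odot>\<^bsub>M\<^esub> x = a \<odot>\<^bsub>M\<^esub> (b \<odot>\<^bsub>M\<^esub> x)"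
  using left_module.axioms(3)[OF assms] unfolding left_module_axioms_def by simp_all

locale podles_sphere = podles q "of_real s" for q :: "'k::real_normed_field" and s :: real
begin

section \<open>The sphere and the quotient coalgebra\<close>

lemma sphere_gens_eq:
  "sphere_xi q s = cls xi" "sphere_eta q s = cls eta" "sphere_zeta q s = cls zeta"
  "row_upper q s = cls u1" "row_lower q s = cls u2"
  by (simp_all add: sphere_xi_def sphere_eta_def sphere_zeta_def row_upper_def row_lower_def Let_def
      xi_def eta_def zeta_def u1_def u2_def)

lemma subring_cls_sphere: "subring (cls ` sphere) (SUq2 q)"
  by (rule ring.subringI[OF ring_SUq2]) (auto simp: sphere_alg intro!: imageI)

lemma qsphere_carrier: "carrier (qsphere q s) = cls ` sphere"
proof -
  let ?S = "{\<one>\<^bsub>SUq2 q\<^esub>, sphere_xi q s, sphere_eta q s, sphere_zeta q s}"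
  have "gen_subalgebra (SUq2 q) ?S \<subseteq> cls ` sphere"
    unfolding gen_subalgebra_def
    by (rule Inter_lower)
       (auto simp: subring_cls_sphere sphere_alg sphere_gens_eq intro!: imageI)
  moreover have "cls x \<in> B"
    if B: "subring B (SUq2 q)" "\<And>t b. b \<in> B \<Longrightarrow> t \<odot>\<^bsub>SUq2 q\<^esub> b \<in> B" "?S \<subseteq> B" and x: "x \<in> sphere" for B x
    using x
  proof induction
    case (sphere_sc t)
    show ?case
      using B(2)[of "cls 1" t] B(3) by simp
  next
    case (sphere_add x y)
    then show ?case
      using subringE(7)[OF B(1), of "cls x" "cls y"] by (simp add: sphere_alg)
  next
    case (sphere_mult x y)
    then show ?case
      using subringE(6)[OF B(1), of "cls x" "cls y"] by (simp add: sphere_alg)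
  qed (use B(3) in \<open>simp_all add: sphere_gens_eq\<close>)
  ultimately show ?thesis
    by (auto simp: qsphere_def gen_subalgebra_def)
qed

lemma qsphere_simps [simp]:
  "mult (qsphere q s) = mult (SUq2 q)" "add (qsphere q s) = add (SUq2 q)"
  "one (qsphere q s) = one (SUq2 q)" "zero (qsphere q s) = zero (SUq2 q)"
  by (simp_all add: qsphere_def)

lemma ring_qsphere: "ring (qsphere q s)"
proof -
  have "qsphere q s = (SUq2 q)\<lparr>carrier := cls ` sphere\<rparr>"
    using qsphere_carrier by (simp add: qsphere_def)
  then show ?thesis
    using ring.subring_is_ring[OF ring_SUq2 subring_cls_sphere] by simp
qed

lemma J_gens_eq: "{sphere_xi q s \<ominus>\<^bsub>SUq2 q\<^esub> of_real s \<odot>\<^bsub>SUq2 q\<^esub> \<one>\<^bsub>SUq2 q\<^esub>,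
      sphere_eta q s \<oplus>\<^bsub>SUq2 q\<^esub> of_real s \<odot>\<^bsub>SUq2 q\<^esub> \<one>\<^bsub>SUq2 q\<^esub>, sphere_zeta q s}
    = {cls (xi - sc (of_real s)), cls (eta + sc (of_real s)), cls zeta}"
  by (simp add: sphere_gens_eq)

lemma J_minimal:
  assumes "T \<subseteq> alg" "xi - sc (of_real s) \<in> T" "eta + sc (of_real s) \<in> T" "zeta \<in> T" "0 \<in> T"
    "\<And>x y. x \<in> T \<Longrightarrow> y \<in> T \<Longrightarrow> x + y \<in> T" "\<And>x. x \<in> T \<Longrightarrow> - x \<in> T"
    "\<And>x y. x \<in> T \<Longrightarrow> y \<in> alg \<Longrightarrow> x * y \<in> T"
  shows "J_ideal q s \<subseteq> cls ` T"
proof -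
  have "subgroup (cls ` T) (add_monoid (SUq2 q))"
  proof (rule subgroup.intro)
    fix v assume "v \<in> cls ` T"
    then obtain x where x: "x \<in> T" "v = cls x" by blast
    have "\<ominus>\<^bsub>SUq2 q\<^esub> v = cls (- x)"
      using x assms(1) by auto
    then show "inv\<^bsub>add_monoid (SUq2 q)\<^esub> v \<in> cls ` T"
      using assms(7)[OF x(1)] by (simp add: a_inv_def)
  qed (use assms(1,5,6) in \<open>auto simp: subset_iff intro!: imageI\<close>)
  then have "right_ideal (cls ` T) (SUq2 q)"
    using assms(1,8) by (auto simp: right_ideal_def additive_subgroup_def SUq2_carrier subset_iff intro!: imageI)
  then show ?thesis
    unfolding J_ideal_def Let_def gen_right_ideal_def J_gens_eq
    by (intro Inter_lower) (use assms(2-4) in auto)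
qed

text \<open>
  The right ideal \<open>J\<close> in the operator model.
\<close>

definition Jt :: "'k qop set" where "Jt = {x \<in> alg. cls x \<in> J_ideal q s}"

lemma Jt_alg: "x \<in> Jt \<Longrightarrow> x \<in> alg"
  by (simp add: Jt_def)

lemma Jt_closed:
  "xi - sc (of_real s) \<in> Jt" "eta + sc (of_real s) \<in> Jt" "zeta \<in> Jt" "0 \<in> Jt"
  "x \<in> Jt \<Longrightarrow> y \<in> Jt \<Longrightarrow> x + y \<in> Jt" "x \<in> Jt \<Longrightarrow> y \<in> alg \<Longrightarrow> x * y \<in> Jt"
proof -
  have J: "v \<in> J_ideal q s \<longleftrightarrow> (\<forall>J. right_ideal J (SUq2 q) \<and> {cls (xi - sc (of_real s)),
      cls (eta + sc (of_real s)), cls zeta} \<subseteq> J \<longrightarrow> v \<in> J)" for v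
    unfolding J_ideal_def Let_def gen_right_ideal_def J_gens_eq by blast
  show "xi - sc (of_real s) \<in> Jt" "eta + sc (of_real s) \<in> Jt" "zeta \<in> Jt"
    by (simp_all add: Jt_def J)
  have zero: "cls 0 \<in> J" if "right_ideal J (SUq2 q)" for J
    using additive_subgroup.zero_closed[of J "SUq2 q"] that by (simp add: right_ideal_def)
  show "0 \<in> Jt"
    using zero by (simp add: Jt_def J)
  have add: "cls (x + y) \<in> J" if "right_ideal J (SUq2 q)" "cls x \<in> J" "cls y \<in> J" "x \<in> alg" "y \<in> alg" for J x y
    using additive_subgroup.a_closed[of J "SUq2 q" "cls x" "cls y"] that by (simp add: right_ideal_def)
  show "x \<in> Jt \<Longrightarrow> y \<in> Jt \<Longrightarrow> x + y \<in> Jt"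
    using add by (auto simp: Jt_def J)
  have mult: "cls (x * y) \<in> J" if "right_ideal J (SUq2 q)" "cls x \<in> J" "x \<in> alg" "y \<in> alg" for J x y
    using that unfolding right_ideal_def by (metis SUq2_mult cls_carrier)
  show "x \<in> Jt \<Longrightarrow> y \<in> alg \<Longrightarrow> x * y \<in> Jt"
    using mult by (auto simp: Jt_def J)
qed

lemma Jt_scale: "x \<in> Jt \<Longrightarrow> sc t * x \<in> Jt"
  using Jt_closed(6)[of x "sc t"] by (simp add: sc_central)

lemma Jt_uminus: "x \<in> Jt \<Longrightarrow> - x \<in> Jt"
  using Jt_scale[of x "- 1"] by (simp add: sc_uminus)

lemma J_ideal_eq: "J_ideal q s = cls ` Jt"
proof
  show "J_ideal q s \<subseteq> cls ` Jt"
    by (rule J_minimal) (simp_all add: Jt_closed Jt_uminus, auto simp: Jt_def)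
qed (auto simp: Jt_def)

lemma mem_C_proj:
  assumes "x \<in> alg"
  shows "C_proj q s (cls x) = cls ` {y \<in> alg. y - x \<in> Jt}"
proof -
  have "C_proj q s (cls x) = (\<lambda>j. cls (j + x)) ` Jt"
    using assms by (auto simp: C_proj_def a_r_coset_def r_coset_def J_ideal_eq Jt_alg)
  also have "\<dots> = cls ` {y \<in> alg. y - x \<in> Jt}"
  proof (intro equalityI subsetI)
    fix v assume "v \<in> (\<lambda>j. cls (j + x)) ` Jt"
    then show "v \<in> cls ` {y \<in> alg. y - x \<in> Jt}"
      using assms Jt_alg by auto
  next
    fix v assume "v \<in> cls ` {y \<in> alg. y - x \<in> Jt}"
    then obtain y where "v = cls ((y - x) + x)" "y - x \<in> Jt"
      by auto
    then show "v \<in> (\<lambda>j. cls (j + x)) ` Jt"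
      by blast
  qed
  finally show ?thesis .
qed

definition pc :: "'k qop \<Rightarrow> 'k SUq2_el set" where "pc x = C_proj q s (cls x)"

lemma pc_eqI:
  assumes "x \<in> alg" "y \<in> alg" "x - y \<in> Jt"
  shows "pc x = pc y"
proof -
  have "z - x \<in> Jt \<longleftrightarrow> z - y \<in> Jt" for z
    using Jt_closed(5)[OF _ assms(3), of "z - x"] Jt_closed(5)[OF _ Jt_uminus[OF assms(3)], of "z - y"]
    by auto
  then show ?thesis
    using assms by (simp add: pc_def mem_C_proj)
qed

lemma pc_self: "x \<in> alg \<Longrightarrow> cls x \<in> pc x"
  by (simp add: pc_def mem_C_proj Jt_closed)

lemma pcE:
  assumes "v \<in> pc x" "x \<in> alg"
  obtains y where "y \<in> alg" "v = cls y" "y - x \<in> Jt"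
  using assms by (auto simp: pc_def mem_C_proj)

lemma C_carrier: "carrier (C_coalg q s) = pc ` alg"
  by (auto simp: C_coalg_def quot_space_simps A_RCOSETS_def RCOSETS_def a_r_coset_def pc_def C_proj_def SUq2_carrier)

lemma C_add:
  assumes "x \<in> alg" "y \<in> alg"
  shows "pc x \<oplus>\<^bsub>C_coalg q s\<^esub> pc y = pc (x + y)"
proof -
  have "pc x \<oplus>\<^bsub>C_coalg q s\<^esub> pc y = (\<Union>u\<in>pc x. \<Union>v\<in>pc y. {u \<oplus>\<^bsub>SUq2 q\<^esub> v})"
    by (simp add: C_coalg_def quot_space_simps set_add_def set_mult_def)
  also have "\<dots> = pc (x + y)"
  proof (intro equalityI subsetI)
    fix w assume "w \<in> (\<Union>u\<in>pc x. \<Union>v\<in>pc y. {u \<oplus>\<^bsub>SUq2 q\<^esub> v})"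
    then obtain u v where uv: "u \<in> pc x" "v \<in> pc y" "w = u \<oplus>\<^bsub>SUq2 q\<^esub> v" by blast
    obtain x' where x': "x' \<in> alg" "u = cls x'" "x' - x \<in> Jt"
      using pcE[OF uv(1) assms(1)] by blast
    obtain y' where y': "y' \<in> alg" "v = cls y'" "y' - y \<in> Jt"
      using pcE[OF uv(2) assms(2)] by blast
    have "(x' + y') - (x + y) \<in> Jt"
      using Jt_closed(5)[OF x'(3) y'(3)] by (simp add: algebra_simps)
    then show "w \<in> pc (x + y)"
      using assms x' y' uv(3) by (simp add: pc_def mem_C_proj)
  next
    fix w assume "w \<in> pc (x + y)"
    then obtain z where z: "z \<in> alg" "w = cls z" "z - (x + y) \<in> Jt"
      using assms by (auto elim: pcE)
    have "w = cls (z - y) \<oplus>\<^bsub>SUq2 q\<^esub> cls y" "cls (z - y) \<in> pc x"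
      using z assms by (simp_all add: pc_def mem_C_proj diff_diff_eq add.commute)
    then show "w \<in> (\<Union>u\<in>pc x. \<Union>v\<in>pc y. {u \<oplus>\<^bsub>SUq2 q\<^esub> v})"
      using pc_self[OF assms(2)] by blast
  qed
  finally show ?thesis .
qed

lemma C_smult:
  assumes "x \<in> alg"
  shows "t \<odot>\<^bsub>C_coalg q s\<^esub> pc x = pc (sc t * x)"
proof -
  have "t \<odot>\<^bsub>C_coalg q s\<^esub> pc x = (\<Union>u\<in>pc x. C_proj q s (t \<odot>\<^bsub>SUq2 q\<^esub> u))"
    by (simp add: C_coalg_def quot_space_simps C_proj_def)
  also have "\<dots> = pc (sc t * x)"
  proof (rule UN_constant_eq[OF pc_self[OF assms]], rule ballI)
    fix u assume "u \<in> pc x"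
    then obtain y where y: "y \<in> alg" "u = cls y" "y - x \<in> Jt"
      using assms by (rule pcE)
    have "pc (sc t * y) = pc (sc t * x)"
      by (rule pc_eqI) (use y assms Jt_scale[OF y(3), of t] in \<open>simp_all add: right_diff_distrib\<close>)
    then show "C_proj q s (t \<odot>\<^bsub>SUq2 q\<^esub> u) = pc (sc t * x)"
      using y by (simp add: pc_def)
  qed
  finally show ?thesis .
qed

lemma closed_C [simp]: "closed_space (C_coalg q s)"
  by (auto simp: closed_space_def C_carrier C_add C_smult)

lemma bilinear_on_C_proj:
  assumes "bilinear_on (SUq2 q) (C_coalg q s) m"
  shows "bilinear_on (SUq2 q) (SUq2 q) (\<lambda>v w. m v (C_proj q s w))"
proof -
  have pc: "C_proj q s (cls x) = pc x" for x
    by (simp add: pc_def)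
  note B = assms[unfolded bilinear_on_def C_carrier SUq2_carrier]
  show ?thesis
    unfolding bilinear_on_def SUq2_carrier
  proof (intro conjI ballI allI; elim imageE)
    fix v w w' x y y' assume xy: "v = cls x" "x \<in> alg" "w = cls y" "y \<in> alg" "w' = cls y'" "y' \<in> alg"
    then have "m (cls x) (pc y \<oplus>\<^bsub>C_coalg q s\<^esub> pc y') = m (cls x) (pc y) + m (cls x) (pc y')"
      using B by blast
    then show "m v (C_proj q s (w \<oplus>\<^bsub>SUq2 q\<^esub> w')) = m v (C_proj q s w) + m v (C_proj q s w')"
      using xy by (simp add: pc C_add)
  next
    fix t v w x y assume xy: "v = cls x" "x \<in> alg" "w = cls y" "y \<in> alg"
    then have "m (cls x) (t \<odot>\<^bsub>C_coalg q s\<^esub> pc y) = t * m (cls x) (pc y)"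
      using B by blast
    then show "m v (C_proj q s (t \<odot>\<^bsub>SUq2 q\<^esub> w)) = t * m v (C_proj q s w)"
      using xy by (simp add: pc C_smult)
  qed (use B in \<open>auto simp: pc\<close>)
qed

section \<open>The coact_genion\<close>

definition push :: "(('k SUq2_el \<times> 'k SUq2_el) \<Rightarrow>\<^sub>0 'k) \<Rightarrow> ('k SUq2_el \<times> 'k SUq2_el set) \<Rightarrow>\<^sub>0 'k"
  where "push z = (\<Sum>k\<in>keys z. pm_scale (lookup z k)
    (single (fst k, C_proj q s (snd k)) 1))"

lemma tval_push: "tval m (push z) = tval (\<lambda>v w. m v (C_proj q s w)) z"
proof -
  have "tval m (push z) = (\<Sum>k\<in>keys z. lookup z k * m (fst k) (C_proj q s (snd k)))"
    by (simp add: push_def tval_sum)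
  then show ?thesis
    by (simp add: tval_def lin_ext_def split_def)
qed

text \<open>
  The union over representatives defining the coaction collapses because every bilinear form on
  \<open>A \<otimes> C\<close> pulls back along \<open>id \<otimes> \<pi>\<close> to one on \<open>A \<otimes> A\<close>.
\<close>

lemma right_coaction_eq:
  assumes "x \<in> alg"
  shows "right_coaction q s (cls x) = tclass (SUq2 q) (C_coalg q s) (push (poly_pairs (lift x)))"
proof -
  have eval: "(\<Oplus>\<^bsub>tensor (SUq2 q) (C_coalg q s)\<^esub>k\<in>keys z. lookup z k
      \<odot>\<^bsub>tensor (SUq2 q) (C_coalg q s)\<^esub> pure_tensor (SUq2 q) (C_coalg q s) (id (fst k)) (C_proj q s (snd k)))
    = tclass (SUq2 q) (C_coalg q s) (push (poly_pairs (lift x)))"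
    if z: "z \<in> tclass (SUq2 q) (SUq2 q) (poly_pairs (lift x))" for z
  proof -
    have zp: "z \<in> pairs (SUq2 q) (SUq2 q)"
      by (rule tclass_pairs[OF _ _ z]) simp_all
    have "(\<Oplus>\<^bsub>tensor (SUq2 q) (C_coalg q s)\<^esub>k\<in>keys z. lookup z k
      \<odot>\<^bsub>tensor (SUq2 q) (C_coalg q s)\<^esub> pure_tensor (SUq2 q) (C_coalg q s) (id (fst k)) (C_proj q s (snd k)))
      = tclass (SUq2 q) (C_coalg q s) (push z)"
      unfolding push_def
    proof (rule tensor_finsum)
      fix k assume "k \<in> keys z"
      then have "fst k \<in> carrier (SUq2 q)" "snd k \<in> carrier (SUq2 q)"
        using zp by (auto simp: pairs_def)
      then have "C_proj q s (snd k) \<in> carrier (C_coalg q s)"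
        by (auto simp: C_carrier pc_def SUq2_carrier)
      then show "pm_scale (lookup z k) (single (fst k, C_proj q s (snd k)) 1)
          \<in> pairs (SUq2 q) (C_coalg q s)"
        using \<open>fst k \<in> carrier (SUq2 q)\<close> by simp
    qed (simp_all add: pure_tensor_tclass tensor_smult)
    also have "\<dots> = tclass (SUq2 q) (C_coalg q s) (push (poly_pairs (lift x)))"
    proof (rule tclass_eqI)
      fix m assume "bilinear_on (SUq2 q) (C_coalg q s) m"
      then show "tval m (push z) = tval m (push (poly_pairs (lift x)))"
        unfolding tval_push by (intro tclass_tval[OF _ _ z bilinear_on_C_proj]) simp_all
    qed
    finally show ?thesis .
  qed
  show ?thesis
    unfolding right_coaction_def tensor_map_def coproduct_eq[OF assms]
    by (rule UN_constant_eq[OF tclass_self]) (rule ballI, rule eval)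
qed

lemma kills_J_Jt:
  assumes n: "kills_J n" and "j \<in> Jt"
  shows "n x j = 0"
proof -
  note B = bilinear_formD[OF kills_J_bilinear[OF n]]
  let ?T = "{y \<in> alg. \<forall>r\<in>alg. \<forall>x. n x (y * r) = 0}"
  have "J_ideal q s \<subseteq> cls ` ?T"
    by (rule J_minimal) (use n in \<open>auto simp: kills_J_def distrib_right B mult.assoc\<close>)
  then have "cls j \<in> cls ` ?T"
    using assms(2) by (auto simp: Jt_def)
  then have "j \<in> ?T"
    using Jt_alg[OF assms(2)] by auto
  then have "n x (j * 1) = 0"
    using alg_gens(2) by blast
  then show ?thesis by simp
qed

text \<open>
  Bilinear forms on \<open>A \<otimes> C\<close> correspond to the forms on \<open>A \<otimes> A\<close> that kill \<open>J\<close>, and these separate the two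
  sides of \<open>\<Delta>\<^sub>P(p) = p \<otimes> g\<close>.
\<close>

lemma line_bundle_iff:
  assumes x: "x \<in> alg"
  shows "cls x \<in> carrier (line_bundle q s) \<longleftrightarrow> (\<forall>n. kills_J n \<longrightarrow> coact x n 1 1 = n x u1)"
proof -
  have "cls x \<in> carrier (line_bundle q s) \<longleftrightarrow>
    tclass (SUq2 q) (C_coalg q s) (push (poly_pairs (lift x)))
      = tclass (SUq2 q) (C_coalg q s) (single (cls x, pc u1) 1)"
    using x by (simp add: line_bundle_def right_coaction_eq pure_tensor_tclass grouplike_def
        sphere_gens_eq pc_def)
  also have "\<dots> \<longleftrightarrow> (\<forall>m. bilinear_on (SUq2 q) (C_coalg q s) m \<longrightarrow>
      tval (\<lambda>v w. m v (C_proj q s w)) (poly_pairs (lift x)) = m (cls x) (pc u1))"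
    by (subst tclass_eq_iff) (simp_all add: tval_push)
  also have "\<dots> \<longleftrightarrow> (\<forall>n. kills_J n \<longrightarrow> coact x n 1 1 = n x u1)"
  proof (intro iffI allI impI)
    fix n assume n: "kills_J n"
      and *: "\<forall>m. bilinear_on (SUq2 q) (C_coalg q s) m \<longrightarrow>
        tval (\<lambda>v w. m v (C_proj q s w)) (poly_pairs (lift x)) = m (cls x) (pc u1)"
    note B = bilinear_formD[OF kills_J_bilinear[OF n]]
    define m where "m v Q = n (ev (SOME P. P \<in> v)) (SOME y. y \<in> alg \<and> cls y \<in> Q)" for v :: "'k SUq2_el" and Q
    have m: "m (cls x) (pc y) = n x y" if xy: "x \<in> alg" "y \<in> alg" for x y
    proof -
      have "(SOME P. P \<in> cls x) \<in> cls x"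
        by (rule someI[of _ "lift x"]) (simp add: cls_def xy)
      then have 1: "ev (SOME P. P \<in> cls x) = x"
        by (simp add: cls_def)
      define z where "z = (SOME z. z \<in> alg \<and> cls z \<in> pc y)"
      have z: "z \<in> alg \<and> cls z \<in> pc y"
        unfolding z_def by (rule someI[of _ y]) (simp add: xy pc_self)
      then obtain z' where "z' \<in> alg" "cls z = cls z'" "z' - y \<in> Jt"
        using xy(2) by (auto elim: pcE)
      then have "z - y \<in> Jt"
        using z by simp
      then have "n x z = n x y"
        using kills_J_Jt[OF n, of "z - y" x] by (simp add: B)
      then show ?thesis
        by (simp add: m_def 1 z_def)
    qed
    have "bilinear_on (SUq2 q) (C_coalg q s) m"
      by (auto simp: bilinear_on_def SUq2_carrier C_carrier C_add C_smult m B)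
    then have "tval (\<lambda>v w. m v (C_proj q s w)) (poly_pairs (lift x)) = n x u1"
      using * x by (simp add: m)
    moreover have "tval (\<lambda>v w. m v (C_proj q s w)) (poly_pairs (lift x)) = coact x n 1 1"
      unfolding coact_def by (rule tval_poly_pairs) (simp add: m pc_def[symmetric])
    ultimately show "coact x n 1 1 = n x u1"
      by simp
  next
    fix m assume m: "bilinear_on (SUq2 q) (C_coalg q s) m"
      and *: "\<forall>n. kills_J n \<longrightarrow> coact x n 1 1 = n x u1"
    obtain n where n: "bilinear_form n" "\<And>x y. x \<in> alg \<Longrightarrow> y \<in> alg \<Longrightarrow> n x y = m (cls x) (C_proj q s (cls y))"
      "\<And>x. \<exists>x'\<in>alg. \<forall>y\<in>alg. n x y = m (cls x') (C_proj q s (cls y))"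
      by (rule bilinear_on_extend[OF bilinear_on_C_proj[OF m]]) blast
    have zero: "n x j = 0" if "j \<in> Jt" for x j
    proof -
      obtain x' where x': "\<forall>y\<in>alg. n x y = m (cls x') (C_proj q s (cls y))"
        using n(3) by blast
      have "pc j = pc 0"
        by (rule pc_eqI) (use that Jt_alg in auto)
      then have "n x j = n x 0"
        using x' Jt_alg[OF that] by (simp add: pc_def)
      then show ?thesis
        by (simp add: bilinear_formD[OF n(1)])
    qed
    have "kills_J n"
      unfolding kills_J_def using n(1) zero Jt_closed(1,2,3,6) by blast
    then have "coact x n 1 1 = n x u1"
      using * by blast
    moreover have "tval (\<lambda>v w. m v (C_proj q s w)) (poly_pairs (lift x)) = coact x n 1 1"
      unfolding coact_def by (rule tval_poly_pairs) (simp add: n(2))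
    ultimately show "tval (\<lambda>v w. m v (C_proj q s w)) (poly_pairs (lift x)) = m (cls x) (pc u1)"
      using n(2)[OF x, of u1] by (simp add: pc_def)
  qed
  finally show ?thesis .
qed

section \<open>The line bundle\<close>

definition v1 :: "'k qop" where "v1 = sc (inverse (1 + (of_real s)\<^sup>2)) * w1"
definition v2 :: "'k qop" where "v2 = sc (inverse (1 + (of_real s)\<^sup>2)) * w2"

lemma v_alg [simp]: "v1 \<in> alg" "v2 \<in> alg"
  by (simp_all add: v1_def v2_def)

lemma vu: "v1 * u1 + v2 * u2 = 1"
proof -
  have "v1 * u1 + v2 * u2 = sc (inverse (1 + (of_real s)\<^sup>2)) * (w1 * u1 + w2 * u2)"
    by (simp add: v1_def v2_def distrib_left mult.assoc)
  then show ?thesis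
    using \<sigma> by (simp add: wu sc_mult[symmetric])
qed

lemma uv_sphere: "u1 * v1 \<in> sphere" "u1 * v2 \<in> sphere" "u2 * v1 \<in> sphere" "u2 * v2 \<in> sphere"
  unfolding v1_def v2_def sc_left_commute[of u1] sc_left_commute[of u2] uw by simp_all

lemma recover_row: "p = p * v1 * u1 + p * v2 * u2"
proof -
  have "p * v1 * u1 + p * v2 * u2 = p * (v1 * u1 + v2 * u2)"
    by (simp add: distrib_left mult.assoc)
  then show ?thesis
    by (simp add: vu)
qed

definition rows :: "'k qop set" where "rows = {x * u1 + y * u2 | x y. x \<in> sphere \<and> y \<in> sphere}"

lemma rowsI: "x \<in> sphere \<Longrightarrow> y \<in> sphere \<Longrightarrow> x * u1 + y * u2 \<in> rows"
  by (auto simp: rows_def)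

lemma rows_iff: "p \<in> rows \<longleftrightarrow> p * v1 \<in> sphere \<and> p * v2 \<in> sphere"
proof
  assume "p \<in> rows"
  then obtain x y where "p = x * u1 + y * u2" "x \<in> sphere" "y \<in> sphere"
    by (auto simp: rows_def)
  then show "p * v1 \<in> sphere \<and> p * v2 \<in> sphere"
    by (simp add: distrib_right mult.assoc uv_sphere)
next
  assume "p * v1 \<in> sphere \<and> p * v2 \<in> sphere"
  then have "p * v1 * u1 + p * v2 * u2 \<in> rows"
    by (simp add: rowsI)
  then show "p \<in> rows"
    by (simp only: recover_row[symmetric])
qed

lemma rows_v: "p \<in> rows \<Longrightarrow> p * v1 \<in> sphere" "p \<in> rows \<Longrightarrow> p * v2 \<in> sphere"
  by (simp_all add: rows_iff)

lemma rows_alg: "p \<in> rows \<Longrightarrow> p \<in> alg"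
  by (auto simp: rows_def sphere_alg)

lemma rows_closed [simp]:
  "0 \<in> rows" "p \<in> rows \<Longrightarrow> p' \<in> rows \<Longrightarrow> p + p' \<in> rows" "p \<in> rows \<Longrightarrow> - p \<in> rows"
  "z \<in> sphere \<Longrightarrow> p \<in> rows \<Longrightarrow> z * p \<in> rows" "u1 \<in> rows" "u2 \<in> rows"
  by (simp_all add: rows_iff distrib_right mult.assoc uv_sphere)

lemma line_bundle_carrier: "carrier (line_bundle q s) = cls ` rows"
proof
  show "carrier (line_bundle q s) \<subseteq> cls ` rows"
  proof
    fix v assume v: "v \<in> carrier (line_bundle q s)"
    then have "v \<in> carrier (SUq2 q)"
      by (simp add: line_bundle_def)
    then obtain p where p: "p \<in> alg" "v = cls p"
      by (rule SUq2_carrierE)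
    then have "\<And>n. kills_J n \<Longrightarrow> coact p n 1 1 = n p u1"
      using v line_bundle_iff by blast
    from coinvariant_imp_row[OF p(1) this] have "p * w1 \<in> sphere" "p * w2 \<in> sphere"
      by blast+
    then have "p * v1 \<in> sphere" "p * v2 \<in> sphere"
      by (simp_all add: v1_def v2_def sc_left_commute[of p])
    then show "v \<in> cls ` rows"
      by (simp add: p(2) rows_iff)
  qed
  show "cls ` rows \<subseteq> carrier (line_bundle q s)"
    by (auto simp: rows_def line_bundle_iff sphere_alg coact_row)
qed

lemma line_bundle_simps [simp]:
  "zero (line_bundle q s) = zero (SUq2 q)" "add (line_bundle q s) = add (SUq2 q)"
  "smult (line_bundle q s) = mult (SUq2 q)"
  by (simp_all add: line_bundle_def)

lemma left_module_line_bundle: "left_module (qsphere q s) (line_bundle q s)"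
proof (intro left_module.intro left_module_axioms.intro ring_qsphere)
  show "abelian_group (line_bundle q s)"
  proof (rule abelian_groupI)
    show "\<exists>y\<in>carrier (line_bundle q s). y \<oplus>\<^bsub>line_bundle q s\<^esub> v = \<zero>\<^bsub>line_bundle q s\<^esub>"
      if v: "v \<in> carrier (line_bundle q s)" for v
    proof -
      obtain p where "p \<in> rows" "v = cls p"
        using v by (auto simp: line_bundle_carrier)
      then show ?thesis
        by (intro bexI[of _ "cls (- p)"]) (simp_all add: rows_alg line_bundle_carrier)
    qed
  qed (auto simp: line_bundle_carrier rows_alg add_ac intro!: imageI)
qed (auto simp: line_bundle_carrier qsphere_carrier rows_alg sphere_alg distrib_left distrib_right
      mult.assoc intro!: imageI)

lemma u1_neq_u2: "u1 \<noteq> u2"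
proof
  assume "u1 = u2"
  then have "cf u1 (1, 1, 0) = cf u2 (1, 1, 0)"
    by simp
  then show False
    by (simp add: u1_def u2_def a_def b_def c_def d_def cf_mon)
qed

lemma line_bundle_finitely_generated: "left_finitely_generated (qsphere q s) (line_bundle q s)"
  unfolding left_finitely_generated_def
proof (intro exI[of _ "{cls u1, cls u2}"] conjI ballI)
  show "{cls u1, cls u2} \<subseteq> carrier (line_bundle q s)"
    by (simp add: line_bundle_carrier)
  fix v assume "v \<in> carrier (line_bundle q s)"
  then obtain p where p: "p \<in> rows" "v = cls p"
    by (auto simp: line_bundle_carrier)
  define t where "t v = (if v = cls u1 then cls (p * v1) else cls (p * v2))" for v
  have t: "t (cls u1) = cls (p * v1)" "t (cls u2) = cls (p * v2)"
    using u1_neq_u2 by (auto simp: t_def)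
  interpret L: abelian_group "line_bundle q s"
    by (rule left_module.axioms(2)[OF left_module_line_bundle])
  note pv = rows_v[OF p(1)]
  have c: "cls (p * v1 * u1) \<in> carrier (line_bundle q s)" "cls (p * v2 * u2) \<in> carrier (line_bundle q s)"
    using pv by (simp_all add: line_bundle_carrier)
  have "(\<Oplus>\<^bsub>line_bundle q s\<^esub>x\<in>{cls u1, cls u2}. t x \<odot>\<^bsub>line_bundle q s\<^esub> x) = cls (p * v1 * u1) \<oplus>\<^bsub>line_bundle q s\<^esub> cls (p * v2 * u2)"
    using c u1_neq_u2 pv by (simp add: t sphere_alg)
  also have "\<dots> = v"
    using recover_row[of p] pv by (simp add: p(2) sphere_alg)
  finally have "v = (\<Oplus>\<^bsub>line_bundle q s\<^esub>x\<in>{cls u1, cls u2}. t x \<odot>\<^bsub>line_bundle q s\<^esub> x)" ..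
  moreover have "t \<in> {cls u1, cls u2} \<rightarrow> carrier (qsphere q s)"
    using pv by (auto simp: t qsphere_carrier)
  ultimately show "\<exists>c\<in>{cls u1, cls u2} \<rightarrow> carrier (qsphere q s).
      v = (\<Oplus>\<^bsub>line_bundle q s\<^esub>x\<in>{cls u1, cls u2}. c x \<odot>\<^bsub>line_bundle q s\<^esub> x)"
    by blast
qed simp

text \<open>
  A map out of the line bundle is lifted by choosing preimages \<open>n\<^sub>1\<close>, \<open>n\<^sub>2\<close> of the images of \<open>u\<^sub>1\<close>, \<open>u\<^sub>2\<close> and
  sending \<open>p\<close> to \<open>(p v\<^sub>1) n\<^sub>1 + (p v\<^sub>2) n\<^sub>2\<close>.
\<close>

lemma line_bundle_projective:
  "left_projective TYPE('n) TYPE('p) (qsphere q s) (line_bundle q s)"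
  unfolding left_projective_def
proof (intro allI impI ballI)
  fix N :: "('k SUq2_el, 'n) module" and P :: "('k SUq2_el, 'p) module" and g f
  assume NP: "left_module (qsphere q s) N \<and> left_module (qsphere q s) P"
    and g: "g \<in> left_hom (qsphere q s) N P" "g ` carrier N = carrier P"
    and f: "f \<in> left_hom (qsphere q s) (line_bundle q s) P"
  interpret N: abelian_group N
    using NP left_module.axioms(2) by blast
  note Na = left_moduleD[OF conjunct1[OF NP]]
  have sphere_c: "cls x \<in> carrier (qsphere q s)" if "x \<in> sphere" for x
    using that by (simp add: qsphere_carrier)
  have smult_closed: "cls x \<odot>\<^bsub>N\<^esub> n \<in> carrier N" if "x \<in> sphere" "n \<in> carrier N" for x n
    using Na(1) sphere_c that by simp
  have smult_add: "cls (x + y) \<odot>\<^bsub>N\<^esub> n = cls x \<odot>\<^bsub>N\<^esub> n \<oplus>\<^bsub>N\<^esub> cls y \<odot>\<^bsub>N\<^esub> n"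
    and smult_mult: "cls (x * y) \<odot>\<^bsub>N\<^esub> n = cls x \<odot>\<^bsub>N\<^esub> (cls y \<odot>\<^bsub>N\<^esub> n)"
    if "x \<in> sphere" "y \<in> sphere" "n \<in> carrier N" for x y n
  proof -
    have "(cls x \<oplus>\<^bsub>SUq2 q\<^esub> cls y) \<odot>\<^bsub>N\<^esub> n = cls x \<odot>\<^bsub>N\<^esub> n \<oplus>\<^bsub>N\<^esub> cls y \<odot>\<^bsub>N\<^esub> n"
      "(cls x \<otimes>\<^bsub>SUq2 q\<^esub> cls y) \<odot>\<^bsub>N\<^esub> n = cls x \<odot>\<^bsub>N\<^esub> (cls y \<odot>\<^bsub>N\<^esub> n)"
      using Na(2,4)[OF sphere_c sphere_c] that by simp_all
    then show "cls (x + y) \<odot>\<^bsub>N\<^esub> n = cls x \<odot>\<^bsub>N\<^esub> n \<oplus>\<^bsub>N\<^esub> cls y \<odot>\<^bsub>N\<^esub> n"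
      "cls (x * y) \<odot>\<^bsub>N\<^esub> n = cls x \<odot>\<^bsub>N\<^esub> (cls y \<odot>\<^bsub>N\<^esub> n)"
      using that by (simp_all add: sphere_alg)
  qed
  have smult_distrib: "cls x \<odot>\<^bsub>N\<^esub> (n \<oplus>\<^bsub>N\<^esub> n') = cls x \<odot>\<^bsub>N\<^esub> n \<oplus>\<^bsub>N\<^esub> cls x \<odot>\<^bsub>N\<^esub> n'"
    if "x \<in> sphere" "n \<in> carrier N" "n' \<in> carrier N" for x n n'
    using Na(3) sphere_c that by simp
  note smult = smult_closed smult_add smult_mult smult_distrib
  have g_add: "g (n \<oplus>\<^bsub>N\<^esub> n') = g n \<oplus>\<^bsub>P\<^esub> g n'" if "n \<in> carrier N" "n' \<in> carrier N" for n n'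
    using g(1) that by (simp add: left_hom_def)
  have g_smult: "g (cls x \<odot>\<^bsub>N\<^esub> n) = cls x \<odot>\<^bsub>P\<^esub> g n" if "n \<in> carrier N" "x \<in> sphere" for n x
    using g(1) that by (simp add: left_hom_def qsphere_carrier)
  have f_add: "f (cls (p + p')) = f (cls p) \<oplus>\<^bsub>P\<^esub> f (cls p')" if "p \<in> rows" "p' \<in> rows" for p p'
    using f that unfolding left_hom_def by (auto simp: line_bundle_carrier rows_alg)
  have f_smult: "f (cls (x * p)) = cls x \<odot>\<^bsub>P\<^esub> f (cls p)" if "p \<in> rows" "x \<in> sphere" for p x
    using f that unfolding left_hom_def
    by (auto simp: qsphere_carrier line_bundle_carrier rows_alg sphere_alg)
  have fu: "f (cls u1) \<in> g ` carrier N" "f (cls u2) \<in> g ` carrier N"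
    using f unfolding g(2) by (auto simp: left_hom_def line_bundle_carrier)
  obtain n1 where n1: "n1 \<in> carrier N" "g n1 = f (cls u1)"
    using fu(1) by fastforce
  obtain n2 where n2: "n2 \<in> carrier N" "g n2 = f (cls u2)"
    using fu(2) by fastforce
  note n = n1 n2
  define h where "h v = (v \<otimes>\<^bsub>SUq2 q\<^esub> cls v1) \<odot>\<^bsub>N\<^esub> n1 \<oplus>\<^bsub>N\<^esub> (v \<otimes>\<^bsub>SUq2 q\<^esub> cls v2) \<odot>\<^bsub>N\<^esub> n2" for v
  have h: "h (cls p) = cls (p * v1) \<odot>\<^bsub>N\<^esub> n1 \<oplus>\<^bsub>N\<^esub> cls (p * v2) \<odot>\<^bsub>N\<^esub> n2" if "p \<in> rows" for p
    using that by (simp add: h_def rows_alg)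
  have "h \<in> left_hom (qsphere q s) (line_bundle q s) N"
    unfolding left_hom_def
  proof (intro CollectI conjI ballI Pi_I; unfold line_bundle_carrier qsphere_carrier; elim imageE)
    fix v p assume v: "v = cls p" "p \<in> rows"
    show "h v \<in> carrier N"
      using v n rows_v smult by (simp add: h)
    fix v' p' assume v': "v' = cls p'" "p' \<in> rows"
    show "h (v \<oplus>\<^bsub>line_bundle q s\<^esub> v') = h v \<oplus>\<^bsub>N\<^esub> h v'"
      using v v' n rows_v smult
      by (simp add: rows_alg h distrib_right N.a_ac)
  next
    fix z x v p assume v: "z = cls x" "x \<in> sphere" "v = cls p" "p \<in> rows"
    then show "h (z \<odot>\<^bsub>line_bundle q s\<^esub> v) = z \<odot>\<^bsub>N\<^esub> h v"
      using n rows_v smult by (simp add: rows_alg sphere_alg h mult.assoc)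
  qed
  moreover have "g (h v) = f v" if v: "v \<in> carrier (line_bundle q s)" for v
  proof -
    obtain p where p: "p \<in> rows" "v = cls p"
      using v by (auto simp: line_bundle_carrier)
    note pv = rows_v[OF p(1)]
    have "g (h v) = cls (p * v1) \<odot>\<^bsub>P\<^esub> f (cls u1) \<oplus>\<^bsub>P\<^esub> cls (p * v2) \<odot>\<^bsub>P\<^esub> f (cls u2)"
      using p pv n smult by (simp add: h g_add g_smult)
    also have "\<dots> = f (cls (p * v1 * u1 + p * v2 * u2))"
      using pv by (simp add: f_add f_smult)
    finally show ?thesis
      using recover_row[of p] p(2) by simp
  qed
  ultimately show "\<exists>h\<in>left_hom (qsphere q s) (line_bundle q s) N. \<forall>m\<in>carrier (line_bundle q s). g (h m) = f m"
    by blast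
qed

section \<open>The idempotent\<close>

lemma e_matrix_eq: "e_matrix q s = ((cls (u1 * v1), cls (u1 * v2)), (cls (u2 * v1), cls (u2 * v2)))"
proof -
  have "u1 * v1 = sc (inverse (1 + (of_real s)\<^sup>2)) * (1 - zeta)"
    "u1 * v2 = sc (inverse (1 + (of_real s)\<^sup>2)) * xi" "u2 * v1 = sc (inverse (1 + (of_real s)\<^sup>2)) * (- eta)"
    "u2 * v2 = sc (inverse (1 + (of_real s)\<^sup>2)) * (sc ((of_real s)\<^sup>2) + sc (inverse (q\<^sup>2)) * zeta)"
    unfolding v1_def v2_def sc_left_commute[of u1] sc_left_commute[of u2] uw by simp_all
  then show ?thesis
    by (simp add: e_matrix_def Let_def sphere_gens_eq)
qed

text \<open>
  The row \<open>(p v\<^sub>1, p v\<^sub>2)\<close> equals \<open>(x, y) e\<close> for \<open>p = x u\<^sub>1 + y u\<^sub>2\<close>.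
\<close>

definition srow :: "'k qop \<Rightarrow> 'k SUq2_el \<times> 'k SUq2_el"
  where "srow p = (cls (p * v1), cls (p * v2))"

lemma row_times_e:
  assumes "x \<in> sphere" "y \<in> sphere"
  shows "row_times (qsphere q s) (cls x, cls y) (e_matrix q s) = srow (x * u1 + y * u2)"
  using assms by (simp add: e_matrix_eq srow_def sphere_alg uv_sphere distrib_right mult.assoc)

lemma row_module_carrier: "carrier (row_module (qsphere q s) (e_matrix q s)) = srow ` rows"
proof -
  have "carrier (row_module (qsphere q s) (e_matrix q s))
      = {row_times (qsphere q s) (cls x, cls y) (e_matrix q s) | x y. x \<in> sphere \<and> y \<in> sphere}"
    unfolding row_module_def qsphere_carrier by auto
  also have "\<dots> = srow ` rows"
    by (force simp: rows_def row_times_e)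
  finally show ?thesis .
qed

lemma row_module_ops:
  "zero (row_module (qsphere q s) (e_matrix q s)) = srow 0"
  "p \<in> rows \<Longrightarrow> p' \<in> rows \<Longrightarrow> srow p \<oplus>\<^bsub>row_module (qsphere q s) (e_matrix q s)\<^esub> srow p' = srow (p + p')"
  "z \<in> sphere \<Longrightarrow> p \<in> rows \<Longrightarrow> cls z \<odot>\<^bsub>row_module (qsphere q s) (e_matrix q s)\<^esub> srow p = srow (z * p)"
  by (simp_all add: row_module_def srow_def rows_alg sphere_alg distrib_right mult.assoc)

lemma left_module_row_module: "left_module (qsphere q s) (row_module (qsphere q s) (e_matrix q s))"
proof (intro left_module.intro left_module_axioms.intro ring_qsphere)
  let ?M = "row_module (qsphere q s) (e_matrix q s)"
  show "abelian_group ?M"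
  proof (rule abelian_groupI)
    show "\<exists>y\<in>carrier ?M. y \<oplus>\<^bsub>?M\<^esub> v = \<zero>\<^bsub>?M\<^esub>" if v: "v \<in> carrier ?M" for v
    proof -
      obtain p where "p \<in> rows" "v = srow p"
        using v by (auto simp: row_module_carrier)
      then show ?thesis
        by (intro bexI[of _ "srow (- p)"]) (simp_all add: row_module_ops row_module_carrier)
    qed
  qed (auto simp: row_module_carrier row_module_ops add_ac intro!: imageI)
qed (auto simp: row_module_carrier row_module_ops qsphere_carrier sphere_alg distrib_left distrib_right
      mult.assoc intro!: imageI)

lemma e_matrix_entries: "case e_matrix q s of ((e11, e12), (e21, e22)) \<Rightarrow>
    {e11, e12, e21, e22} \<subseteq> carrier (qsphere q s)"
  by (simp add: e_matrix_eq qsphere_carrier uv_sphere)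

lemma e_matrix_idempotent: "mat_times (qsphere q s) (e_matrix q s) (e_matrix q s) = e_matrix q s"
proof -
  have "u1 * v1 * u1 + u1 * v2 * u2 = u1" "u2 * v1 * u1 + u2 * v2 * u2 = u2"
    using recover_row by simp_all
  then have "row_times (qsphere q s) (cls (u1 * v1), cls (u1 * v2)) (e_matrix q s) = srow u1"
    "row_times (qsphere q s) (cls (u2 * v1), cls (u2 * v2)) (e_matrix q s) = srow u2"
    using row_times_e uv_sphere by metis+
  then show ?thesis
    by (subst (1 3) e_matrix_eq) (simp add: srow_def)
qed

lemma row_module_iso:
  "\<exists>\<Theta>. (\<forall>x\<in>carrier (qsphere q s). \<forall>y\<in>carrier (qsphere q s).
        \<Theta> (row_times (qsphere q s) (x, y) (e_matrix q s)) =
          x \<otimes>\<^bsub>SUq2 q\<^esub> row_upper q s \<oplus>\<^bsub>SUq2 q\<^esub> y \<otimes>\<^bsub>SUq2 q\<^esub> row_lower q s)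
    \<and> \<Theta> \<in> left_iso (qsphere q s) (row_module (qsphere q s) (e_matrix q s)) (line_bundle q s)"
proof (intro exI conjI ballI)
  define \<Theta> where "\<Theta> = (\<lambda>(v, w). v \<otimes>\<^bsub>SUq2 q\<^esub> cls u1 \<oplus>\<^bsub>SUq2 q\<^esub> w \<otimes>\<^bsub>SUq2 q\<^esub> cls u2)"
  have \<Theta>: "\<Theta> (srow p) = cls p" if "p \<in> rows" for p
    using that recover_row[of p] by (simp add: \<Theta>_def srow_def rows_alg)
  show "\<Theta> (row_times (qsphere q s) (v, w) (e_matrix q s)) =
      v \<otimes>\<^bsub>SUq2 q\<^esub> row_upper q s \<oplus>\<^bsub>SUq2 q\<^esub> w \<otimes>\<^bsub>SUq2 q\<^esub> row_lower q s"
    if vw: "v \<in> carrier (qsphere q s)" "w \<in> carrier (qsphere q s)" for v w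
  proof -
    obtain x y where "x \<in> sphere" "v = cls x" "y \<in> sphere" "w = cls y"
      using vw by (auto simp: qsphere_carrier)
    then show ?thesis
      by (simp add: row_times_e \<Theta> rowsI sphere_gens_eq sphere_alg)
  qed
  show "\<Theta> \<in> left_iso (qsphere q s) (row_module (qsphere q s) (e_matrix q s)) (line_bundle q s)"
    unfolding left_iso_def left_hom_def bij_betw_def inj_on_def
    by (auto simp: row_module_carrier line_bundle_carrier qsphere_carrier row_module_ops \<Theta> rows_alg
        sphere_alg image_image)
qed

end

theorem mainTheorem1:
  fixes q :: "'k::real_normed_field" and s :: real
  assumes "q \<noteq> 0" and "s \<in> {0..1}"
  shows "left_module (qsphere q s) (line_bundle q s)
    \<and> left_finitely_generated (qsphere q s) (line_bundle q s)
    \<and> left_projective TYPE('n) TYPE('p) (qsphere q s) (line_bundle q s)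
    \<and> (case e_matrix q s of ((a, b), (c, d)) \<Rightarrow> {a, b, c, d} \<subseteq> carrier (qsphere q s))
    \<and> mat_times (qsphere q s) (e_matrix q s) (e_matrix q s) = e_matrix q s
    \<and> left_module (qsphere q s) (row_module (qsphere q s) (e_matrix q s))
    \<and> (\<exists>\<Theta>. (\<forall>x\<in>carrier (qsphere q s). \<forall>y\<in>carrier (qsphere q s).
              \<Theta> (row_times (qsphere q s) (x, y) (e_matrix q s)) =
                x \<otimes>\<^bsub>SUq2 q\<^esub> row_upper q s \<oplus>\<^bsub>SUq2 q\<^esub> y \<otimes>\<^bsub>SUq2 q\<^esub> row_lower q s)
          \<and> \<Theta> \<in> left_iso (qsphere q s)
              (row_module (qsphere q s) (e_matrix q s)) (line_bundle q s))"
proof -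
  have "1 + s\<^sup>2 > 0"
    by (simp add: add_pos_nonneg)
  then have "(of_real (1 + s\<^sup>2) :: 'k) \<noteq> 0"
    by (metis of_real_eq_0_iff less_irrefl)
  then interpret podles_sphere q s
    using assms(1) by unfold_locales simp_all
  show ?thesis
    by (intro conjI left_module_line_bundle line_bundle_finitely_generated line_bundle_projective
        e_matrix_entries e_matrix_idempotent left_module_row_module row_module_iso)
qed

end
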